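(* Let $H$ be a Hilbert space (not necessarily separable) and let $\mathcal L$ be a commutative subspace lattice (CSL) on $H$. Then there is a smallest element (with respect to inclusion) in the class of all ultraweakly closed algebras $\mathcal A\subseteq B(H)$ such that $\operatorname{lat}\mathcal A=\mathcal L$ and $\mathcal L'\subseteq\mathcal A$.
   Context: A commutative subspace lattice is a strongly closed lattice of mutually commuting orthogonal projections on $H$ containing $0$ and $1$. $\operatorname{lat}\mathcal A$ is the set of orthogonal projections onto closed subspaces $L\subseteq H$ with $TL\subseteq L$ for all $T\in\mathcal A$. $\mathcal L'$ is the commutant of $\mathcal L$ in $B(H)$. *)

theory Defs
  imports "HOL-Analysis.Analysis"
begin

section \<open>Complex Hilbert spaces\<close>

class complex_vector = real_vector +
  fixes scaleC :: "complex \<Rightarrow> 'a \<Rightarrow> 'a"  (infixr "*\<^sub>C" 75)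
  assumes scaleC_add_right: "c *\<^sub>C (x + y) = c *\<^sub>C x + c *\<^sub>C y"
    and scaleC_add_left: "(c + d) *\<^sub>C x = c *\<^sub>C x + d *\<^sub>C x"
    and scaleC_scaleC: "c *\<^sub>C (d *\<^sub>C x) = (c * d) *\<^sub>C x"
    and scaleC_of_real: "complex_of_real r *\<^sub>C x = r *\<^sub>R x"

text \<open>The inner product is linear in the first argument.  Since the left-hand side of
  \<open>cinner_self\<close> is a square of a norm, that axiom also gives positive definiteness.\<close>

class complex_inner = complex_vector + real_normed_vector +
  fixes cinner :: "'a \<Rightarrow> 'a \<Rightarrow> complex"
  assumes cinner_commute: "cinner x y = cnj (cinner y x)"
    and cinner_add_left: "cinner (x + y) z = cinner x z + cinner y z"
    and cinner_scaleC_left: "cinner (c *\<^sub>C x) y = c * cinner x y"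
    and cinner_self: "complex_of_real ((norm x)\<^sup>2) = cinner x x"

class complex_hilbert_space = complex_inner + complete_space

lemma norm_scaleC: "norm (c *\<^sub>C x) = cmod c * norm x" for x :: "'a::complex_inner"
proof -
  have right: "cinner x (c *\<^sub>C y) = cnj c * cinner x y" for x y :: 'a
    by (metis cinner_commute cinner_scaleC_left complex_cnj_mult)
  have "complex_of_real ((norm (c *\<^sub>C x))\<^sup>2) = c * cnj c * cinner x x"
    by (simp only: cinner_self cinner_scaleC_left right mult_ac)
  also have "\<dots> = complex_of_real ((cmod c * norm x)\<^sup>2)"
    by (simp add: complex_norm_square[symmetric] cinner_self[symmetric] power_mult_distrib)
  finally have "(norm (c *\<^sub>C x))\<^sup>2 = (cmod c * norm x)\<^sup>2"
    by (simp only: of_real_eq_iff)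
  then show ?thesis
    by (simp add: power2_eq_iff_nonneg)
qed


section \<open>Bounded operators\<close>

text \<open>The type of bounded linear functions in the library consists of the real-linear ones;
  \<open>bounded_ops\<close> is \<open>B(H)\<close>.\<close>

definition bounded_ops :: "('a::complex_hilbert_space \<Rightarrow>\<^sub>L 'a) set" where
  "bounded_ops = {T :: 'a \<Rightarrow>\<^sub>L 'a. \<forall>c x. T (c *\<^sub>C x) = c *\<^sub>C T x}"

definition scale_op :: "complex \<Rightarrow> ('a::complex_hilbert_space \<Rightarrow>\<^sub>L 'a) \<Rightarrow> ('a \<Rightarrow>\<^sub>L 'a)" where
  "scale_op c T = Blinfun (\<lambda>x. c *\<^sub>C T x)"

lemma scale_op_apply: "scale_op c T x = c *\<^sub>C T x"
proof -
  have "bounded_linear (\<lambda>x. c *\<^sub>C T x)"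
  proof (rule bounded_linear_intro[where K = "cmod c * norm T"])
    show "c *\<^sub>C T (x + y) = c *\<^sub>C T x + c *\<^sub>C T y" for x y
      by (simp add: blinfun.add_right scaleC_add_right)
    show "c *\<^sub>C T (r *\<^sub>R x) = r *\<^sub>R (c *\<^sub>C T x)" for r x
      unfolding blinfun.scaleR_right by (simp only: scaleC_of_real[symmetric] scaleC_scaleC mult.commute)
    show "norm (c *\<^sub>C T x) \<le> norm x * (cmod c * norm T)" for x
      using mult_left_mono[OF norm_blinfun[of T x] norm_ge_zero[of c]]
      by (simp add: norm_scaleC mult_ac)
  qed
  then show ?thesis
    unfolding scale_op_def by (simp add: bounded_linear_Blinfun_apply)
qed

text \<open>Algebras are not required to contain the identity.\<close>

definition operator_algebra :: "('a::complex_hilbert_space \<Rightarrow>\<^sub>L 'a) set \<Rightarrow> bool" where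
  "operator_algebra A \<longleftrightarrow> A \<subseteq> bounded_ops \<and> 0 \<in> A \<and>
    (\<forall>S\<in>A. \<forall>T\<in>A. S + T \<in> A \<and> S o\<^sub>L T \<in> A) \<and> (\<forall>c. \<forall>T\<in>A. scale_op c T \<in> A)"

definition commutant :: "('a::complex_hilbert_space \<Rightarrow>\<^sub>L 'a) set \<Rightarrow> ('a \<Rightarrow>\<^sub>L 'a) set" where
  "commutant S = {T \<in> bounded_ops. \<forall>P\<in>S. T o\<^sub>L P = P o\<^sub>L T}"

text \<open>The ultraweak topology on \<open>B(H)\<close> is the initial topology of the functionals
  \<open>T \<mapsto> (\<Sum>n. \<langle>T x\<^sub>n, y\<^sub>n\<rangle>)\<close> for square-summable sequences of vectors.  Sequences suffice also
  on non-separable spaces, since a square-summable family has countable support.\<close>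

definition square_summable :: "(nat \<Rightarrow> 'a::complex_hilbert_space) \<Rightarrow> bool" where
  "square_summable x \<longleftrightarrow> summable (\<lambda>n. (norm (x n))\<^sup>2)"

definition ultraweak_topology :: "('a::complex_hilbert_space \<Rightarrow>\<^sub>L 'a) topology" where
  "ultraweak_topology = topology_generated_by
     {{T \<in> bounded_ops. (\<Sum>n. cinner (T (x n)) (y n)) \<in> U} | x y U.
        square_summable x \<and> square_summable y \<and> open U}"


section \<open>Projections and subspace lattices\<close>

definition projections :: "('a::complex_hilbert_space \<Rightarrow>\<^sub>L 'a) set" where
  "projections = {P \<in> bounded_ops. P o\<^sub>L P = P \<and> (\<forall>x y. cinner (P x) y = cinner x (P y))}"

text \<open>A projection is identified with its range, a closed subspace.  The meet of two projections
  projects onto the intersection of the ranges, the join onto the closure of their sum.\<close>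

definition projection_lattice :: "('a::complex_hilbert_space \<Rightarrow>\<^sub>L 'a) set \<Rightarrow> bool" where
  "projection_lattice L \<longleftrightarrow> L \<subseteq> projections \<and>
    (\<forall>P\<in>L. \<forall>Q\<in>L.
      (\<exists>R\<in>L. range (blinfun_apply R) = range (blinfun_apply P) \<inter> range (blinfun_apply Q)) \<and>
      (\<exists>R\<in>L. range (blinfun_apply R) = closure {P x + Q y | x y. True}))"

definition commutative_subspace_lattice :: "('a::complex_hilbert_space \<Rightarrow>\<^sub>L 'a) set \<Rightarrow> bool" where
  "commutative_subspace_lattice L \<longleftrightarrow> projection_lattice L \<and>
    (\<forall>P\<in>L. \<forall>Q\<in>L. P o\<^sub>L Q = Q o\<^sub>L P) \<and> 0 \<in> L \<and> id_blinfun \<in> L \<and>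
    closedin (subtopology strong_operator_topology bounded_ops) L"

definition lat :: "('a::complex_hilbert_space \<Rightarrow>\<^sub>L 'a) set \<Rightarrow> ('a \<Rightarrow>\<^sub>L 'a) set" where
  "lat A = {P \<in> projections. \<forall>T\<in>A. blinfun_apply T ` range (blinfun_apply P) \<subseteq> range (blinfun_apply P)}"

definition csl_algebras :: "('a::complex_hilbert_space \<Rightarrow>\<^sub>L 'a) set \<Rightarrow> ('a \<Rightarrow>\<^sub>L 'a) set set" where
  "csl_algebras L = {A. operator_algebra A \<and> closedin ultraweak_topology A \<and>
     lat A = L \<and> commutant L \<subseteq> A}"

end

theory Submission
  imports Defs
begin

text \<open>The smallest algebra is the intersection \<open>A\<^sub>0\<close> of the class. The class contains \<open>alg L\<close>, the algebra of all operators that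
  leave every element of \<open>L\<close> invariant, provided that \<open>L\<close> is reflexive, so two things are to be shown: \<open>lat (alg L) \<subseteq> L\<close>
  and \<open>lat A\<^sub>0 \<subseteq> L\<close>. A projection \<open>P\<close> in either set has a range invariant under \<open>L'\<close>, hence belongs to the complete Boolean
  algebra of projections of \<open>L''\<close> (\<open>invariant_projection_in_bicommutant\<close>). If it is not in \<open>L\<close>, one needs an operator that does not
  leave \<open>P\<close> invariant but lies in \<open>alg L\<close> and in every algebra of the class (\<open>separating_operator_exists\<close>).

  Because \<open>L\<close> is strongly closed, there are vectors \<open>\<xi>\<close> in the range and \<open>\<eta>\<close> in the kernel of \<open>P\<close> such that
  \<open>\<parallel>E\<^sup>\<bottom> \<xi>\<parallel>\<^sup>2 + \<parallel>E \<eta>\<parallel>\<^sup>2\<close> is bounded away from \<open>0\<close> on \<open>L\<close> (\<open>inseparable_pair_exists\<close>). In a finite Boolean subalgebra a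
  transport problem with \<open>\<xi>\<close> as supply and \<open>\<eta>\<close> as demand, along the order that \<open>L\<close> induces on the atoms, then has a flow
  of value bounded below; a greedy flow suffices in place of a maximal one (\<open>finite_flow\<close>). By compactness the flows
  produce a contraction \<open>T\<close> for which \<open>\<langle>T E \<xi>, F \<eta>\<rangle>\<close> is a positive bimeasure, supported on the order of \<open>L\<close>, with
  \<open>\<langle>T \<xi>, \<eta>\<rangle> \<noteq> 0\<close> (\<open>positive_operator_exists\<close>). This is a coordinate-free form of the pseudo-integral operators of Arveson;
  no separability enters, because the Boolean algebra itself takes the place of a standard measure space.

  It remains to see that \<open>T\<close>, compressed to the cyclic spaces, lies in each algebra \<open>A\<close> of the class. By the bipolar
  theorem this holds if every functional \<open>S \<mapsto> \<Sum>\<^sub>n \<langle>S x\<^sub>n, y\<^sub>n\<rangle>\<close> annihilating \<open>A\<close> kills \<open>T\<close>. On the cyclic spaces \<open>x\<close> and \<open>y\<close> are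
  \<open>\<ell>\<^sup>2\<close>-valued functions times \<open>\<xi>\<close> and \<open>\<eta>\<close>. A Hahn decomposition cuts out pieces \<open>E\<^sub>i\<close> and \<open>F\<^sub>j\<close> on which they are uniformly
  close to constants \<open>c\<^sub>i\<close> and \<open>d\<^sub>j\<close> (\<open>hereditary_approximation_exists\<close>). If \<open>c\<^sub>i \<cdot> d\<^sub>j\<close> exceeds the error, the functional acts on
  the corner \<open>F\<^sub>j A E\<^sub>i\<close> as a small perturbation of a nonzero multiple of the identity, so the corner vanishes
  (\<open>corner_vanishes\<close>); then an element of \<open>lat A \<subseteq> L\<close> separates \<open>E\<^sub>i\<close> from \<open>F\<^sub>j\<close>, and the corner of \<open>T\<close> vanishes as well.
  Otherwise \<open>c\<^sub>i \<cdot> d\<^sub>j\<close> is small. As the bimeasure is positive with dominated marginals, the contributions of all these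
  pairs have a small sum (\<open>annihilating_functional_kills_positive_operator\<close>).\<close>

section \<open>Complex Hilbert space geometry\<close>

lemma scaleC_zero_left [simp]: "0 *\<^sub>C x = 0" for x :: "'a::complex_inner"
  using scaleC_of_real[of 0 x] by simp

lemma scaleC_zero_right [simp]: "c *\<^sub>C (0::'a::complex_inner) = 0"
proof -
  have "norm (c *\<^sub>C (0::'a)) = 0" by (simp add: norm_scaleC)
  then show ?thesis by simp
qed

lemma scaleC_one [simp]: "1 *\<^sub>C x = x" for x :: "'a::complex_inner"
  using scaleC_of_real[of 1 x] by simp

lemma scaleC_minus_one: "(- 1) *\<^sub>C x = - x" for x :: "'a::complex_inner"
  using scaleC_of_real[of "-1" x] by simp

lemma scaleC_minus_right [simp]: "c *\<^sub>C (- x) = - (c *\<^sub>C x)" for x :: "'a::complex_inner"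
  by (metis scaleC_minus_one scaleC_scaleC mult.commute)

lemma scaleC_diff_right: "c *\<^sub>C (x - y) = c *\<^sub>C x - c *\<^sub>C y" for x :: "'a::complex_inner"
  using scaleC_add_right[of c x "- y"] by simp

lemma scaleC_sum_right: "c *\<^sub>C (\<Sum>i\<in>I. f i) = (\<Sum>i\<in>I. c *\<^sub>C f i)" for f :: "'i \<Rightarrow> 'a::complex_inner"
  by (induction I rule: infinite_finite_induct) (auto simp: scaleC_add_right)

lemma scaleC_sum_left: "(\<Sum>i\<in>I. f i) *\<^sub>C x = (\<Sum>i\<in>I. f i *\<^sub>C x)" for x :: "'a::complex_inner"
  by (induction I rule: infinite_finite_induct) (auto simp: scaleC_add_left)

lemma cinner_add_right: "cinner x (y + z) = cinner x y + cinner x z"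
  by (metis cinner_commute cinner_add_left complex_cnj_add)

lemma cinner_scaleC_right: "cinner x (c *\<^sub>C y) = cnj c * cinner x y"
  by (metis cinner_commute cinner_scaleC_left complex_cnj_mult)

lemma cinner_zero_left [simp]: "cinner 0 x = 0" for x :: "'a::complex_inner"
  using cinner_scaleC_left[of 0 0 x] by simp

lemma cinner_zero_right [simp]: "cinner x 0 = 0" for x :: "'a::complex_inner"
  using cinner_scaleC_right[of x 0 0] by simp

lemma cinner_minus_left [simp]: "cinner (- x) y = - cinner x y" for x :: "'a::complex_inner"
  using cinner_scaleC_left[of "-1" x y] by (simp add: scaleC_minus_one)

lemma cinner_minus_right [simp]: "cinner x (- y) = - cinner x y" for x :: "'a::complex_inner"
  using cinner_scaleC_right[of x "-1" y] by (simp add: scaleC_minus_one)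

lemma cinner_diff_left: "cinner (x - y) z = cinner x z - cinner y z" for x :: "'a::complex_inner"
  using cinner_add_left[of x "- y" z] by simp

lemma cinner_diff_right: "cinner x (y - z) = cinner x y - cinner x z" for x :: "'a::complex_inner"
  using cinner_add_right[of x y "- z"] by simp

lemma cinner_sum_left: "cinner (\<Sum>i\<in>I. f i) y = (\<Sum>i\<in>I. cinner (f i) y)" for y :: "'a::complex_inner"
  by (induction I rule: infinite_finite_induct) (auto simp: cinner_add_left)

lemma cinner_sum_right: "cinner y (\<Sum>i\<in>I. f i) = (\<Sum>i\<in>I. cinner y (f i))" for y :: "'a::complex_inner"
  by (induction I rule: infinite_finite_induct) (auto simp: cinner_add_right)

lemma cinner_eq_zero_commute: "cinner x y = 0 \<longleftrightarrow> cinner y x = 0"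
  by (metis cinner_commute complex_cnj_zero)

lemma norm_sq_cinner: "(norm x)\<^sup>2 = Re (cinner x x)" for x :: "'a::complex_inner"
  by (metis cinner_self Re_complex_of_real)

lemma norm_add_sq: "(norm (x + y))\<^sup>2 = (norm x)\<^sup>2 + (norm y)\<^sup>2 + 2 * Re (cinner x y)"
  for x :: "'a::complex_inner"
proof -
  have "Re (cinner y x) = Re (cinner x y)"
    by (subst cinner_commute) simp
  then show ?thesis
    by (simp add: norm_sq_cinner cinner_add_left cinner_add_right)
qed

lemma norm_diff_sq: "(norm (x - y))\<^sup>2 = (norm x)\<^sup>2 + (norm y)\<^sup>2 - 2 * Re (cinner x y)"
  for x :: "'a::complex_inner"
  using norm_add_sq[of x "- y"] by simp

lemma pythagoras: "cinner x y = 0 \<Longrightarrow> (norm (x + y))\<^sup>2 = (norm x)\<^sup>2 + (norm y)\<^sup>2"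
  for x :: "'a::complex_inner"
  by (simp add: norm_add_sq)

lemma parallelogram: "(norm (x + y))\<^sup>2 + (norm (x - y))\<^sup>2 = 2 * (norm x)\<^sup>2 + 2 * (norm y)\<^sup>2"
  for x :: "'a::complex_inner"
  by (simp add: norm_add_sq norm_diff_sq)

lemma pythagoras_sum:
  fixes f :: "'i \<Rightarrow> 'a::complex_inner"
  assumes "finite I" "\<And>i j. i \<in> I \<Longrightarrow> j \<in> I \<Longrightarrow> i \<noteq> j \<Longrightarrow> cinner (f i) (f j) = 0"
  shows "(norm (\<Sum>i\<in>I. f i))\<^sup>2 = (\<Sum>i\<in>I. (norm (f i))\<^sup>2)"
  using assms
proof (induction I rule: finite_induct)
  case (insert i I)
  have "cinner (f i) (\<Sum>j\<in>I. f j) = 0"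
    unfolding cinner_sum_right using insert by (intro sum.neutral) auto
  then show ?case using insert by (simp add: pythagoras)
qed simp

lemma Cauchy_Schwarz: "cmod (cinner x y) \<le> norm x * norm y" for x :: "'a::complex_inner"
proof (cases "y = 0")
  case False
  define a where "a = cinner x y / complex_of_real ((norm y)\<^sup>2)"
  have n: "(norm y)\<^sup>2 > 0" using False by simp
  have yy: "cinner y y = complex_of_real ((norm y)\<^sup>2)" by (rule cinner_self[symmetric])
  have "cinner (x - a *\<^sub>C y) (a *\<^sub>C y) = 0"
    using False by (simp add: cinner_diff_left cinner_scaleC_left cinner_scaleC_right yy a_def)
  then have "(norm x)\<^sup>2 = (norm (x - a *\<^sub>C y))\<^sup>2 + (norm (a *\<^sub>C y))\<^sup>2"
    using pythagoras[of "x - a *\<^sub>C y" "a *\<^sub>C y"] by simp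
  then have "(norm (a *\<^sub>C y))\<^sup>2 \<le> (norm x)\<^sup>2" by simp
  then have "norm (a *\<^sub>C y) \<le> norm x" by (rule power2_le_imp_le) simp
  moreover have "norm (a *\<^sub>C y) = cmod (cinner x y) / norm y"
    using False by (simp add: norm_scaleC a_def norm_divide norm_mult power2_eq_square)
  ultimately show ?thesis using False by (simp add: divide_le_eq)
qed simp

lemma bounded_linear_cinner_left: "bounded_linear (\<lambda>x. cinner x y)" for y :: "'a::complex_inner"
proof (rule bounded_linear_intro[where K = "norm y"])
  show "cinner (r *\<^sub>R x) y = r *\<^sub>R cinner x y" for r x
    by (metis scaleC_of_real cinner_scaleC_left scaleR_conv_of_real)
qed (auto simp: cinner_add_left Cauchy_Schwarz)

lemma bounded_linear_cinner_right: "bounded_linear (\<lambda>x. cinner y x)" for y :: "'a::complex_inner"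
proof (rule bounded_linear_intro[where K = "norm y"])
  show "cinner y (r *\<^sub>R x) = r *\<^sub>R cinner y x" for r x
    unfolding scaleC_of_real[symmetric] cinner_scaleC_right by (simp add: scaleR_conv_of_real)
  show "norm (cinner y x) \<le> norm x * norm y" for x
    using Cauchy_Schwarz[of y x] by (simp add: mult.commute)
qed (auto simp: cinner_add_right)

lemmas tendsto_cinner_left = bounded_linear.tendsto[OF bounded_linear_cinner_left]
lemmas tendsto_cinner_right = bounded_linear.tendsto[OF bounded_linear_cinner_right]
lemmas continuous_on_cinner_left = bounded_linear.continuous_on[OF bounded_linear_cinner_left]
lemmas continuous_on_cinner_right = bounded_linear.continuous_on[OF bounded_linear_cinner_right]

lemma continuous_on_scaleC: "continuous_on S (\<lambda>x. c *\<^sub>C x)" for S :: "'a::complex_inner set"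
proof -
  have "bounded_linear (\<lambda>x::'a. c *\<^sub>C x)"
  proof (rule bounded_linear_intro[where K = "cmod c"])
    show "c *\<^sub>C (r *\<^sub>R x) = r *\<^sub>R (c *\<^sub>C x)" for r and x :: 'a
      unfolding scaleC_of_real[symmetric] scaleC_scaleC by (simp add: mult.commute)
  qed (auto simp: scaleC_add_right norm_scaleC)
  then show ?thesis by (simp add: linear_continuous_on)
qed

lemma cinner_ext: "(\<And>z. cinner x z = cinner y z) \<Longrightarrow> x = y" for x :: "'a::complex_inner"
proof -
  assume "\<And>z. cinner x z = cinner y z"
  then have "cinner (x - y) (x - y) = 0" by (simp add: cinner_diff_left)
  then show ?thesis by (metis cinner_self eq_iff_diff_eq_0 norm_eq_zero of_real_eq_0_iff power_eq_0_iff)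
qed

definition complex_subspace :: "'a::complex_inner set \<Rightarrow> bool" where
  "complex_subspace M \<longleftrightarrow> 0 \<in> M \<and> (\<forall>x\<in>M. \<forall>y\<in>M. x + y \<in> M) \<and> (\<forall>c. \<forall>x\<in>M. c *\<^sub>C x \<in> M)"

lemma complex_subspace_diff: "complex_subspace M \<Longrightarrow> x \<in> M \<Longrightarrow> y \<in> M \<Longrightarrow> x - y \<in> M"
  unfolding complex_subspace_def
  by (metis diff_conv_add_uminus scaleC_minus_one)

lemma complex_subspace_closure:
  fixes M :: "'a::complex_inner set"
  assumes M: "complex_subspace M" shows "complex_subspace (closure M)"
  unfolding complex_subspace_def
proof (intro conjI allI ballI)
  show "0 \<in> closure M" using M closure_subset unfolding complex_subspace_def by blast
next
  fix x y assume "x \<in> closure M" "y \<in> closure M"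
  then obtain f g where "\<And>n. f n \<in> M" "f \<longlonglongrightarrow> x" "\<And>n. g n \<in> M" "g \<longlonglongrightarrow> y"
    unfolding closure_sequential by blast
  then show "x + y \<in> closure M" unfolding closure_sequential
    using M unfolding complex_subspace_def by (intro exI[of _ "\<lambda>n. f n + g n"]) (auto intro: tendsto_intros)
next
  fix c x assume "x \<in> closure M"
  moreover have "(\<lambda>x. c *\<^sub>C x) ` closure M \<subseteq> closure M"
    using M closure_subset[of M] unfolding complex_subspace_def
    by (intro image_closure_subset continuous_on_scaleC) auto
  ultimately show "c *\<^sub>C x \<in> closure M" by blast
qed

text \<open>The minimising sequence is Cauchy by the parallelogram law.\<close>

lemma nearest_point_exists:
  fixes M :: "'a::complex_hilbert_space set"
  assumes M: "complex_subspace M" "closed M"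
  shows "\<exists>m\<in>M. \<forall>y\<in>M. norm (x - m) \<le> norm (x - y)"
proof -
  define d where "d = (INF y\<in>M. norm (x - y))"
  have ne: "M \<noteq> {}" using M(1) unfolding complex_subspace_def by auto
  have bdd: "bdd_below ((\<lambda>y. norm (x - y)) ` M)" by (rule bdd_belowI[of _ 0]) auto
  have dle: "d \<le> norm (x - y)" if "y \<in> M" for y
    unfolding d_def using bdd that by (rule cINF_lower)
  have d0: "d \<ge> 0" unfolding d_def by (rule cINF_greatest) (use ne in auto)
  have "\<exists>y\<in>M. norm (x - y) < d + 1 / real (Suc n)" for n
    using cINF_less_iff[OF ne bdd, of "d + 1 / real (Suc n)"] by (simp add: d_def)
  then obtain f where fM: "\<And>n. f n \<in> M" and f: "\<And>n. norm (x - f n) < d + 1 / real (Suc n)"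
    by metis
  have est: "(norm (f m - f n))\<^sup>2 \<le> 2 * (norm (x - f m))\<^sup>2 + 2 * (norm (x - f n))\<^sup>2 - 4 * d\<^sup>2" for m n
  proof -
    have "(1/2) *\<^sub>R (f m + f n) \<in> M"
      using M(1) fM unfolding complex_subspace_def scaleC_of_real[symmetric] by blast
    then have "d \<le> norm (x - (1/2) *\<^sub>R (f m + f n))" by (rule dle)
    also have "x - (1/2) *\<^sub>R (f m + f n) = (1/2) *\<^sub>R ((x - f n) + (x - f m))"
      by (simp add: algebra_simps flip: scaleR_add_left)
    finally have "2 * d \<le> norm ((x - f n) + (x - f m))" by simp
    then have "4 * d\<^sup>2 \<le> (norm ((x - f n) + (x - f m)))\<^sup>2"
      using power_mono[of "2 * d" _ 2] d0 by (simp add: power_mult_distrib)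
    moreover have "f m - f n = (x - f n) - (x - f m)" by simp
    ultimately show ?thesis
      using parallelogram[of "x - f n" "x - f m"] by simp
  qed
  have lim: "(\<lambda>n. norm (x - f n)) \<longlonglongrightarrow> d"
  proof (rule tendsto_sandwich[of "\<lambda>_. d" _ _ "\<lambda>n. d + 1 / real (Suc n)"])
    show "(\<lambda>n. d + 1 / real (Suc n)) \<longlonglongrightarrow> d"
      using tendsto_add[OF tendsto_const LIMSEQ_inverse_real_of_nat, of d] by (simp add: inverse_eq_divide)
    show "eventually (\<lambda>n. norm (x - f n) \<le> d + 1 / real (Suc n)) sequentially"
      using f less_imp_le by (intro always_eventually) blast
  qed (use dle fM in auto)
  have "Cauchy f"
  proof (rule metric_CauchyI)
    fix e :: real assume e: "e > 0"
    have "(\<lambda>n. 2 * (norm (x - f n))\<^sup>2 - 2 * d\<^sup>2) \<longlonglongrightarrow> 2 * d\<^sup>2 - 2 * d\<^sup>2"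
      by (intro tendsto_intros lim)
    then have "eventually (\<lambda>n. 2 * (norm (x - f n))\<^sup>2 - 2 * d\<^sup>2 < e\<^sup>2 / 2) sequentially"
      using e by (intro order_tendstoD) auto
    then obtain N where N: "\<And>n. n \<ge> N \<Longrightarrow> 2 * (norm (x - f n))\<^sup>2 - 2 * d\<^sup>2 < e\<^sup>2 / 2"
      unfolding eventually_sequentially by blast
    have "dist (f m) (f n) < e" if "m \<ge> N" "n \<ge> N" for m n
    proof -
      have "(norm (f m - f n))\<^sup>2 < e\<^sup>2"
        using est[of m n] N[OF that(1)] N[OF that(2)] by simp
      then show ?thesis using e by (simp add: dist_norm power_less_imp_less_base)
    qed
    then show "\<exists>M. \<forall>m\<ge>M. \<forall>n\<ge>M. dist (f m) (f n) < e" by blast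
  qed
  then obtain l where l: "f \<longlonglongrightarrow> l" using Cauchy_convergent convergent_def by blast
  have "l \<in> M" using M(2) fM l closed_sequentially by blast
  moreover have "norm (x - l) = d"
    using lim tendsto_norm[OF tendsto_diff[OF tendsto_const l, of x]] LIMSEQ_unique by blast
  ultimately show ?thesis using dle by auto
qed

lemma orthogonal_decomposition:
  fixes M :: "'a::complex_hilbert_space set"
  assumes M: "complex_subspace M" "closed M"
  shows "\<exists>m\<in>M. \<forall>y\<in>M. cinner (x - m) y = 0"
proof -
  obtain m where m: "m \<in> M" "\<And>y. y \<in> M \<Longrightarrow> norm (x - m) \<le> norm (x - y)"
    using nearest_point_exists[OF M] by blast
  have "cinner (x - m) y = 0" if y: "y \<in> M" for y
  proof (cases "y = 0")
    case False
    define a where "a = cinner (x - m) y / complex_of_real ((norm y)\<^sup>2)"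
    have yy: "cinner y y = complex_of_real ((norm y)\<^sup>2)" by (rule cinner_self[symmetric])
    have "cinner (x - m - a *\<^sub>C y) (a *\<^sub>C y) = 0"
      using False by (simp add: cinner_diff_left[of "x - m"] cinner_scaleC_left cinner_scaleC_right yy a_def)
    then have "(norm (x - m))\<^sup>2 = (norm (x - m - a *\<^sub>C y))\<^sup>2 + (norm (a *\<^sub>C y))\<^sup>2"
      using pythagoras[of "x - m - a *\<^sub>C y" "a *\<^sub>C y"] by simp
    moreover have "m + a *\<^sub>C y \<in> M" using M(1) m(1) y unfolding complex_subspace_def by blast
    then have "norm (x - m) \<le> norm (x - m - a *\<^sub>C y)" using m(2) by (simp add: diff_diff_eq)
    then have "(norm (x - m))\<^sup>2 \<le> (norm (x - m - a *\<^sub>C y))\<^sup>2" by (simp add: power_mono)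
    ultimately have "norm (a *\<^sub>C y) = 0" by simp
    then show ?thesis using False by (simp add: norm_scaleC a_def)
  qed simp
  then show ?thesis using m(1) by blast
qed

lemma bounded_opsD: "T \<in> bounded_ops \<Longrightarrow> blinfun_apply T (c *\<^sub>C x) = c *\<^sub>C T x"
  unfolding bounded_ops_def by auto

lemma projectionsD:
  assumes "P \<in> projections"
  shows "P \<in> bounded_ops" "blinfun_apply P (P x) = P x" "cinner (P x) y = cinner x (P y)"
  using assms unfolding projections_def by (auto dest: arg_cong[where f = "\<lambda>T. blinfun_apply T x"])

lemma projection_exists:
  fixes M :: "'a::complex_hilbert_space set"
  assumes M: "complex_subspace M" "closed M"
  obtains P where "P \<in> projections" "\<And>x. blinfun_apply P x \<in> M" "\<And>x. x \<in> M \<Longrightarrow> blinfun_apply P x = x"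
    "\<And>x y. y \<in> M \<Longrightarrow> cinner (x - blinfun_apply P x) y = 0"
proof -
  obtain p where pM: "\<And>x. p x \<in> M" and p: "\<And>x y. y \<in> M \<Longrightarrow> cinner (x - p x) y = 0"
    using orthogonal_decomposition[OF M] by metis
  have uniq: "p x = m" if "m \<in> M" "\<And>y. y \<in> M \<Longrightarrow> cinner (x - m) y = 0" for x m
  proof -
    have mem: "p x - m \<in> M" using complex_subspace_diff M(1) pM that(1) by blast
    have "p x - m = (x - m) - (x - p x)" by simp
    then have "cinner (p x - m) (p x - m) = 0"
      using that(2)[OF mem] p[OF mem, of x] by (metis cinner_diff_left diff_self)
    then show ?thesis
      by (metis cinner_self eq_iff_diff_eq_0 norm_eq_zero of_real_eq_0_iff power_eq_0_iff)
  qed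
  have add: "p (x + y) = p x + p y" for x y
  proof (rule uniq)
    show "p x + p y \<in> M" using M(1) pM unfolding complex_subspace_def by blast
    show "cinner (x + y - (p x + p y)) z = 0" if "z \<in> M" for z
      using p[OF that, of x] p[OF that, of y] by (simp add: cinner_diff_left cinner_add_left)
  qed
  have scale: "p (c *\<^sub>C x) = c *\<^sub>C p x" for c x
  proof (rule uniq)
    show "c *\<^sub>C p x \<in> M" using M(1) pM unfolding complex_subspace_def by blast
    show "cinner (c *\<^sub>C x - c *\<^sub>C p x) z = 0" if "z \<in> M" for z
      using p[OF that, of x] by (simp add: cinner_scaleC_left flip: scaleC_diff_right)
  qed
  have "norm (p x) \<le> norm x" for x
  proof -
    have "(norm x)\<^sup>2 = (norm (x - p x))\<^sup>2 + (norm (p x))\<^sup>2"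
      using pythagoras[OF p[OF pM], of x x] by simp
    then have "(norm (p x))\<^sup>2 \<le> (norm x)\<^sup>2" by simp
    then show ?thesis by (rule power2_le_imp_le) simp
  qed
  then have bl: "bounded_linear p"
    by (intro bounded_linear_intro[where K = 1]) (auto simp: add scale simp flip: scaleC_of_real)
  define P where "P = Blinfun p"
  have P: "blinfun_apply P x = p x" for x
    unfolding P_def using bl by (simp add: bounded_linear_Blinfun_apply)
  have id: "p x = x" if "x \<in> M" for x by (rule uniq) (use that in auto)
  have sa: "cinner (p x) y = cinner x (p y)" for x y
  proof -
    have "cinner (p x) y = cinner (p x) (p y)"
      using p[OF pM, of y x] cinner_eq_zero_commute[of "p x" "y - p y"] by (simp add: cinner_diff_right)
    also have "\<dots> = cinner x (p y)" using p[OF pM, of x y] by (simp add: cinner_diff_left)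
    finally show ?thesis .
  qed
  have "P \<in> projections"
    unfolding projections_def bounded_ops_def by (auto simp: P scale id[OF pM] sa intro: blinfun_eqI)
  then show thesis by (rule that) (auto simp: P pM id p)
qed

lemma Riesz_representation:
  fixes f :: "'a::complex_hilbert_space \<Rightarrow> complex"
  assumes add: "\<And>x y. f (x + y) = f x + f y" and scale: "\<And>c x. f (c *\<^sub>C x) = c * f x"
    and bound: "\<And>x. cmod (f x) \<le> norm x * K"
  shows "\<exists>y. \<forall>x. f x = cinner x y"
proof (cases "\<forall>x. f x = 0")
  case True then show ?thesis by (intro exI[of _ 0]) simp
next
  case False
  then obtain w where w: "f w \<noteq> 0" by blast
  have bl: "bounded_linear f"
  proof (rule bounded_linear_intro[OF add _ bound])
    show "f (r *\<^sub>R x) = r *\<^sub>R f x" for r x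
      by (metis scale scaleC_of_real scaleR_conv_of_real)
  qed
  have diff: "f (x - y) = f x - f y" for x y using bl by (simp add: bounded_linear.linear linear_diff)
  define M where "M = {x. f x = 0}"
  have "complex_subspace M"
    unfolding complex_subspace_def M_def using add scale bl by (auto simp: linear_0 bounded_linear.linear)
  moreover have "closed M" unfolding M_def
    by (intro closed_Collect_eq linear_continuous_on bl continuous_on_const)
  ultimately obtain m where m: "m \<in> M" "\<And>y. y \<in> M \<Longrightarrow> cinner (w - m) y = 0"
    using orthogonal_decomposition by blast
  define u where "u = w - m"
  have fu: "f u \<noteq> 0" using w m(1) by (simp add: u_def diff M_def)
  then have u0: "u \<noteq> 0" using bl by (auto simp: linear_0 bounded_linear.linear)
  have uM: "cinner y u = 0" if "f y = 0" for y
    using m(2)[of y] that cinner_eq_zero_commute by (auto simp: M_def u_def)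
  define a where "a = cnj (f u) / complex_of_real ((norm u)\<^sup>2)"
  have "f x = cinner x (a *\<^sub>C u)" for x
  proof -
    have "f (x - (f x / f u) *\<^sub>C u) = 0" using fu by (simp add: diff scale)
    then have "cinner (x - (f x / f u) *\<^sub>C u) u = 0" by (rule uM)
    then have "cinner x u = (f x / f u) * cinner u u"
      by (simp add: cinner_diff_left cinner_scaleC_left)
    then show ?thesis
      using fu u0 by (simp add: cinner_scaleC_right a_def flip: cinner_self)
  qed
  then show ?thesis by blast
qed

lemma sesquilinear_form_operator:
  fixes B :: "'a::complex_hilbert_space \<Rightarrow> 'a \<Rightarrow> complex"
  assumes addl: "\<And>x x' y. B (x + x') y = B x y + B x' y" and scl: "\<And>c x y. B (c *\<^sub>C x) y = c * B x y"
    and addr: "\<And>x y y'. B x (y + y') = B x y + B x y'" and scr: "\<And>c x y. B x (c *\<^sub>C y) = cnj c * B x y"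
    and bound: "\<And>x y. cmod (B x y) \<le> K * norm x * norm y"
  obtains T where "T \<in> bounded_ops" "\<And>x y. cinner (blinfun_apply T x) y = B x y"
proof -
  have "\<exists>z. \<forall>y. cnj (B x y) = cinner y z" for x
    by (rule Riesz_representation[of "\<lambda>y. cnj (B x y)" "K * norm x"])
      (use bound[of x] in \<open>auto simp: addr scr mult.commute\<close>)
  then obtain t where "\<And>x y. cnj (B x y) = cinner y (t x)" by metis
  then have t: "cinner (t x) y = B x y" for x y by (metis cinner_commute complex_cnj_cnj)
  have sc: "t (c *\<^sub>C x) = c *\<^sub>C t x" for c x
    by (rule cinner_ext) (simp add: t cinner_scaleC_left scl)
  have bl: "bounded_linear t"
  proof (rule bounded_linear_intro[where K = K])
    show "t (x + y) = t x + t y" for x y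
      by (rule cinner_ext) (simp add: t cinner_add_left addl)
    show "t (r *\<^sub>R x) = r *\<^sub>R t x" for r x by (metis sc scaleC_of_real)
    show "norm (t x) \<le> norm x * K" for x
    proof (cases "t x = 0")
      case True
      have "0 \<le> cmod (B x x)" by simp
      also have "\<dots> \<le> K * norm x * norm x" by (rule bound)
      finally show ?thesis using True
        by (cases "x = 0") (auto simp: zero_le_mult_iff)
    next
      case False
      have "(norm (t x))\<^sup>2 = cmod (B x (t x))"
        by (metis cinner_self t norm_of_real abs_of_nonneg zero_le_power2)
      also have "\<dots> \<le> K * norm x * norm (t x)" by (rule bound)
      finally show ?thesis using False by (simp add: power2_eq_square mult.commute)
    qed
  qed
  define T where "T = Blinfun t"
  have T: "blinfun_apply T x = t x" for x
    unfolding T_def using bl by (simp add: bounded_linear_Blinfun_apply)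
  show thesis by (rule that[of T]) (auto simp: T t bounded_ops_def sc)
qed

lemma adjoint_exists:
  fixes T :: "'a::complex_hilbert_space \<Rightarrow>\<^sub>L 'a"
  assumes "T \<in> bounded_ops"
  obtains T' where "T' \<in> bounded_ops" "\<And>x y. cinner (blinfun_apply T' x) y = cinner x (T y)"
proof (rule sesquilinear_form_operator[of "\<lambda>x y. cinner x (T y)" "norm T"])
  show "cmod (cinner x (T y)) \<le> norm T * norm x * norm y" for x y
    using Cauchy_Schwarz[of x "T y"] norm_blinfun[of T y]
      mult_left_mono[OF norm_blinfun[of T y] norm_ge_zero[of x]]
    by (simp add: mult_ac)
qed (use assms in \<open>auto simp: cinner_add_left cinner_add_right cinner_scaleC_left cinner_scaleC_right blinfun.add_right bounded_opsD\<close>)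

section \<open>Projections and commutants\<close>

lemma norm_projection_split:
  assumes "P \<in> projections"
  shows "(norm (blinfun_apply P x))\<^sup>2 + (norm (x - P x))\<^sup>2 = (norm x)\<^sup>2"
proof -
  have "cinner (P x) (x - P x) = 0"
    using projectionsD[OF assms] by (simp add: cinner_diff_right)
  from pythagoras[OF this] show ?thesis by simp
qed

lemma norm_projection_le: "P \<in> projections \<Longrightarrow> norm (blinfun_apply P x) \<le> norm x"
proof (rule power2_le_imp_le)
  assume "P \<in> projections"
  from norm_projection_split[OF this, of x] show "(norm (P x))\<^sup>2 \<le> (norm x)\<^sup>2"
    by (smt (verit) zero_le_power2)
qed simp

lemma norm_projection_sq_cinner:
  "P \<in> projections \<Longrightarrow> complex_of_real ((norm (blinfun_apply P x))\<^sup>2) = cinner (P x) x"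
  unfolding cinner_self by (simp add: projectionsD)

lemma range_projection_iff: "P \<in> projections \<Longrightarrow> x \<in> range (blinfun_apply P) \<longleftrightarrow> P x = x"
  using projectionsD(2) by (metis rangeE rangeI)

lemma projection_kernel: "P \<in> projections \<Longrightarrow> (\<And>y. cinner x (P y) = 0) \<Longrightarrow> blinfun_apply P x = 0"
  by (rule cinner_ext) (simp add: projectionsD)

lemma projection_eqI:
  assumes P: "P \<in> projections" and Q: "Q \<in> projections"
    and PQ: "\<And>x. blinfun_apply Q x = x \<Longrightarrow> P x = x" and QP: "\<And>x. blinfun_apply P x = x \<Longrightarrow> Q x = x"
  shows "P = Q"
proof (rule blinfun_eqI, rule cinner_ext)
  fix x z
  have *: "P (Q y) = Q y" "Q (P y) = P y" for y using PQ QP projectionsD(2) P Q by blast+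
  have "cinner (P x) z = cinner (Q (P x)) z" by (simp add: *)
  also have "\<dots> = cinner x (P (Q z))" by (simp add: projectionsD P Q)
  also have "\<dots> = cinner (Q x) z" by (simp add: * projectionsD Q)
  finally show "cinner (P x) z = cinner (Q x) z" .
qed

lemma commutantD:
  assumes "T \<in> commutant S"
  shows "T \<in> bounded_ops" "P \<in> S \<Longrightarrow> blinfun_apply T (blinfun_apply P x) = P (T x)"
  using assms unfolding commutant_def by (auto dest!: bspec arg_cong[where f = "\<lambda>T. blinfun_apply T x"])

lemma commutantI:
  assumes "T \<in> bounded_ops" "\<And>P x. P \<in> S \<Longrightarrow> blinfun_apply T (blinfun_apply P x) = P (T x)"
  shows "T \<in> commutant S"
  using assms unfolding commutant_def by (auto intro: blinfun_eqI)

lemma adjoint_in_commutant: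
  assumes S: "S \<subseteq> projections" and T: "T \<in> commutant S" and T': "T' \<in> bounded_ops"
    and adj: "\<And>x y. cinner (blinfun_apply T' x) y = cinner x (T y)"
  shows "T' \<in> commutant S"
proof (rule commutantI[OF T'], rule cinner_ext)
  fix P x z assume P: "P \<in> S"
  then have "P \<in> projections" using S by blast
  then show "cinner (T' (P x)) z = cinner (P (T' x)) z"
    using commutantD(2)[OF T P] by (simp add: adj projectionsD)
qed

text \<open>Since the commutant is closed under adjoints, an invariant subspace of it is reducing.\<close>

lemma invariant_projection_in_bicommutant:
  assumes S: "S \<subseteq> projections" and P: "P \<in> lat (commutant S)"
  shows "P \<in> commutant (commutant S)"
proof (rule commutantI)
  have Pp: "P \<in> projections" using P unfolding lat_def by blast
  then show "P \<in> bounded_ops" by (rule projectionsD)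
  have inv: "P (T (P x)) = T (P x)" if "T \<in> commutant S" for T x
    using P that range_projection_iff[OF Pp] unfolding lat_def by blast
  fix T x assume T: "T \<in> commutant S"
  obtain T' where T': "T' \<in> bounded_ops" and adj: "\<And>x y. cinner (blinfun_apply T' x) y = cinner x (T y)"
    using adjoint_exists[OF commutantD(1)[OF T]] by blast
  have T'c: "T' \<in> commutant S" by (rule adjoint_in_commutant[OF S T T' adj])
  have adj': "cinner (T x) y = cinner x (T' y)" for x y by (metis adj cinner_commute)
  show "P (T x) = T (P x)"
  proof (rule cinner_ext)
    fix z
    have "cinner (P (T x)) z = cinner x (T' (P z))" by (simp add: projectionsD[OF Pp] adj')
    also have "\<dots> = cinner (P x) (T' (P z))" using inv[OF T'c, of z] projectionsD(3)[OF Pp] by metis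
    also have "\<dots> = cinner (P (T (P x))) z" by (simp add: projectionsD[OF Pp] adj')
    finally show "cinner (P (T x)) z = cinner (T (P x)) z" using inv[OF T] by simp
  qed
qed

lemma bounded_ops_blinfun_arith:
  "S \<in> bounded_ops \<Longrightarrow> T \<in> bounded_ops \<Longrightarrow> S + T \<in> bounded_ops"
  "S \<in> bounded_ops \<Longrightarrow> T \<in> bounded_ops \<Longrightarrow> S - T \<in> bounded_ops"
  "S \<in> bounded_ops \<Longrightarrow> T \<in> bounded_ops \<Longrightarrow> S o\<^sub>L T \<in> bounded_ops"
  "T \<in> bounded_ops \<Longrightarrow> scale_op c T \<in> bounded_ops"
  "0 \<in> bounded_ops" "id_blinfun \<in> bounded_ops"
  unfolding bounded_ops_def
  by (auto simp: blinfun.add_left blinfun.diff_left scale_op_apply scaleC_add_right scaleC_diff_right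
      scaleC_scaleC mult.commute)

lemma operator_algebra_commutant:
  assumes "S \<subseteq> bounded_ops" shows "operator_algebra (commutant S)"
  unfolding operator_algebra_def
proof (intro conjI ballI allI subsetI)
  show "T \<in> bounded_ops" if "T \<in> commutant S" for T using that by (rule commutantD)
  show "0 \<in> commutant S" by (rule commutantI) (auto intro: bounded_ops_blinfun_arith)
  fix T U c assume T: "T \<in> commutant S" and U: "U \<in> commutant S"
  note [simp] = commutantD(2)[OF T] commutantD(2)[OF U]
  note [intro] = bounded_ops_blinfun_arith commutantD(1)[OF T] commutantD(1)[OF U]
  have S: "P \<in> bounded_ops" if "P \<in> S" for P using that assms by blast
  show "T + U \<in> commutant S" by (rule commutantI) (auto simp: blinfun.add_left blinfun.add_right)
  show "T o\<^sub>L U \<in> commutant S" by (rule commutantI) auto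
  show "scale_op c T \<in> commutant S"
    by (rule commutantI) (auto simp: scale_op_apply bounded_opsD S)
qed

lemma id_in_commutant: "id_blinfun \<in> commutant S"
  by (rule commutantI) (auto intro: bounded_ops_blinfun_arith)

lemma projections_id_minus: "P \<in> projections \<Longrightarrow> id_blinfun - P \<in> projections"
  unfolding projections_def
  by (auto intro!: bounded_ops_blinfun_arith blinfun_eqI dest: arg_cong[where f = "\<lambda>T. blinfun_apply T _"]
      simp: blinfun.diff_left blinfun.diff_right cinner_diff_left cinner_diff_right
        projectionsD(2)[unfolded projections_def, simplified])

lemma projections_compose:
  assumes "P \<in> projections" "Q \<in> projections" "\<And>x. blinfun_apply P (blinfun_apply Q x) = Q (P x)"
  shows "P o\<^sub>L Q \<in> projections"
  unfolding projections_def
  using assms by (auto intro!: bounded_ops_blinfun_arith blinfun_eqI simp: projectionsD)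

section \<open>Boolean algebras of projections\<close>

text \<open>Completeness is required only along increasing sequences: this is what a Hahn decomposition takes,
  and it is the analogue of countable additivity for the vector measures \<open>E \<mapsto> E \<xi>\<close>.\<close>

locale boolean_projections =
  fixes BB :: "('a::complex_hilbert_space \<Rightarrow>\<^sub>L 'a) set"
  assumes proj: "E \<in> BB \<Longrightarrow> E \<in> projections"
    and commute: "E \<in> BB \<Longrightarrow> F \<in> BB \<Longrightarrow> blinfun_apply E (blinfun_apply F x) = F (E x)"
    and one: "id_blinfun \<in> BB"
    and inter: "E \<in> BB \<Longrightarrow> F \<in> BB \<Longrightarrow> E o\<^sub>L F \<in> BB"
    and compl: "E \<in> BB \<Longrightarrow> id_blinfun - E \<in> BB"
    and increasing_limit: "(\<And>n. Es n \<in> BB) \<Longrightarrow>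
      (\<And>n x. blinfun_apply (Es n) (blinfun_apply (Es (Suc n)) x) = Es n x) \<Longrightarrow>
      \<exists>G\<in>BB. \<forall>x. (\<lambda>n. blinfun_apply (Es n) x) \<longlonglongrightarrow> G x"
begin

lemma idem [simp]: "E \<in> BB \<Longrightarrow> blinfun_apply E (blinfun_apply E x) = E x"
  using proj projectionsD(2) by blast

lemma cinner_move: "E \<in> BB \<Longrightarrow> cinner (blinfun_apply E x) y = cinner x (E y)"
  using proj projectionsD(3) by blast

lemma apply_scaleC: "E \<in> BB \<Longrightarrow> blinfun_apply E (c *\<^sub>C x) = c *\<^sub>C E x"
  using proj projectionsD(1) bounded_opsD by blast

lemma orthogonal_sum:
  assumes "E \<in> BB" "F \<in> BB" "\<And>x. blinfun_apply E (blinfun_apply F x) = 0"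
  shows "E + F \<in> BB"
proof -
  have "E + F = id_blinfun - ((id_blinfun - E) o\<^sub>L (id_blinfun - F))"
    using assms by (intro blinfun_eqI) (simp add: blinfun.add_left blinfun.diff_left blinfun.diff_right)
  then show ?thesis using assms by (auto intro: compl inter)
qed

lemma atoms_exist:
  assumes "finite S" "S \<subseteq> BB"
  shows "\<exists>a. (\<forall>X\<in>Pow S. a X \<in> BB) \<and>
    (\<forall>X\<in>Pow S. \<forall>E\<in>S. \<forall>x. blinfun_apply E (blinfun_apply (a X) x) = (if E \<in> X then a X x else 0)) \<and>
    (\<forall>x. (\<Sum>X\<in>Pow S. blinfun_apply (a X) x) = x)"
  using assms
proof (induction S rule: finite_induct)
  case empty
  show ?case by (intro exI[of _ "\<lambda>_. id_blinfun"]) (auto intro: one)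
next
  case (insert F S)
  then obtain a where a': "\<forall>X\<in>Pow S. a X \<in> BB"
    and aE': "\<forall>X\<in>Pow S. \<forall>E\<in>S. \<forall>x. blinfun_apply E (blinfun_apply (a X) x) = (if E \<in> X then a X x else 0)"
    and asum': "\<forall>x. (\<Sum>X\<in>Pow S. blinfun_apply (a X) x) = x" by auto
  have a: "a X \<in> BB" if "X \<subseteq> S" for X using a' that by blast
  have aE: "blinfun_apply E (blinfun_apply (a X) x) = (if E \<in> X then a X x else 0)"
    if "X \<subseteq> S" "E \<in> S" for X E x using aE' that by blast
  have asum: "(\<Sum>X\<in>Pow S. blinfun_apply (a X) x) = x" for x using asum' by blast
  have F: "F \<in> BB" and FS: "F \<notin> S" using insert by auto
  define b where "b X = (if F \<in> X then F o\<^sub>L a (X - {F}) else (id_blinfun - F) o\<^sub>L a X)" for X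
  have sub: "X - {F} \<subseteq> S" if "X \<subseteq> insert F S" for X using that by auto
  have sub': "X \<subseteq> S" if "X \<subseteq> insert F S" "F \<notin> X" for X using that by auto
  have b: "b X \<in> BB" if "X \<subseteq> insert F S" for X
    unfolding b_def using a sub[OF that] sub'[OF that] F by (auto intro: inter compl)
  have bE: "E (b X x) = (if E \<in> X then b X x else 0)" if X: "X \<subseteq> insert F S" and E: "E \<in> insert F S" for X E x
  proof (cases "E = F")
    case True
    then show ?thesis using F by (auto simp: b_def blinfun.diff_left blinfun.diff_right)
  next
    case False
    then have ES: "E \<in> S" and EB: "E \<in> BB" using E insert.prems by auto
    show ?thesis
      using False aE[OF sub[OF X] ES] aE[OF sub'[OF X] ES] commute[OF EB F]
      by (auto simp: b_def blinfun.diff_left blinfun.diff_right)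
  qed
  have "(\<Sum>X\<in>Pow (insert F S). blinfun_apply (b X) x) = x" for x
  proof -
    have inj: "inj_on (insert F) (Pow S)" using FS by (auto simp: inj_on_def)
    have "(\<Sum>X\<in>Pow (insert F S). b X x) = (\<Sum>X\<in>Pow S. b X x) + (\<Sum>X\<in>insert F ` Pow S. b X x)"
      unfolding Pow_insert using insert.hyps FS by (intro sum.union_disjoint) auto
    also have "(\<Sum>X\<in>insert F ` Pow S. b X x) = (\<Sum>X\<in>Pow S. b (insert F X) x)"
      by (simp add: sum.reindex[OF inj])
    also have "(\<Sum>X\<in>Pow S. b X x) = (\<Sum>X\<in>Pow S. a X x - F (a X x))"
      using FS by (intro sum.cong) (auto simp: b_def blinfun.diff_left)
    also have "(\<Sum>X\<in>Pow S. b (insert F X) x) = (\<Sum>X\<in>Pow S. F (a X x))"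
    proof (intro sum.cong refl)
      fix X assume "X \<in> Pow S"
      then have "insert F X - {F} = X" using FS by auto
      then show "b (insert F X) x = F (a X x)" by (simp add: b_def)
    qed
    finally show ?thesis by (simp add: sum_subtractf asum)
  qed
  then show ?case using b bE by (intro exI[of _ b]) auto
qed

text \<open>The atom of the Boolean algebra generated by \<open>S\<close> that is the product of the members of \<open>X\<close> and of the
  complements of the members of \<open>S - X\<close>. An atom may be zero.\<close>

definition atom :: "('a \<Rightarrow>\<^sub>L 'a) set \<Rightarrow> ('a \<Rightarrow>\<^sub>L 'a) set \<Rightarrow> 'a \<Rightarrow>\<^sub>L 'a" where
  "atom S = (SOME a. (\<forall>X\<in>Pow S. a X \<in> BB) \<and>
    (\<forall>X\<in>Pow S. \<forall>E\<in>S. \<forall>x. blinfun_apply E (blinfun_apply (a X) x) = (if E \<in> X then a X x else 0)) \<and>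
    (\<forall>x. (\<Sum>X\<in>Pow S. blinfun_apply (a X) x) = x))"

context
  fixes S assumes S: "finite S" "S \<subseteq> BB"
begin

lemma atom_in: "X \<subseteq> S \<Longrightarrow> atom S X \<in> BB"
  and apply_atom: "X \<subseteq> S \<Longrightarrow> E \<in> S \<Longrightarrow>
    blinfun_apply E (blinfun_apply (atom S X) x) = (if E \<in> X then atom S X x else 0)"
  and sum_atoms: "(\<Sum>X\<in>Pow S. blinfun_apply (atom S X) x) = x"
  using someI_ex[OF atoms_exist[OF S]] unfolding atom_def[symmetric] by auto

lemma atom_disjoint:
  assumes "X \<subseteq> S" "Y \<subseteq> S" "X \<noteq> Y"
  shows "blinfun_apply (atom S X) (blinfun_apply (atom S Y) x) = 0"
proof -
  obtain E where E: "E \<in> S" "E \<in> X \<longleftrightarrow> E \<notin> Y" using assms by blast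
  have EB: "E \<in> BB" using E S by auto
  have "atom S X (E (atom S Y x)) = E (atom S X (atom S Y x))"
    using commute[OF EB atom_in[OF assms(1)]] by simp
  then show ?thesis using apply_atom[OF assms(1) E(1)] apply_atom[OF assms(2) E(1)] E(2)
    by (auto simp: blinfun.zero_right split: if_splits)
qed

lemma atom_orthogonal:
  assumes "X \<subseteq> S" "Y \<subseteq> S" "X \<noteq> Y"
  shows "cinner (blinfun_apply (atom S X) x) (blinfun_apply (atom S Y) y) = 0"
  using atom_disjoint[OF assms] cinner_move[OF atom_in[OF assms(1)]] by simp

lemma combination_eq_sum_atoms:
  "(\<Sum>E\<in>S. \<alpha> E *\<^sub>C blinfun_apply E z) = (\<Sum>X\<in>Pow S. (\<Sum>E\<in>X. \<alpha> E) *\<^sub>C blinfun_apply (atom S X) z)"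
proof -
  have "(\<Sum>E\<in>S. \<alpha> E *\<^sub>C E z) = (\<Sum>E\<in>S. \<Sum>X\<in>Pow S. if E \<in> X then \<alpha> E *\<^sub>C atom S X z else 0)"
  proof (intro sum.cong refl)
    fix E assume E: "E \<in> S"
    have "E z = (\<Sum>X\<in>Pow S. E (atom S X z))"
      by (subst (1) sum_atoms[of z, symmetric]) (simp add: blinfun.sum_right)
    also have "\<dots> = (\<Sum>X\<in>Pow S. if E \<in> X then atom S X z else 0)"
      using apply_atom E by (intro sum.cong) auto
    finally show "\<alpha> E *\<^sub>C E z = (\<Sum>X\<in>Pow S. if E \<in> X then \<alpha> E *\<^sub>C atom S X z else 0)"
      by (simp add: scaleC_sum_right if_distrib[of "\<lambda>v. \<alpha> E *\<^sub>C v"] cong: if_cong)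
  qed
  also have "\<dots> = (\<Sum>X\<in>Pow S. \<Sum>E\<in>S. if E \<in> X then \<alpha> E *\<^sub>C atom S X z else 0)"
    by (rule sum.swap)
  also have "\<dots> = (\<Sum>X\<in>Pow S. (\<Sum>E\<in>X. \<alpha> E) *\<^sub>C atom S X z)"
  proof (intro sum.cong refl)
    fix X assume "X \<in> Pow S"
    then have "{E \<in> S. E \<in> X} = X" by auto
    then show "(\<Sum>E\<in>S. if E \<in> X then \<alpha> E *\<^sub>C atom S X z else 0) = (\<Sum>E\<in>X. \<alpha> E) *\<^sub>C atom S X z"
      using S by (simp add: scaleC_sum_left flip: sum.inter_filter)
  qed
  finally show ?thesis .
qed

end

text \<open>For the spectral measure of \<open>\<xi>\<close> these are the simple functions, and \<open>cyclic_space \<xi>\<close> below is the space of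
  all square-integrable functions.\<close>

inductive_set simple_vectors for \<xi> :: 'a where
  base: "E \<in> BB \<Longrightarrow> blinfun_apply E \<xi> \<in> simple_vectors \<xi>"
| add: "u \<in> simple_vectors \<xi> \<Longrightarrow> v \<in> simple_vectors \<xi> \<Longrightarrow> u + v \<in> simple_vectors \<xi>"
| scale: "u \<in> simple_vectors \<xi> \<Longrightarrow> c *\<^sub>C u \<in> simple_vectors \<xi>"

lemma self_simple: "\<xi> \<in> simple_vectors \<xi>"
  using simple_vectors.base[OF one] by simp

lemma simple_subspace: "complex_subspace (simple_vectors \<xi>)"
  unfolding complex_subspace_def
  using simple_vectors.scale[OF self_simple, of 0] by (auto intro: simple_vectors.intros)

lemma simple_invariant: "u \<in> simple_vectors \<xi> \<Longrightarrow> E \<in> BB \<Longrightarrow> blinfun_apply E u \<in> simple_vectors \<xi>"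
proof (induction rule: simple_vectors.induct)
  case (base F)
  then show ?case using simple_vectors.base[OF inter[of E F]] by simp
qed (auto simp: blinfun.add_right apply_scaleC intro: simple_vectors.intros)

lemma simple_vectors_combination:
  "u \<in> simple_vectors \<xi> \<Longrightarrow> \<exists>S \<alpha>. finite S \<and> S \<subseteq> BB \<and> u = (\<Sum>E\<in>S. \<alpha> E *\<^sub>C blinfun_apply E \<xi>)"
proof (induction rule: simple_vectors.induct)
  case (base E)
  then show ?case by (intro exI[of _ "{E}"] exI[of _ "\<lambda>_. 1"]) auto
next
  case (add u v)
  then obtain S \<alpha> S' \<alpha>' where S: "finite S" "S \<subseteq> BB" "u = (\<Sum>E\<in>S. \<alpha> E *\<^sub>C blinfun_apply E \<xi>)"
    and S': "finite S'" "S' \<subseteq> BB" "v = (\<Sum>E\<in>S'. \<alpha>' E *\<^sub>C blinfun_apply E \<xi>)" by blast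
  have "u = (\<Sum>E\<in>S\<union>S'. (if E \<in> S then \<alpha> E else 0) *\<^sub>C blinfun_apply E \<xi>)"
    unfolding S(3) using S S' by (intro sum.mono_neutral_cong_left) auto
  moreover have "v = (\<Sum>E\<in>S\<union>S'. (if E \<in> S' then \<alpha>' E else 0) *\<^sub>C blinfun_apply E \<xi>)"
    unfolding S'(3) using S S' by (intro sum.mono_neutral_cong_left) auto
  ultimately have "u + v = (\<Sum>E\<in>S\<union>S'. ((if E \<in> S then \<alpha> E else 0) + (if E \<in> S' then \<alpha>' E else 0)) *\<^sub>C blinfun_apply E \<xi>)"
    by (simp add: sum.distrib scaleC_add_left)
  then show ?case using S S' by (intro exI[of _ "S \<union> S'"] exI conjI) auto
next
  case (scale u c)
  then obtain S \<alpha> where S: "finite S" "S \<subseteq> BB" "u = (\<Sum>E\<in>S. \<alpha> E *\<^sub>C blinfun_apply E \<xi>)" by blast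
  then show ?case
    by (intro exI[of _ S] exI[of _ "\<lambda>E. c * \<alpha> E"]) (auto simp: scaleC_sum_right scaleC_scaleC)
qed

definition cyclic_space :: "'a \<Rightarrow> 'a set" where
  "cyclic_space \<xi> = closure (simple_vectors \<xi>)"

lemma cyclic_space_subspace: "complex_subspace (cyclic_space \<xi>)" "closed (cyclic_space \<xi>)"
  unfolding cyclic_space_def by (auto intro: complex_subspace_closure simple_subspace)

lemma simple_in_cyclic: "u \<in> simple_vectors \<xi> \<Longrightarrow> u \<in> cyclic_space \<xi>"
  unfolding cyclic_space_def using closure_subset by blast

lemma cyclic_invariant:
  assumes "u \<in> cyclic_space \<xi>" "E \<in> BB" shows "blinfun_apply E u \<in> cyclic_space \<xi>"
proof -
  have "blinfun_apply E ` cyclic_space \<xi> \<subseteq> cyclic_space \<xi>"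
    unfolding cyclic_space_def using simple_invariant[OF _ assms(2)] closure_subset
    by (intro image_closure_subset) (auto intro: linear_continuous_on blinfun.bounded_linear_right)
  then show ?thesis using assms(1) by blast
qed

lemma cyclic_projection:
  obtains p where "p \<in> projections" "\<And>E x. E \<in> BB \<Longrightarrow> blinfun_apply p (blinfun_apply E x) = E (p x)"
    "\<And>x. blinfun_apply p x \<in> cyclic_space \<xi>" "\<And>x. x \<in> cyclic_space \<xi> \<Longrightarrow> blinfun_apply p x = x"
proof -
  obtain p where p: "p \<in> projections" "\<And>x. blinfun_apply p x \<in> cyclic_space \<xi>"
    "\<And>x. x \<in> cyclic_space \<xi> \<Longrightarrow> blinfun_apply p x = x"
    "\<And>x y. y \<in> cyclic_space \<xi> \<Longrightarrow> cinner (x - blinfun_apply p x) y = 0"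
    using projection_exists[OF cyclic_space_subspace, of \<xi>] by blast
  have "p (E x) = E (p x)" if E: "E \<in> BB" for E x
  proof -
    have "p (E (x - p x)) = 0"
    proof (rule projection_kernel[OF p(1)])
      show "cinner (E (x - p x)) (p y) = 0" for y
        using cinner_move[OF E] p(4)[OF cyclic_invariant[OF p(2) E]] by simp
    qed
    then show ?thesis using p(3)[OF cyclic_invariant[OF p(2) E]]
      by (simp add: blinfun.diff_right)
  qed
  then show thesis using p that by blast
qed

end

section \<open>Hahn decomposition\<close>

context boolean_projections
begin

lemma decreasing_limit:
  assumes E: "\<And>n. Es n \<in> BB"
    and dec: "\<And>n x. blinfun_apply (Es n) (blinfun_apply (Es (Suc n)) x) = Es (Suc n) x"
  shows "\<exists>G\<in>BB. \<forall>x. (\<lambda>n. blinfun_apply (Es n) x) \<longlonglongrightarrow> G x"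
proof -
  have "\<exists>G\<in>BB. \<forall>x. (\<lambda>n. blinfun_apply (id_blinfun - Es n) x) \<longlonglongrightarrow> G x"
    using E dec by (intro increasing_limit compl) (simp_all add: blinfun.diff_left blinfun.diff_right)
  then obtain G where G: "G \<in> BB" "\<And>x. (\<lambda>n. x - blinfun_apply (Es n) x) \<longlonglongrightarrow> G x"
    by (auto simp: blinfun.diff_left)
  have "(\<lambda>n. x - (x - blinfun_apply (Es n) x)) \<longlonglongrightarrow> x - G x" for x
    by (intro tendsto_intros G)
  then show ?thesis using compl[OF G(1)] by (intro bexI[of _ "id_blinfun - G"]) (auto simp: blinfun.diff_left)
qed

fun meets :: "(nat \<Rightarrow> 'a \<Rightarrow>\<^sub>L 'a) \<Rightarrow> nat \<Rightarrow> nat \<Rightarrow> 'a \<Rightarrow>\<^sub>L 'a" where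
  "meets Es k 0 = Es k"
| "meets Es k (Suc j) = Es (k + Suc j) o\<^sub>L meets Es k j"

text \<open>If \<open>m E\<^sub>n\<close> approaches the supremum \<open>s\<close> at the rate \<open>2\<^sup>-\<^sup>n\<close>, modularity gives
  \<open>m (E\<^sub>k \<and> \<dots> \<and> E\<^sub>l) \<ge> s - 2 * 2\<^sup>-\<^sup>k\<close>, so \<open>liminf E\<^sub>n\<close> attains \<open>s\<close>, and a projection attaining the
  supremum separates the positive from the negative part of \<open>m\<close>.\<close>

lemma Hahn_decomposition:
  fixes m :: "('a \<Rightarrow>\<^sub>L 'a) \<Rightarrow> real"
  assumes add: "\<And>E F. E \<in> BB \<Longrightarrow> F \<in> BB \<Longrightarrow> (\<And>x. blinfun_apply E (blinfun_apply F x) = 0) \<Longrightarrow> m (E + F) = m E + m F"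
    and bound: "\<And>E. E \<in> BB \<Longrightarrow> m E \<le> K"
    and cont: "\<And>Es G. (\<And>n. Es n \<in> BB) \<Longrightarrow> G \<in> BB \<Longrightarrow> (\<And>x. (\<lambda>n. blinfun_apply (Es n) x) \<longlonglongrightarrow> G x)
      \<Longrightarrow> (\<lambda>n. m (Es n)) \<longlonglongrightarrow> m G"
  obtains G where "G \<in> BB" "\<And>E. E \<in> BB \<Longrightarrow> (\<And>x. blinfun_apply G (blinfun_apply E x) = E x) \<Longrightarrow> m E \<ge> 0"
    "\<And>E. E \<in> BB \<Longrightarrow> (\<And>x. blinfun_apply G (blinfun_apply E x) = 0) \<Longrightarrow> m E \<le> 0"
proof -
  define s where "s = (SUP E\<in>BB. m E)"
  have bdd: "bdd_above (m ` BB)" using bound by (auto intro!: bdd_aboveI2)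
  have le_s: "m E \<le> s" if "E \<in> BB" for E unfolding s_def using that bdd by (rule cSUP_upper)
  have ne: "BB \<noteq> {}" using one by auto
  have "\<exists>E\<in>BB. s - (1/2)^n < m E" for n
    using less_cSUP_iff[OF ne bdd, of "s - (1/2)^n"] by (simp add: s_def)
  then obtain Es where Es: "\<And>n. Es n \<in> BB" and mEs: "\<And>n. s - (1/2)^n < m (Es n)" by metis
  have split: "m E = m (E o\<^sub>L F) + m (E - (E o\<^sub>L F))" if "E \<in> BB" "F \<in> BB" for E F
  proof -
    have "E - (E o\<^sub>L F) = E o\<^sub>L (id_blinfun - F)"
      by (rule blinfun_eqI) (simp add: blinfun.diff_left blinfun.diff_right)
    then have "E - (E o\<^sub>L F) \<in> BB" using that by (simp add: inter compl)
    moreover have "(E o\<^sub>L F) ((E - (E o\<^sub>L F)) x) = 0" for x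
      using commute[OF that] that by (simp add: blinfun.diff_left blinfun.diff_right)
    ultimately have "m ((E o\<^sub>L F) + (E - (E o\<^sub>L F))) = m (E o\<^sub>L F) + m (E - (E o\<^sub>L F))"
      using that by (intro add inter)
    then show ?thesis by simp
  qed
  have modular: "m (E o\<^sub>L F) \<ge> m E + m F - s" if "E \<in> BB" "F \<in> BB" for E F
  proof -
    have "E - (E o\<^sub>L F) = E o\<^sub>L (id_blinfun - F)"
      by (rule blinfun_eqI) (simp add: blinfun.diff_left blinfun.diff_right)
    then have B: "E - (E o\<^sub>L F) \<in> BB" using that by (simp add: inter compl)
    have *: "F ((E - (E o\<^sub>L F)) x) = 0" for x
      using commute[OF that] that by (simp add: blinfun.diff_left blinfun.diff_right)
    then have "m (F + (E - (E o\<^sub>L F))) = m F + m (E - (E o\<^sub>L F))" using that B by (intro add)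
    moreover have "m (F + (E - (E o\<^sub>L F))) \<le> s"
      using that B * by (intro le_s orthogonal_sum)
    ultimately show ?thesis using split[OF that] by simp
  qed
  have meets_in: "meets Es k j \<in> BB" for k j by (induction j) (auto intro: Es inter)
  have m_meets: "m (meets Es k j) \<ge> s - 2 * (1/2)^k + (1/2)^(k + j)" for k j
  proof (induction j)
    case 0
    show ?case using mEs[of k] by simp
  next
    case (Suc j)
    have "m (meets Es k (Suc j)) \<ge> m (Es (k + Suc j)) + m (meets Es k j) - s"
      using modular[OF Es meets_in] by simp
    then show ?case using Suc mEs[of "k + Suc j"] by simp
  qed
  have "\<exists>G\<in>BB. \<forall>x. (\<lambda>j. blinfun_apply (meets Es k j) x) \<longlonglongrightarrow> G x" for k
  proof (rule decreasing_limit[OF meets_in])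
    show "meets Es k j (meets Es k (Suc j) x) = meets Es k (Suc j) x" for j x
      using commute[OF meets_in Es, of k j "k + Suc j"] meets_in by simp
  qed
  then obtain D where D: "\<And>k. D k \<in> BB" and Dlim: "\<And>k x. (\<lambda>j. blinfun_apply (meets Es k j) x) \<longlonglongrightarrow> D k x"
    by metis
  have mD: "m (D k) \<ge> s - 2 * (1/2)^k" for k
  proof (rule LIMSEQ_le_const[OF cont[OF meets_in D Dlim]])
    show "\<exists>N. \<forall>n\<ge>N. s - 2 * (1/2)^k \<le> m (meets Es k n)"
      using m_meets[of k] by (meson order_trans le_add_same_cancel1 zero_le_power zero_le_divide_1_iff zero_le_numeral)
  qed
  have DS: "D k x = Es k (D (Suc k) x)" for k x
  proof -
    have "meets Es k (Suc j) x = Es k (meets Es (Suc k) j x)" for j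
      using commute[OF Es Es] by (induction j) auto
    then have "(\<lambda>j. Es k (meets Es (Suc k) j x)) \<longlonglongrightarrow> D k x"
      using LIMSEQ_Suc[OF Dlim[of k x]] by simp
    moreover have "(\<lambda>j. Es k (meets Es (Suc k) j x)) \<longlonglongrightarrow> Es k (D (Suc k) x)"
      by (intro blinfun.tendsto tendsto_const Dlim)
    ultimately show ?thesis by (rule LIMSEQ_unique)
  qed
  have "\<exists>G\<in>BB. \<forall>x. (\<lambda>n. blinfun_apply (D n) x) \<longlonglongrightarrow> G x"
  proof (rule increasing_limit[OF D])
    show "D k (D (Suc k) x) = D k x" for k x
      using DS[of k "D (Suc k) x"] DS[of k x] D by simp
  qed
  then obtain G where G: "G \<in> BB" and Glim: "\<And>x. (\<lambda>n. blinfun_apply (D n) x) \<longlonglongrightarrow> G x" by blast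
  have "m G \<ge> s"
  proof (rule LIMSEQ_le[OF _ cont[OF D G Glim]])
    have "(\<lambda>k. s - 2 * (1/2)^k) \<longlonglongrightarrow> s - 2 * 0"
      by (intro tendsto_intros LIMSEQ_power_zero) simp
    then show "(\<lambda>k. s - 2 * (1/2)^k) \<longlonglongrightarrow> s" by simp
  qed (use mD in blast)
  show thesis
  proof (rule that[OF G])
    fix E assume E: "E \<in> BB" "\<And>x. G (E x) = E x"
    have "G o\<^sub>L E = E" by (rule blinfun_eqI) (simp add: E)
    then have "m G = m E + m (G - E)" using split[OF G E(1)] by simp
    moreover have "G - E = G o\<^sub>L (id_blinfun - E)"
      using \<open>G o\<^sub>L E = E\<close> by (intro blinfun_eqI) (simp add: blinfun.diff_left blinfun.diff_right E)
    then have "m (G - E) \<le> s" using G E(1) by (simp add: le_s inter compl)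
    ultimately show "m E \<ge> 0" using \<open>m G \<ge> s\<close> by simp
  next
    fix E assume E: "E \<in> BB" "\<And>x. G (E x) = 0"
    then have "m (G + E) = m G + m E" "m (G + E) \<le> s"
      using G by (auto intro: add le_s orthogonal_sum)
    then show "m E \<le> 0" using \<open>m G \<ge> s\<close> by simp
  qed
qed

end

section \<open>Square-summable sequences and their approximation\<close>

definition sq_norm :: "(nat \<Rightarrow> 'a::complex_hilbert_space) \<Rightarrow> real" where
  "sq_norm x = (\<Sum>n. (norm (x n))\<^sup>2)"

lemma sq_norm_nonneg: "square_summable x \<Longrightarrow> sq_norm x \<ge> 0"
  unfolding sq_norm_def square_summable_def by (rule suminf_nonneg) auto

lemma square_summable_dominated:
  fixes x y :: "nat \<Rightarrow> 'a::complex_hilbert_space"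
  assumes x: "square_summable x" and yx: "\<And>n. norm (y n) \<le> C * norm (x n)"
  shows "square_summable y" "sq_norm y \<le> C\<^sup>2 * sq_norm x"
proof -
  have le: "(norm (y n))\<^sup>2 \<le> C\<^sup>2 * (norm (x n))\<^sup>2" for n
    using power_mono[OF yx, of n 2] by (simp add: power_mult_distrib)
  have s: "summable (\<lambda>n. C\<^sup>2 * (norm (x n))\<^sup>2)"
    using x unfolding square_summable_def by (rule summable_mult)
  then show y: "square_summable y" unfolding square_summable_def
    using le by (intro summable_comparison_test'[OF s]) auto
  show "sq_norm y \<le> C\<^sup>2 * sq_norm x"
    using suminf_le[OF le _ s] y x unfolding sq_norm_def square_summable_def
    by (simp add: suminf_mult)
qed

lemma square_summable_add:
  fixes x y :: "nat \<Rightarrow> 'a::complex_hilbert_space"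
  assumes x: "square_summable x" and y: "square_summable y"
  shows "square_summable (\<lambda>n. x n + y n)" "sq_norm (\<lambda>n. x n + y n) \<le> 2 * sq_norm x + 2 * sq_norm y"
proof -
  have le: "(norm (x n + y n))\<^sup>2 \<le> 2 * (norm (x n))\<^sup>2 + 2 * (norm (y n))\<^sup>2" for n
    using parallelogram[of "x n" "y n"] zero_le_power2[of "norm (x n - y n)"] by linarith
  have s: "summable (\<lambda>n. 2 * (norm (x n))\<^sup>2 + 2 * (norm (y n))\<^sup>2)"
    using x y unfolding square_summable_def by (intro summable_add summable_mult)
  show xy: "square_summable (\<lambda>n. x n + y n)" unfolding square_summable_def
    using le by (intro summable_comparison_test'[OF s]) auto
  have "(\<Sum>n. 2 * (norm (x n))\<^sup>2 + 2 * (norm (y n))\<^sup>2) = 2 * sq_norm x + 2 * sq_norm y"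
    using x y unfolding sq_norm_def square_summable_def
    by (simp add: suminf_mult flip: suminf_add)
  then show "sq_norm (\<lambda>n. x n + y n) \<le> 2 * sq_norm x + 2 * sq_norm y"
    using suminf_le[OF le _ s] xy unfolding sq_norm_def square_summable_def by simp
qed

lemma square_summable_minus:
  "square_summable (\<lambda>n. - x n) = square_summable x" "sq_norm (\<lambda>n. - x n) = sq_norm x"
  unfolding square_summable_def sq_norm_def by auto

lemma square_summable_diff:
  fixes x y :: "nat \<Rightarrow> 'a::complex_hilbert_space"
  assumes "square_summable x" "square_summable y"
  shows "square_summable (\<lambda>n. x n - y n)" "sq_norm (\<lambda>n. x n - y n) \<le> 2 * sq_norm x + 2 * sq_norm y"
  using square_summable_add[of x "\<lambda>n. - y n"] assms by (auto simp: square_summable_minus)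

lemma square_summable_finite_support:
  assumes "\<And>n. n \<ge> N \<Longrightarrow> x n = 0" shows "square_summable x"
  unfolding square_summable_def using assms by (intro summable_finite[of "{..<N}"]) auto

lemma square_summable_apply:
  fixes T :: "'a::complex_hilbert_space \<Rightarrow>\<^sub>L 'a"
  assumes "square_summable x"
  shows "square_summable (\<lambda>n. blinfun_apply T (x n))"
    "sq_norm (\<lambda>n. blinfun_apply T (x n)) \<le> (norm T)\<^sup>2 * sq_norm x"
  using square_summable_dominated[OF assms, of "\<lambda>n. T (x n)" "norm T"] norm_blinfun by auto

lemma square_summable_scaleC_vector:
  fixes v :: "'a::complex_hilbert_space"
  assumes "summable (\<lambda>n. (cmod (c n))\<^sup>2)"
  shows "square_summable (\<lambda>n. c n *\<^sub>C v)" "sq_norm (\<lambda>n. c n *\<^sub>C v) = (\<Sum>n. (cmod (c n))\<^sup>2) * (norm v)\<^sup>2"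
  using assms unfolding square_summable_def sq_norm_def
  by (auto simp: norm_scaleC power_mult_distrib suminf_mult2 intro: summable_mult2)

lemma sq_norm_projection_split:
  assumes P: "P \<in> projections" and x: "square_summable x"
  shows "sq_norm (\<lambda>n. blinfun_apply P (x n)) + sq_norm (\<lambda>n. x n - blinfun_apply P (x n)) = sq_norm x"
proof -
  have "square_summable (\<lambda>n. P (x n))" using x by (rule square_summable_apply)
  moreover have "square_summable (\<lambda>n. x n - P (x n))"
    by (rule square_summable_diff) fact+
  ultimately show ?thesis unfolding sq_norm_def square_summable_def
    by (simp add: suminf_add norm_projection_split[OF P])
qed

lemma sq_norm_projection_le:
  assumes "P \<in> projections" and "square_summable x"
  shows "sq_norm (\<lambda>n. blinfun_apply P (x n)) \<le> sq_norm x"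
  using sq_norm_projection_split[OF assms]
    sq_norm_nonneg[OF square_summable_diff(1)[OF assms(2) square_summable_apply(1)[OF assms(2), of P]]]
  by linarith

lemma cinner_series:
  fixes x y :: "nat \<Rightarrow> 'a::complex_hilbert_space"
  assumes x: "square_summable x" and y: "square_summable y"
  shows "summable (\<lambda>n. cinner (x n) (y n))"
    "cmod (\<Sum>n. cinner (x n) (y n)) \<le> sqrt (sq_norm x) * sqrt (sq_norm y)"
proof -
  have part: "(\<Sum>n<N. cmod (cinner (x n) (y n))) \<le> sqrt (sq_norm x) * sqrt (sq_norm y)" for N
  proof -
    have "(\<Sum>n<N. cmod (cinner (x n) (y n))) \<le> (\<Sum>n<N. \<bar>norm (x n)\<bar> * \<bar>norm (y n)\<bar>)"
      by (intro sum_mono) (simp add: Cauchy_Schwarz)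
    also have "\<dots> \<le> L2_set (\<lambda>n. norm (x n)) {..<N} * L2_set (\<lambda>n. norm (y n)) {..<N}"
      by (rule L2_set_mult_ineq)
    also have "\<dots> \<le> sqrt (sq_norm x) * sqrt (sq_norm y)"
      using x y unfolding L2_set_def sq_norm_def square_summable_def
      by (intro mult_mono real_sqrt_le_mono sum_le_suminf) (auto intro: sum_nonneg suminf_nonneg)
    finally show ?thesis .
  qed
  then have abs: "summable (\<lambda>n. cmod (cinner (x n) (y n)))"
    by (intro summableI_nonneg_bounded[of _ "sqrt (sq_norm x) * sqrt (sq_norm y)"]) auto
  then show "summable (\<lambda>n. cinner (x n) (y n))" by (rule summable_norm_cancel)
  have "cmod (\<Sum>n. cinner (x n) (y n)) \<le> (\<Sum>n. cmod (cinner (x n) (y n)))"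
    using abs by (rule summable_norm)
  also have "\<dots> \<le> sqrt (sq_norm x) * sqrt (sq_norm y)"
    using abs part by (rule suminf_le_const)
  finally show "cmod (\<Sum>n. cinner (x n) (y n)) \<le> sqrt (sq_norm x) * sqrt (sq_norm y)" .
qed

context boolean_projections
begin

lemma sq_norm_continuous:
  assumes Es: "\<And>n. Es n \<in> BB" and x: "square_summable x"
    and lim: "\<And>x. (\<lambda>k. blinfun_apply (Es k) x) \<longlonglongrightarrow> blinfun_apply G x"
  shows "(\<lambda>k. sq_norm (\<lambda>n. Es k (x n))) \<longlonglongrightarrow> sq_norm (\<lambda>n. G (x n))"
proof -
  have "eventually (\<lambda>(n, k). norm ((norm (Es k (x n)))\<^sup>2) \<le> (norm (x n))\<^sup>2) (at_top \<times>\<^sub>F sequentially)"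
    by (intro always_eventually) (auto simp: norm_projection_le[OF proj[OF Es]])
  moreover have "(\<lambda>k. (norm (Es k (x n)))\<^sup>2) \<longlonglongrightarrow> (norm (G (x n)))\<^sup>2" for n
    by (intro tendsto_intros lim)
  moreover have "summable (\<lambda>n. (norm (x n))\<^sup>2)" using x unfolding square_summable_def .
  ultimately show ?thesis
    using tannerys_theorem[of "\<lambda>n k. (norm (Es k (x n)))\<^sup>2" "\<lambda>n. (norm (G (x n)))\<^sup>2" sequentially "\<lambda>n. (norm (x n))\<^sup>2"]
    unfolding sq_norm_def by (metis sequentially_bot)
qed

lemma sq_norm_add:
  assumes E: "E \<in> BB" and F: "F \<in> BB" and EF: "\<And>z. blinfun_apply E (blinfun_apply F z) = 0" and x: "square_summable x"
  shows "sq_norm (\<lambda>n. (E + F) (x n)) = sq_norm (\<lambda>n. E (x n)) + sq_norm (\<lambda>n. F (x n))"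
    "(norm ((E + F) z))\<^sup>2 = (norm (E z))\<^sup>2 + (norm (F z))\<^sup>2"
proof -
  have pt: "(norm ((E + F) z))\<^sup>2 = (norm (E z))\<^sup>2 + (norm (F z))\<^sup>2" for z
    using pythagoras[of "E z" "F z"] EF cinner_move[OF E] by (simp add: blinfun.add_left)
  then show "(norm ((E + F) z))\<^sup>2 = (norm (E z))\<^sup>2 + (norm (F z))\<^sup>2" .
  show "sq_norm (\<lambda>n. (E + F) (x n)) = sq_norm (\<lambda>n. E (x n)) + sq_norm (\<lambda>n. F (x n))"
    using square_summable_apply(1)[OF x, of E] square_summable_apply(1)[OF x, of F]
    unfolding sq_norm_def square_summable_def pt by (simp add: suminf_add)
qed

lemma simple_approximation:
  assumes x: "square_summable x" "\<And>n. x n \<in> cyclic_space \<xi>" and e: "e > 0"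
  obtains N u where "\<And>n. u n \<in> simple_vectors \<xi>" "\<And>n. n \<ge> N \<Longrightarrow> u n = 0"
    "square_summable u" "sq_norm (\<lambda>n. x n - u n) \<le> e"
proof -
  have s: "summable (\<lambda>n. (norm (x n))\<^sup>2)" using x(1) unfolding square_summable_def .
  have "(\<lambda>N. \<Sum>n<N. (norm (x n))\<^sup>2) \<longlonglongrightarrow> sq_norm x"
    using summable_LIMSEQ[OF s] unfolding sq_norm_def .
  then have "eventually (\<lambda>N. sq_norm x - e/2 < (\<Sum>n<N. (norm (x n))\<^sup>2)) sequentially"
    using e by (intro order_tendstoD) auto
  then obtain N where N: "sq_norm x - e/2 < (\<Sum>n<N. (norm (x n))\<^sup>2)"
    unfolding eventually_sequentially by blast
  define d where "d = sqrt (e / (2 * real N + 2))"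
  have d: "d > 0" unfolding d_def using e by simp
  have "\<exists>v\<in>simple_vectors \<xi>. norm (x n - v) < d" for n
    using x(2)[of n] d unfolding cyclic_space_def closure_approachable
    by (metis dist_commute dist_norm)
  then obtain v where v: "\<And>n. v n \<in> simple_vectors \<xi>" "\<And>n. norm (x n - v n) < d" by metis
  define u where "u n = (if n < N then v n else 0)" for n
  have ss: "square_summable u" by (rule square_summable_finite_support[of N]) (simp add: u_def)
  have "sq_norm (\<lambda>n. x n - u n) = (\<Sum>n. (norm (x (n + N)))\<^sup>2) + (\<Sum>n<N. (norm (x n - v n))\<^sup>2)"
    using suminf_split_initial_segment[of "\<lambda>n. (norm (x n - u n))\<^sup>2" N] square_summable_diff(1)[OF x(1) ss]
    unfolding sq_norm_def square_summable_def by (simp add: u_def)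
  also have "(\<Sum>n. (norm (x (n + N)))\<^sup>2) = sq_norm x - (\<Sum>n<N. (norm (x n))\<^sup>2)"
    using suminf_split_initial_segment[OF s, of N] unfolding sq_norm_def by simp
  also have "(\<Sum>n<N. (norm (x n - v n))\<^sup>2) \<le> (\<Sum>n<N. d\<^sup>2)"
    using v(2) by (intro sum_mono power_mono) (auto intro: less_imp_le)
  also have "(\<Sum>n<N. d\<^sup>2) \<le> e / 2"
    using e by (simp add: d_def field_simps)
  finally have "sq_norm (\<lambda>n. x n - u n) \<le> e" using N by simp
  moreover have "u n \<in> simple_vectors \<xi>" for n
    using v simple_subspace unfolding u_def complex_subspace_def by auto
  moreover have "u n = 0" if "n \<ge> N" for n using that by (simp add: u_def)
  ultimately show thesis using ss that by blast
qed

text \<open>On each piece \<open>a X\<close> the ratio \<open>x / \<xi>\<close> is close to the constant \<open>c X\<close> hereditarily, that is, also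
  on each projection below \<open>a X\<close>. The pieces need not exhaust the space: the part of \<open>x\<close> off them is
  only small in norm.\<close>

definition hereditary_approximation where
  "hereditary_approximation x \<xi> \<epsilon> I a c \<longleftrightarrow> finite I \<and> (\<forall>X\<in>I. a X \<in> BB) \<and>
    (\<forall>X\<in>I. \<forall>Y\<in>I. \<forall>z. X \<noteq> Y \<longrightarrow> blinfun_apply (a X) (blinfun_apply (a Y) z) = 0) \<and>
    (\<exists>N. \<forall>X. \<forall>n\<ge>N. c X n = 0) \<and>
    (\<forall>X\<in>I. \<forall>E\<in>BB. (\<forall>z. blinfun_apply (a X) (blinfun_apply E z) = blinfun_apply E z) \<longrightarrow>
      sq_norm (\<lambda>n. blinfun_apply E (x n - c X n *\<^sub>C \<xi>)) \<le>
        2 * \<epsilon> * (1 + 2 * (\<Sum>n. (cmod (c X n))\<^sup>2)) * (norm (blinfun_apply E \<xi>))\<^sup>2) \<and>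
    sq_norm (\<lambda>n. x n - (\<Sum>X\<in>I. c X n *\<^sub>C blinfun_apply (a X) \<xi>)) \<le> 2 * \<epsilon>"

lemma hereditary_approximationD:
  assumes "hereditary_approximation x \<xi> \<epsilon> I a c"
  shows "finite I" "\<And>X. X \<in> I \<Longrightarrow> a X \<in> BB"
    "\<And>X Y z. X \<in> I \<Longrightarrow> Y \<in> I \<Longrightarrow> X \<noteq> Y \<Longrightarrow> blinfun_apply (a X) (blinfun_apply (a Y) z) = 0"
    "\<exists>N. \<forall>X. \<forall>n\<ge>N. c X n = 0"
    "\<And>X E. X \<in> I \<Longrightarrow> E \<in> BB \<Longrightarrow> (\<And>z. blinfun_apply (a X) (blinfun_apply E z) = E z) \<Longrightarrow>
      sq_norm (\<lambda>n. blinfun_apply E (x n - c X n *\<^sub>C \<xi>)) \<le> 2 * \<epsilon> * (1 + 2 * (\<Sum>n. (cmod (c X n))\<^sup>2)) * (norm (E \<xi>))\<^sup>2"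
    "sq_norm (\<lambda>n. x n - (\<Sum>X\<in>I. c X n *\<^sub>C blinfun_apply (a X) \<xi>)) \<le> 2 * \<epsilon>"
  using assms unfolding hereditary_approximation_def by simp_all

text \<open>Approximate \<open>x\<close> in norm by a sequence \<open>u\<close> of simple vectors, which is constant on the atoms of a finite
  algebra, and keep the part \<open>G\<close> of the space where \<open>\<Sum>\<^sub>n \<parallel>E (x\<^sub>n - u\<^sub>n)\<parallel>\<^sup>2 \<le> \<epsilon> (\<parallel>E \<xi>\<parallel>\<^sup>2 + \<Sum>\<^sub>n \<parallel>E x\<^sub>n\<parallel>\<^sup>2)\<close>
  holds hereditarily. The opposite inequality off \<open>G\<close> bounds the part of \<open>x\<close> that is lost there; this is why
  \<open>\<Sum>\<^sub>n \<parallel>E x\<^sub>n\<parallel>\<^sup>2\<close> is added to the measure of \<open>\<xi>\<close>. The price is a bound relative to \<open>1 + 2 \<parallel>c X\<parallel>\<^sup>2\<close>.\<close>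

lemma hereditary_approximation_exists:
  assumes x: "square_summable x" "\<And>n. x n \<in> cyclic_space \<xi>" and e: "0 < \<epsilon>" "\<epsilon> \<le> 1/4"
  shows "\<exists>(I :: ('a \<Rightarrow>\<^sub>L 'a) set set) a c. hereditary_approximation x \<xi> \<epsilon> I a c"
proof -
  have e2: "\<epsilon>\<^sup>2 > 0" using e by simp
  obtain N u where u: "\<And>n. u n \<in> simple_vectors \<xi>" "\<And>n. n \<ge> N \<Longrightarrow> u n = 0"
    "square_summable u" and xu: "sq_norm (\<lambda>n. x n - u n) \<le> \<epsilon>\<^sup>2"
    using simple_approximation[OF x e2] by metis
  define s where "s n = x n - u n" for n
  have s: "square_summable s" unfolding s_def using x(1) u(3) by (rule square_summable_diff)
  have "\<forall>n. \<exists>S \<alpha>. finite S \<and> S \<subseteq> BB \<and> u n = (\<Sum>E\<in>S. \<alpha> E *\<^sub>C blinfun_apply E \<xi>)"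
    using simple_vectors_combination[OF u(1)] by blast
  then obtain S \<alpha> where S: "\<And>n. finite (S n)" "\<And>n. S n \<subseteq> BB"
    and uS: "\<And>n. u n = (\<Sum>E\<in>S n. \<alpha> n E *\<^sub>C blinfun_apply E \<xi>)" by metis
  define U where "U = (\<Union>n<N. S n)"
  have U: "finite U" "U \<subseteq> BB" unfolding U_def using S by auto
  note at = atom_in[OF U] atom_disjoint[OF U]
  define c where "c X n = (if n < N then \<Sum>E\<in>X \<inter> S n. \<alpha> n E else 0)" for X n
  have c0: "c X n = 0" if "n \<ge> N" for X n using that by (simp add: c_def)
  have uc: "u n = (\<Sum>X\<in>Pow U. c X n *\<^sub>C atom U X \<xi>)" for n
  proof (cases "n < N")
    case True
    have "u n = (\<Sum>E\<in>U. (if E \<in> S n then \<alpha> n E else 0) *\<^sub>C blinfun_apply E \<xi>)"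
      unfolding uS using U S True by (intro sum.mono_neutral_cong_left) (auto simp: U_def)
    also have "\<dots> = (\<Sum>X\<in>Pow U. (\<Sum>E\<in>X. if E \<in> S n then \<alpha> n E else 0) *\<^sub>C atom U X \<xi>)"
      by (rule combination_eq_sum_atoms[OF U])
    also have "\<dots> = (\<Sum>X\<in>Pow U. c X n *\<^sub>C atom U X \<xi>)"
    proof (intro sum.cong refl)
      fix X assume "X \<in> Pow U"
      then have "finite X" using U finite_subset by auto
      then show "(\<Sum>E\<in>X. if E \<in> S n then \<alpha> n E else 0) *\<^sub>C atom U X \<xi> = c X n *\<^sub>C atom U X \<xi>"
        using True by (simp add: c_def sum.inter_restrict)
    qed
    finally show ?thesis .
  qed (simp add: u(2) c_def)
  have csum: "summable (\<lambda>n. (cmod (c X n))\<^sup>2)" for X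
    by (rule summable_finite[of "{..<N}"]) (auto simp: c_def)
  define m where "m E = \<epsilon> * ((norm (E \<xi>))\<^sup>2 + sq_norm (\<lambda>n. E (x n))) - sq_norm (\<lambda>n. E (s n))"
    for E :: "'a \<Rightarrow>\<^sub>L 'a"
  obtain G where G: "G \<in> BB"
    and Gpos: "\<And>E. E \<in> BB \<Longrightarrow> (\<And>x. blinfun_apply G (blinfun_apply E x) = E x) \<Longrightarrow> m E \<ge> 0"
    and Gneg: "\<And>E. E \<in> BB \<Longrightarrow> (\<And>x. blinfun_apply G (blinfun_apply E x) = 0) \<Longrightarrow> m E \<le> 0"
  proof (rule Hahn_decomposition[of m "\<epsilon> * ((norm \<xi>)\<^sup>2 + sq_norm x)"])
    show "m (E + F) = m E + m F" if "E \<in> BB" "F \<in> BB" "\<And>z. E (F z) = 0" for E F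
      using sq_norm_add[OF that x(1)] sq_norm_add[OF that s] by (simp add: m_def algebra_simps)
    show "m E \<le> \<epsilon> * ((norm \<xi>)\<^sup>2 + sq_norm x)" if "E \<in> BB" for E
    proof -
      have "m E \<le> \<epsilon> * ((norm (E \<xi>))\<^sup>2 + sq_norm (\<lambda>n. E (x n)))"
        using sq_norm_nonneg[OF square_summable_apply(1)[OF s, of E]] by (simp add: m_def)
      also have "\<dots> \<le> \<epsilon> * ((norm \<xi>)\<^sup>2 + sq_norm x)"
        using e norm_projection_le[OF proj[OF that]] sq_norm_projection_le[OF proj[OF that] x(1)]
        by (intro mult_left_mono add_mono power_mono) auto
      finally show ?thesis .
    qed
    show "(\<lambda>n. m (Es n)) \<longlonglongrightarrow> m G" if "\<And>n. Es n \<in> BB" "G \<in> BB"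
      "\<And>x. (\<lambda>n. blinfun_apply (Es n) x) \<longlonglongrightarrow> G x" for Es G
      unfolding m_def
      by (intro tendsto_intros that(3) sq_norm_continuous[OF that(1) x(1) that(3)] sq_norm_continuous[OF that(1) s that(3)])
  qed (rule that; blast)
  define a where "a X = atom U X o\<^sub>L G" for X
  have "hereditary_approximation x \<xi> \<epsilon> (Pow U) a c"
    unfolding hereditary_approximation_def
  proof (intro conjI ballI allI impI)
    show "finite (Pow U)" using U by simp
    show "a X \<in> BB" if "X \<in> Pow U" for X using that at G by (auto simp: a_def intro: inter)
    show "a X (a Y z) = 0" if "X \<in> Pow U" "Y \<in> Pow U" "X \<noteq> Y" for X Y z
      using that at commute[OF G at(1)] G by (auto simp: a_def)
    show "\<exists>N. \<forall>X. \<forall>n\<ge>N. c X n = 0" using c0 by blast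
  next
    fix X E assume X: "X \<in> Pow U" and E: "E \<in> BB" and "\<forall>z. a X (blinfun_apply E z) = E z"
    then have aE: "a X (E z) = E z" for z by blast
    have GE: "G (E z) = E z" for z
      using aE[of z] commute[OF G at(1)] X G unfolding a_def by (metis Pow_iff blinfun_apply_blinfun_compose idem)
    have XE: "atom U X (E z) = E z" for z using aE[of z] by (simp add: a_def GE)
    have Eu: "E (u n) = c X n *\<^sub>C E \<xi>" for n
    proof -
      have "E (atom U Y \<xi>) = (if Y = X then E \<xi> else 0)" if Y: "Y \<in> Pow U" for Y
      proof -
        have *: "E (atom U Y \<xi>) = atom U Y (atom U X (E \<xi>))" using XE commute[OF E at(1)] Y by simp
        show ?thesis
        proof (cases "Y = X")
          case True
          then show ?thesis using * XE by simp
        next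
          case False
          then show ?thesis using * at(2)[of Y X] X Y by simp
        qed
      qed
      then have "E (u n) = (\<Sum>Y\<in>Pow U. if Y = X then c X n *\<^sub>C E \<xi> else 0)"
        unfolding uc blinfun.sum_right apply_scaleC[OF E] by (intro sum.cong) auto
      then show ?thesis using X U by simp
    qed
    have Es: "E (x n - c X n *\<^sub>C \<xi>) = E (s n)" for n
      by (simp add: s_def blinfun.diff_right Eu apply_scaleC[OF E])
    have "sq_norm (\<lambda>n. E (x n)) = sq_norm (\<lambda>n. E (s n) + c X n *\<^sub>C E \<xi>)"
      by (simp add: s_def blinfun.diff_right Eu)
    also have "\<dots> \<le> 2 * sq_norm (\<lambda>n. E (s n)) + 2 * sq_norm (\<lambda>n. c X n *\<^sub>C E \<xi>)"
      by (intro square_summable_add square_summable_apply s square_summable_scaleC_vector csum)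
    also have "sq_norm (\<lambda>n. c X n *\<^sub>C E \<xi>) = (\<Sum>n. (cmod (c X n))\<^sup>2) * (norm (E \<xi>))\<^sup>2"
      by (rule square_summable_scaleC_vector[OF csum])
    finally have tau: "\<epsilon> * sq_norm (\<lambda>n. E (x n)) \<le>
      \<epsilon> * (2 * sq_norm (\<lambda>n. E (s n)) + 2 * ((\<Sum>n. (cmod (c X n))\<^sup>2) * (norm (E \<xi>))\<^sup>2))"
      using e by (intro mult_left_mono) auto
    have "0 \<le> m E" using Gpos[OF E GE] .
    then have "sq_norm (\<lambda>n. E (s n)) \<le> \<epsilon> * (norm (E \<xi>))\<^sup>2 + \<epsilon> * sq_norm (\<lambda>n. E (x n))"
      by (simp add: m_def algebra_simps)
    also note tau
    finally have *: "sq_norm (\<lambda>n. E (s n)) \<le> \<epsilon> * ((1 + 2 * (\<Sum>n. (cmod (c X n))\<^sup>2)) * (norm (E \<xi>))\<^sup>2)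
      + 2 * (\<epsilon> * sq_norm (\<lambda>n. E (s n)))"
      by (simp add: algebra_simps)
    moreover have "\<epsilon> * sq_norm (\<lambda>n. E (s n)) \<le> 1/4 * sq_norm (\<lambda>n. E (s n))"
      using e sq_norm_nonneg[OF square_summable_apply(1)[OF s, of E]] by (intro mult_right_mono) auto
    ultimately show "sq_norm (\<lambda>n. E (x n - c X n *\<^sub>C \<xi>)) \<le>
        2 * \<epsilon> * (1 + 2 * (\<Sum>n. (cmod (c X n))\<^sup>2)) * (norm (E \<xi>))\<^sup>2"
      unfolding Es by simp
  next
    define r where "r n = x n - (\<Sum>X\<in>Pow U. c X n *\<^sub>C a X \<xi>)" for n
    have Gu: "(\<Sum>X\<in>Pow U. c X n *\<^sub>C a X \<xi>) = G (u n)" for n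
      unfolding uc blinfun.sum_right apply_scaleC[OF G]
      using commute[OF G at(1)] by (intro sum.cong) (auto simp: a_def)
    have r: "square_summable r" unfolding r_def Gu
      by (intro square_summable_diff x square_summable_apply u)
    have Gr: "G (r n) = G (s n)" "r n - G (r n) = (id_blinfun - G) (x n)" for n
      using G by (simp_all add: r_def Gu s_def blinfun.diff_right blinfun.diff_left)
    let ?H = "id_blinfun - G"
    have H: "?H \<in> BB" using G by (rule compl)
    have "m ?H \<le> 0" using G by (intro Gneg H) (simp add: blinfun.diff_left blinfun.diff_right)
    then have "\<epsilon> * sq_norm (\<lambda>n. ?H (x n)) \<le> sq_norm (\<lambda>n. ?H (s n)) - \<epsilon> * (norm (?H \<xi>))\<^sup>2"
      by (simp add: m_def algebra_simps)
    also have "\<dots> \<le> sq_norm (\<lambda>n. ?H (s n))" using e by simp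
    also have "\<dots> \<le> sq_norm s" by (rule sq_norm_projection_le[OF proj[OF H] s])
    also have "\<dots> \<le> \<epsilon> * \<epsilon>" using xu by (simp add: s_def[abs_def] power2_eq_square)
    finally have Hx: "sq_norm (\<lambda>n. ?H (x n)) \<le> \<epsilon>" using e by simp
    have "sq_norm r = sq_norm (\<lambda>n. G (s n)) + sq_norm (\<lambda>n. ?H (x n))"
      using sq_norm_projection_split[OF proj[OF G] r, unfolded Gr(2), unfolded Gr(1)] by simp
    moreover have "sq_norm (\<lambda>n. G (s n)) \<le> \<epsilon>"
    proof -
      have "sq_norm (\<lambda>n. G (s n)) \<le> sq_norm s" by (rule sq_norm_projection_le[OF proj[OF G] s])
      also have "\<dots> \<le> \<epsilon>\<^sup>2" using xu by (simp add: s_def[abs_def])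
      also have "\<dots> \<le> 1 * \<epsilon>" unfolding power2_eq_square using e by (intro mult_right_mono) auto
      finally show ?thesis by simp
    qed
    ultimately show "sq_norm (\<lambda>n. x n - (\<Sum>X\<in>Pow U. c X n *\<^sub>C a X \<xi>)) \<le> 2 * \<epsilon>"
      using Hx unfolding r_def[abs_def] by simp
  qed
  then show ?thesis by blast
qed

end

section \<open>Positive operators supported on a lattice\<close>

text \<open>Raising the flow on one edge after the other until an endpoint is saturated keeps the
  saturated endpoints saturated.\<close>

lemma greedy_flow:
  fixes \<mu> :: "'i \<Rightarrow> real" and \<nu> :: "'j \<Rightarrow> real"
  assumes fin: "finite I" "finite J" and R: "finite R" "R \<subseteq> I \<times> J"
    and nonneg: "\<And>i. i \<in> I \<Longrightarrow> \<mu> i \<ge> 0" "\<And>j. j \<in> J \<Longrightarrow> \<nu> j \<ge> 0"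
  shows "\<exists>f. (\<forall>i j. f i j \<ge> 0) \<and> (\<forall>i j. (i, j) \<notin> R \<longrightarrow> f i j = 0) \<and>
    (\<forall>i\<in>I. (\<Sum>j\<in>J. f i j) \<le> \<mu> i) \<and> (\<forall>j\<in>J. (\<Sum>i\<in>I. f i j) \<le> \<nu> j) \<and>
    (\<forall>i j. (i, j) \<in> R \<longrightarrow> (\<Sum>j\<in>J. f i j) = \<mu> i \<or> (\<Sum>i\<in>I. f i j) = \<nu> j)"
  using R
proof (induction R rule: finite_induct)
  case empty
  show ?case by (rule exI[of _ "\<lambda>_ _. 0"]) (use nonneg in auto)
next
  case (insert e R)
  obtain k l where e: "e = (k, l)" "k \<in> I" "l \<in> J" using insert.prems by (cases e) auto
  have "R \<subseteq> I \<times> J" using insert.prems by auto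
  from insert.IH[OF this] obtain f where f: "(\<forall>i j. f i j \<ge> 0) \<and> (\<forall>i j. (i, j) \<notin> R \<longrightarrow> f i j = 0) \<and>
    (\<forall>i\<in>I. (\<Sum>j\<in>J. f i j) \<le> \<mu> i) \<and> (\<forall>j\<in>J. (\<Sum>i\<in>I. f i j) \<le> \<nu> j) \<and>
    (\<forall>i j. (i, j) \<in> R \<longrightarrow> (\<Sum>j\<in>J. f i j) = \<mu> i \<or> (\<Sum>i\<in>I. f i j) = \<nu> j)" ..
  then have f0: "\<And>i j. f i j \<ge> 0" and fR: "\<And>i j. (i, j) \<notin> R \<Longrightarrow> f i j = 0"
    and f\<mu>: "\<And>i. i \<in> I \<Longrightarrow> (\<Sum>j\<in>J. f i j) \<le> \<mu> i" and f\<nu>: "\<And>j. j \<in> J \<Longrightarrow> (\<Sum>i\<in>I. f i j) \<le> \<nu> j"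
    and sat: "\<And>i j. (i, j) \<in> R \<Longrightarrow> (\<Sum>j\<in>J. f i j) = \<mu> i \<or> (\<Sum>i\<in>I. f i j) = \<nu> j"
    by blast+
  define t where "t = min (\<mu> k - (\<Sum>j\<in>J. f k j)) (\<nu> l - (\<Sum>i\<in>I. f i l))"
  have t0: "t \<ge> 0" using f\<mu>[OF e(2)] f\<nu>[OF e(3)] by (simp add: t_def)
  define g where "g i j = f i j + (if i = k \<and> j = l then t else 0)" for i j
  have g1: "(\<Sum>j\<in>J. g i j) = (\<Sum>j\<in>J. f i j) + (if i = k then t else 0)" for i
    using e(3) fin(2) by (cases "i = k") (simp_all add: g_def sum.distrib)
  have g2: "(\<Sum>i\<in>I. g i j) = (\<Sum>i\<in>I. f i j) + (if j = l then t else 0)" for j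
    using e(2) fin(1) by (cases "j = l") (simp_all add: g_def sum.distrib)
  have "(\<Sum>j\<in>J. g i j) \<le> \<mu> i" if "i \<in> I" for i using f\<mu>[OF that] by (auto simp: g1 t_def)
  moreover have "(\<Sum>i\<in>I. g i j) \<le> \<nu> j" if "j \<in> J" for j using f\<nu>[OF that] by (auto simp: g2 t_def)
  moreover have "(\<Sum>j\<in>J. g i j) = \<mu> i \<or> (\<Sum>i\<in>I. g i j) = \<nu> j" if "(i, j) \<in> insert e R" for i j
  proof (cases "(i, j) \<in> R")
    case True
    then have ij: "i \<in> I" "j \<in> J" using insert.prems by auto
    show ?thesis using sat[OF True] f\<mu>[OF ij(1)] f\<nu>[OF ij(2)] t0 by (auto simp: g1 g2 t_def)
  next
    case False
    then show ?thesis using that e by (auto simp: g1 g2 t_def min_def)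
  qed
  moreover have "g i j = 0" if "(i, j) \<notin> insert e R" for i j using that fR e by (auto simp: g_def)
  ultimately show ?case using f0 t0 by (intro exI[of _ g]) (auto simp: g_def)
qed

context boolean_projections
begin

lemma cyclic_space_subset:
  assumes "complex_subspace M" "closed M" "\<And>E. E \<in> BB \<Longrightarrow> blinfun_apply E \<xi> \<in> M"
  shows "cyclic_space \<xi> \<subseteq> M"
proof -
  have "u \<in> M" if "u \<in> simple_vectors \<xi>" for u
    using that assms unfolding complex_subspace_def by (induction rule: simple_vectors.induct) auto
  then show ?thesis unfolding cyclic_space_def using assms(2) by (intro closure_minimal) auto
qed

lemma norm_sq_sum_atoms:
  assumes "finite S" "S \<subseteq> BB"
  shows "(\<Sum>X\<in>Pow S. (norm (atom S X x))\<^sup>2) = (norm x)\<^sup>2"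
proof -
  have "(norm (\<Sum>X\<in>Pow S. atom S X x))\<^sup>2 = (\<Sum>X\<in>Pow S. (norm (atom S X x))\<^sup>2)"
    using assms by (intro pythagoras_sum) (auto intro: atom_orthogonal)
  then show ?thesis using sum_atoms[OF assms] by simp
qed

end

locale projection_sublattice = boolean_projections +
  fixes L :: "('a::complex_hilbert_space \<Rightarrow>\<^sub>L 'a) set"
  assumes L_sub: "E \<in> L \<Longrightarrow> E \<in> BB"
    and L_meet: "E \<in> L \<Longrightarrow> F \<in> L \<Longrightarrow> E o\<^sub>L F \<in> L"
    and L_join: "E \<in> L \<Longrightarrow> F \<in> L \<Longrightarrow> E + F - (E o\<^sub>L F) \<in> L"
    and L_zero: "0 \<in> L" and L_one: "id_blinfun \<in> L"
begin

lemma finite_meet: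
  assumes "finite \<X>" "\<X> \<subseteq> L"
  shows "\<exists>M\<in>L. \<forall>x. ((\<forall>E\<in>\<X>. blinfun_apply E x = x) \<longrightarrow> blinfun_apply M x = x) \<and>
    ((\<exists>E\<in>\<X>. blinfun_apply E x = 0) \<longrightarrow> M x = 0)"
  using assms
proof (induction rule: finite_induct)
  case empty
  show ?case by (intro bexI[of _ id_blinfun] L_one) auto
next
  case (insert F \<X>)
  then obtain M where M: "M \<in> L" "\<And>x. (\<forall>E\<in>\<X>. blinfun_apply E x = x) \<Longrightarrow> blinfun_apply M x = x"
    "\<And>x. (\<exists>E\<in>\<X>. blinfun_apply E x = 0) \<Longrightarrow> blinfun_apply M x = 0" by auto
  have F: "F \<in> L" using insert.prems by auto
  have "(M o\<^sub>L F) x = 0" if "F x = 0 \<or> M x = 0" for x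
    using that commute[OF L_sub[OF F] L_sub[OF M(1)], of x] by auto
  then show ?case using M F L_meet[OF M(1) F] by (intro bexI[of _ "M o\<^sub>L F"]) auto
qed

lemma finite_join:
  assumes "finite \<X>" "\<X> \<subseteq> L"
  shows "\<exists>M\<in>L. \<forall>x. ((\<exists>E\<in>\<X>. blinfun_apply E x = x) \<longrightarrow> blinfun_apply M x = x) \<and>
    ((\<forall>E\<in>\<X>. blinfun_apply E x = 0) \<longrightarrow> M x = 0)"
  using assms
proof (induction rule: finite_induct)
  case empty
  show ?case by (intro bexI[of _ 0] L_zero) auto
next
  case (insert F \<X>)
  then obtain M where M: "M \<in> L" "\<And>x. (\<exists>E\<in>\<X>. blinfun_apply E x = x) \<Longrightarrow> blinfun_apply M x = x"
    "\<And>x. (\<forall>E\<in>\<X>. blinfun_apply E x = 0) \<Longrightarrow> blinfun_apply M x = 0" by auto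
  have F: "F \<in> L" using insert.prems by auto
  let ?J = "M + F - (M o\<^sub>L F)"
  have "?J x = x" if "F x = x" for x using that by (simp add: blinfun.add_left blinfun.diff_left)
  moreover have "?J x = x" if "M x = x" for x
    using that commute[OF L_sub[OF F] L_sub[OF M(1)], of x]
    by (simp add: blinfun.add_left blinfun.diff_left)
  moreover have "?J x = 0" if "F x = 0" "M x = 0" for x
    using that by (simp add: blinfun.add_left blinfun.diff_left)
  ultimately show ?case using M F L_join[OF M(1) F] by (intro bexI[of _ ?J]) auto
qed

definition inseparable :: "'a \<Rightarrow> 'a \<Rightarrow> real \<Rightarrow> bool" where
  "inseparable \<xi> \<eta> \<delta> \<longleftrightarrow> \<delta> > 0 \<and>
    (\<forall>E\<in>L. \<delta> \<le> (norm (\<xi> - blinfun_apply E \<xi>))\<^sup>2 + (norm (blinfun_apply E \<eta>))\<^sup>2)"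

text \<open>Read the atoms as sources weighted by \<open>\<xi>\<close> and as sinks weighted by \<open>\<eta>\<close>, with an edge from \<open>X\<close> to \<open>Y\<close> when
  every element of \<open>S \<inter> L\<close> above the atom \<open>X\<close> is above the atom \<open>Y\<close>. After a greedy flow the saturated sources and
  sinks cover all edges, so finite meets and joins yield an \<open>E\<close> in \<open>L\<close> above the unsaturated sources and
  orthogonal to the unsaturated sinks. Since \<open>E\<close> does not separate \<open>\<xi>\<close> from \<open>\<eta>\<close>, the saturated capacities add up
  to at least \<open>\<delta>\<close>, and the value of the flow is at least half of that.\<close>

lemma finite_flow:
  assumes S: "finite S" "S \<subseteq> BB" and \<delta>: "inseparable \<xi> \<eta> \<delta>"
  shows "\<exists>f. (\<forall>X Y. f X Y \<ge> (0::real)) \<and> (\<forall>X Y. \<forall>E\<in>S \<inter> L. E \<in> X \<longrightarrow> E \<notin> Y \<longrightarrow> f X Y = 0) \<and>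
    (\<forall>X\<in>Pow S. (\<Sum>Y\<in>Pow S. f X Y) \<le> (norm (atom S X \<xi>))\<^sup>2) \<and>
    (\<forall>Y\<in>Pow S. (\<Sum>X\<in>Pow S. f X Y) \<le> (norm (atom S Y \<eta>))\<^sup>2) \<and>
    \<delta> / 2 \<le> (\<Sum>X\<in>Pow S. \<Sum>Y\<in>Pow S. f X Y)"
proof -
  define \<mu> where "\<mu> X = (norm (atom S X \<xi>))\<^sup>2" for X
  define \<nu> where "\<nu> Y = (norm (atom S Y \<eta>))\<^sup>2" for Y
  define R where "R = {(X, Y). X \<subseteq> S \<and> Y \<subseteq> S \<and> X \<inter> L \<subseteq> Y}"
  note at = atom_in[OF S] apply_atom[OF S]
  have "R \<subseteq> Pow S \<times> Pow S" by (auto simp: R_def)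
  moreover from this have "finite R" by (rule finite_subset) (use S in simp)
  ultimately have "\<exists>f. (\<forall>X Y. f X Y \<ge> (0::real)) \<and> (\<forall>X Y. (X, Y) \<notin> R \<longrightarrow> f X Y = 0) \<and>
    (\<forall>X\<in>Pow S. (\<Sum>Y\<in>Pow S. f X Y) \<le> \<mu> X) \<and> (\<forall>Y\<in>Pow S. (\<Sum>X\<in>Pow S. f X Y) \<le> \<nu> Y) \<and>
    (\<forall>X Y. (X, Y) \<in> R \<longrightarrow> (\<Sum>Y\<in>Pow S. f X Y) = \<mu> X \<or> (\<Sum>X\<in>Pow S. f X Y) = \<nu> Y)"
    using S by (intro greedy_flow) (auto simp: \<mu>_def \<nu>_def)
  then obtain f where f: "(\<forall>X Y. f X Y \<ge> (0::real)) \<and> (\<forall>X Y. (X, Y) \<notin> R \<longrightarrow> f X Y = 0) \<and>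
    (\<forall>X\<in>Pow S. (\<Sum>Y\<in>Pow S. f X Y) \<le> \<mu> X) \<and> (\<forall>Y\<in>Pow S. (\<Sum>X\<in>Pow S. f X Y) \<le> \<nu> Y) \<and>
    (\<forall>X Y. (X, Y) \<in> R \<longrightarrow> (\<Sum>Y\<in>Pow S. f X Y) = \<mu> X \<or> (\<Sum>X\<in>Pow S. f X Y) = \<nu> Y)" ..
  then have f0: "\<And>X Y. f X Y \<ge> 0" and fR: "\<And>X Y. (X, Y) \<notin> R \<Longrightarrow> f X Y = 0"
    and f\<mu>: "\<And>X. X \<subseteq> S \<Longrightarrow> (\<Sum>Y\<in>Pow S. f X Y) \<le> \<mu> X" and f\<nu>: "\<And>Y. Y \<subseteq> S \<Longrightarrow> (\<Sum>X\<in>Pow S. f X Y) \<le> \<nu> Y"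
    and sat: "\<And>X Y. (X, Y) \<in> R \<Longrightarrow> (\<Sum>Y\<in>Pow S. f X Y) = \<mu> X \<or> (\<Sum>X\<in>Pow S. f X Y) = \<nu> Y"
    by blast+
  define A where "A = {X \<in> Pow S. (\<Sum>Y\<in>Pow S. f X Y) = \<mu> X}"
  define C where "C = {Y \<in> Pow S. (\<Sum>X\<in>Pow S. f X Y) = \<nu> Y}"
  have AC: "finite A" "finite C" "A \<subseteq> Pow S" "C \<subseteq> Pow S" using S by (auto simp: A_def C_def)
  have "\<exists>M\<in>L. (\<forall>x. M (atom S X x) = atom S X x) \<and> (\<forall>Y\<in>Pow S - C. \<forall>x. M (atom S Y x) = 0)"
    if X: "X \<in> Pow S - A" for X
  proof -
    have "finite (X \<inter> L)" using X S finite_subset by blast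
    then obtain M where M: "M \<in> L" "\<And>x. (\<forall>E\<in>X \<inter> L. blinfun_apply E x = x) \<Longrightarrow> blinfun_apply M x = x"
      "\<And>x. (\<exists>E\<in>X \<inter> L. blinfun_apply E x = 0) \<Longrightarrow> blinfun_apply M x = 0"
      using finite_meet[of "X \<inter> L"] by auto
    have "M (atom S X x) = atom S X x" for x
    proof (rule M(2), rule ballI)
      fix E assume "E \<in> X \<inter> L"
      then show "E (atom S X x) = atom S X x" using X at(2)[of X E x] by auto
    qed
    moreover have "M (atom S Y x) = 0" if Y: "Y \<in> Pow S - C" for Y x
    proof -
      have "(X, Y) \<notin> R" using sat[of X Y] X Y by (auto simp: A_def C_def)
      then obtain E where "E \<in> X \<inter> L" "E \<notin> Y" using X Y by (auto simp: R_def)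
      then show ?thesis using X Y at(2)[of Y E x] by (intro M(3) bexI[of _ E]) auto
    qed
    ultimately show ?thesis using M(1) by blast
  qed
  then obtain M where M: "\<And>X. X \<in> Pow S - A \<Longrightarrow> M X \<in> L"
    "\<And>X x. X \<in> Pow S - A \<Longrightarrow> M X (atom S X x) = atom S X x"
    "\<And>X Y x. X \<in> Pow S - A \<Longrightarrow> Y \<in> Pow S - C \<Longrightarrow> M X (atom S Y x) = 0"
    by metis
  have "finite (M ` (Pow S - A))" "M ` (Pow S - A) \<subseteq> L" using S M(1) by auto
  then obtain E where E: "E \<in> L" and E1: "\<And>x. (\<exists>F\<in>M ` (Pow S - A). blinfun_apply F x = x) \<Longrightarrow> blinfun_apply E x = x"
    and E0: "\<And>x. (\<forall>F\<in>M ` (Pow S - A). blinfun_apply F x = 0) \<Longrightarrow> blinfun_apply E x = 0"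
    using finite_join[of "M ` (Pow S - A)"] by auto
  note EB = L_sub[OF E]
  have EA: "E (atom S X x) = atom S X x" if "X \<in> Pow S - A" for X x using M(2)[OF that] that by (intro E1) auto
  have EC: "E (atom S Y x) = 0" if "Y \<in> Pow S - C" for Y x using M(3) that by (intro E0) auto
  have "(norm (\<xi> - E \<xi>))\<^sup>2 = (\<Sum>X\<in>Pow S. (norm (atom S X (\<xi> - E \<xi>)))\<^sup>2)"
    by (simp add: norm_sq_sum_atoms[OF S])
  also have "\<dots> \<le> (\<Sum>X\<in>Pow S. if X \<in> A then \<mu> X else 0)"
  proof (rule sum_mono)
    fix X assume X: "X \<in> Pow S"
    have *: "atom S X (\<xi> - E \<xi>) = (id_blinfun - E) (atom S X \<xi>)"
      using commute[OF EB at(1)] X by (simp add: blinfun.diff_left blinfun.diff_right)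
    have "norm ((id_blinfun - E) (atom S X \<xi>)) \<le> norm (atom S X \<xi>)"
      by (rule norm_projection_le[OF proj[OF compl[OF EB]]])
    then show "(norm (atom S X (\<xi> - E \<xi>)))\<^sup>2 \<le> (if X \<in> A then \<mu> X else 0)"
      using EA X unfolding * by (auto simp: \<mu>_def blinfun.diff_left intro: power_mono)
  qed
  also have "\<dots> = (\<Sum>X\<in>A. \<mu> X)" using AC S by (simp add: Int_absorb1 flip: sum.inter_restrict)
  also have "\<dots> = (\<Sum>X\<in>A. \<Sum>Y\<in>Pow S. f X Y)" by (intro sum.cong) (auto simp: A_def)
  also have "\<dots> \<le> (\<Sum>X\<in>Pow S. \<Sum>Y\<in>Pow S. f X Y)"
    using AC S f0 by (intro sum_mono2 sum_nonneg) auto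
  finally have 1: "(norm (\<xi> - E \<xi>))\<^sup>2 \<le> (\<Sum>X\<in>Pow S. \<Sum>Y\<in>Pow S. f X Y)" .
  have "(norm (E \<eta>))\<^sup>2 = (\<Sum>Y\<in>Pow S. (norm (atom S Y (E \<eta>)))\<^sup>2)"
    by (simp add: norm_sq_sum_atoms[OF S])
  also have "\<dots> \<le> (\<Sum>Y\<in>Pow S. if Y \<in> C then \<nu> Y else 0)"
  proof (rule sum_mono)
    fix Y assume Y: "Y \<in> Pow S"
    have *: "atom S Y (E \<eta>) = E (atom S Y \<eta>)" using commute[OF EB at(1)] Y by simp
    have "norm (E (atom S Y \<eta>)) \<le> norm (atom S Y \<eta>)"
      by (rule norm_projection_le[OF proj[OF EB]])
    then show "(norm (atom S Y (E \<eta>)))\<^sup>2 \<le> (if Y \<in> C then \<nu> Y else 0)"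
      using EC Y unfolding * by (auto simp: \<nu>_def intro: power_mono)
  qed
  also have "\<dots> = (\<Sum>Y\<in>C. \<nu> Y)" using AC S by (simp add: Int_absorb1 flip: sum.inter_restrict)
  also have "\<dots> = (\<Sum>Y\<in>C. \<Sum>X\<in>Pow S. f X Y)" by (intro sum.cong) (auto simp: C_def)
  also have "\<dots> \<le> (\<Sum>Y\<in>Pow S. \<Sum>X\<in>Pow S. f X Y)"
    using AC S f0 by (intro sum_mono2 sum_nonneg) auto
  also have "\<dots> = (\<Sum>X\<in>Pow S. \<Sum>Y\<in>Pow S. f X Y)" by (rule sum.swap)
  finally have 2: "(norm (E \<eta>))\<^sup>2 \<le> (\<Sum>X\<in>Pow S. \<Sum>Y\<in>Pow S. f X Y)" .
  have "\<delta> \<le> (norm (\<xi> - E \<xi>))\<^sup>2 + (norm (E \<eta>))\<^sup>2" using \<delta> E unfolding inseparable_def by blast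
  then have "\<delta> / 2 \<le> (\<Sum>X\<in>Pow S. \<Sum>Y\<in>Pow S. f X Y)" using 1 2 by linarith
  moreover have "\<forall>X Y. \<forall>E\<in>S \<inter> L. E \<in> X \<longrightarrow> E \<notin> Y \<longrightarrow> f X Y = 0"
    using fR by (auto simp: R_def)
  ultimately show ?thesis using f0 f\<mu> f\<nu> unfolding \<mu>_def \<nu>_def by (intro exI[of _ f]) auto
qed

definition sesquilinear_contraction :: "('a \<times> 'a \<Rightarrow> complex) \<Rightarrow> bool" where
  "sesquilinear_contraction b \<longleftrightarrow>
    (\<forall>x x' y. b (x + x', y) = b (x, y) + b (x', y)) \<and> (\<forall>c x y. b (c *\<^sub>C x, y) = c * b (x, y)) \<and>
    (\<forall>x y y'. b (x, y + y') = b (x, y) + b (x, y')) \<and> (\<forall>c x y. b (x, c *\<^sub>C y) = cnj c * b (x, y)) \<and>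
    (\<forall>x y. cmod (b (x, y)) \<le> norm x * norm y)"

text \<open>The numbers \<open>b (E \<xi>, F \<eta>)\<close> are the values on rectangles of a positive measure whose marginals are dominated by
  the spectral measures of \<open>\<xi>\<close> and \<open>\<eta>\<close> and which charges no rectangle \<open>E \<times> E\<^sup>\<bottom>\<close> with \<open>E\<close> in \<open>L\<close>. In the separable
  theory the operators of such measures are the pseudo-integral operators supported on the order of \<open>L\<close>.\<close>

definition positive_on :: "('a \<Rightarrow>\<^sub>L 'a) set \<Rightarrow> 'a \<Rightarrow> 'a \<Rightarrow> ('a \<times> 'a \<Rightarrow> complex) \<Rightarrow> bool" where
  "positive_on S \<xi> \<eta> b \<longleftrightarrow>
    (\<forall>E\<in>S. \<forall>F\<in>S. Im (b (blinfun_apply E \<xi>, blinfun_apply F \<eta>)) = 0 \<and> 0 \<le> Re (b (E \<xi>, F \<eta>))) \<and>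
    (\<forall>E\<in>S. Re (b (blinfun_apply E \<xi>, \<eta>)) \<le> (norm (E \<xi>))\<^sup>2) \<and>
    (\<forall>F\<in>S. Re (b (\<xi>, blinfun_apply F \<eta>)) \<le> (norm (F \<eta>))\<^sup>2) \<and>
    (\<forall>E\<in>S \<inter> L. b (blinfun_apply E \<xi>, \<eta> - E \<eta>) = 0)"

text \<open>The flow \<open>f\<close> gives the form with value \<open>f X Y\<close> at the components of \<open>\<xi>\<close> and \<open>\<eta>\<close> in the atoms \<open>X\<close> and \<open>Y\<close>.
  Its marginal bounds make it a contraction by the Cauchy-Schwarz inequality, as in the Schur test.\<close>

lemma positive_form_finite:
  assumes S: "finite S" "S \<subseteq> BB" and \<delta>: "inseparable \<xi> \<eta> \<delta>"
  shows "\<exists>b. sesquilinear_contraction b \<and> positive_on S \<xi> \<eta> b \<and> \<delta> / 2 \<le> Re (b (\<xi>, \<eta>))"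
proof -
  obtain f where f: "(\<forall>X Y. f X Y \<ge> (0::real)) \<and> (\<forall>X Y. \<forall>E\<in>S \<inter> L. E \<in> X \<longrightarrow> E \<notin> Y \<longrightarrow> f X Y = 0) \<and>
    (\<forall>X\<in>Pow S. (\<Sum>Y\<in>Pow S. f X Y) \<le> (norm (atom S X \<xi>))\<^sup>2) \<and>
    (\<forall>Y\<in>Pow S. (\<Sum>X\<in>Pow S. f X Y) \<le> (norm (atom S Y \<eta>))\<^sup>2) \<and>
    \<delta> / 2 \<le> (\<Sum>X\<in>Pow S. \<Sum>Y\<in>Pow S. f X Y)"
    using finite_flow[OF S \<delta>] ..
  then have f0: "\<And>X Y. f X Y \<ge> 0"
    and fL: "\<And>X Y E. E \<in> S \<Longrightarrow> E \<in> L \<Longrightarrow> E \<in> X \<Longrightarrow> E \<notin> Y \<Longrightarrow> f X Y = 0"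
    and f\<mu>': "\<And>X. X \<subseteq> S \<Longrightarrow> (\<Sum>Y\<in>Pow S. f X Y) \<le> (norm (atom S X \<xi>))\<^sup>2"
    and f\<nu>': "\<And>Y. Y \<subseteq> S \<Longrightarrow> (\<Sum>X\<in>Pow S. f X Y) \<le> (norm (atom S Y \<eta>))\<^sup>2"
    and f\<delta>: "\<delta> / 2 \<le> (\<Sum>X\<in>Pow S. \<Sum>Y\<in>Pow S. f X Y)"
    by blast+
  define \<mu> where "\<mu> X = (norm (atom S X \<xi>))\<^sup>2" for X
  define \<nu> where "\<nu> Y = (norm (atom S Y \<eta>))\<^sup>2" for Y
  note f\<mu> = f\<mu>'[folded \<mu>_def] note f\<nu> = f\<nu>'[folded \<nu>_def]
  note at = atom_in[OF S] apply_atom[OF S]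
  have PS: "finite (Pow S)" using S by simp
  \<comment> \<open>The flow vanishes at atoms of weight zero, where the normalised coefficient below is a division by zero.\<close>
  have zero\<mu>: "f X Y = 0" if "X \<subseteq> S" "Y \<subseteq> S" "\<mu> X = 0" for X Y
    using f\<mu>[OF that(1)] that(2,3) member_le_sum[of Y "Pow S" "f X"] f0 PS
    by (metis Pow_iff antisym order_trans)
  have zero\<nu>: "f X Y = 0" if "X \<subseteq> S" "Y \<subseteq> S" "\<nu> Y = 0" for X Y
    using f\<nu>[OF that(2)] that(1,3) member_le_sum[of X "Pow S" "\<lambda>X. f X Y"] f0 PS
    by (metis Pow_iff antisym order_trans)
  define b where "b = (\<lambda>(x, y). \<Sum>X\<in>Pow S. \<Sum>Y\<in>Pow S.
    complex_of_real (f X Y / (\<mu> X * \<nu> Y)) * cinner x (atom S X \<xi>) * cinner (atom S Y \<eta>) y)"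
  have b_values: "b (v, w) = complex_of_real (\<Sum>X\<in>Pow S. \<Sum>Y\<in>Pow S. f X Y * p X * q Y)"
    if p: "\<And>X. X \<subseteq> S \<Longrightarrow> cinner v (atom S X \<xi>) = complex_of_real (p X * \<mu> X)"
      and q: "\<And>Y. Y \<subseteq> S \<Longrightarrow> cinner (atom S Y \<eta>) w = complex_of_real (q Y * \<nu> Y)" for v w p q
    unfolding b_def prod.case of_real_sum
  proof (intro sum.cong refl)
    fix X Y assume XY: "X \<in> Pow S" "Y \<in> Pow S"
    then have "f X Y / (\<mu> X * \<nu> Y) * (p X * \<mu> X) * (q Y * \<nu> Y) = f X Y * p X * q Y"
      using zero\<mu>[of X Y] zero\<nu>[of X Y] by (cases "\<mu> X = 0 \<or> \<nu> Y = 0") auto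
    then show "complex_of_real (f X Y / (\<mu> X * \<nu> Y)) * cinner v (atom S X \<xi>) * cinner (atom S Y \<eta>) w
        = complex_of_real (f X Y * p X * q Y)"
      using p q XY by (metis Pow_iff of_real_mult)
  qed
  have v1: "cinner \<xi> (atom S X \<xi>) = complex_of_real (1 * \<mu> X)" if "X \<subseteq> S" for X
    using norm_projection_sq_cinner[OF proj[OF at(1)[OF that]], of \<xi>] cinner_move[OF at(1)[OF that]]
    by (simp add: \<mu>_def)
  have vE: "cinner (blinfun_apply E \<xi>) (atom S X \<xi>) = complex_of_real (of_bool (E \<in> X) * \<mu> X)" if "X \<subseteq> S" "E \<in> S" for X E
    using cinner_move[of E] at(2)[OF that] v1[OF that(1)] that(2) S by (cases "E \<in> X") auto
  have w1: "cinner (atom S Y \<eta>) \<eta> = complex_of_real (1 * \<nu> Y)" if "Y \<subseteq> S" for Y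
    using norm_projection_sq_cinner[OF proj[OF at(1)[OF that]], of \<eta>] by (simp add: \<nu>_def)
  have wE: "cinner (atom S Y \<eta>) (blinfun_apply E \<eta>) = complex_of_real (of_bool (E \<in> Y) * \<nu> Y)" if "Y \<subseteq> S" "E \<in> S" for Y E
    using cinner_move[of E "atom S Y \<eta>"] at(2)[OF that] w1[OF that(1)] that(2) S by (cases "E \<in> Y") auto
  have wE': "cinner (atom S Y \<eta>) (\<eta> - blinfun_apply E \<eta>) = complex_of_real (of_bool (E \<notin> Y) * \<nu> Y)" if "Y \<subseteq> S" "E \<in> S" for Y E
    using w1[OF that(1)] wE[OF that] by (simp add: cinner_diff_right)
  have sumE: "(norm (blinfun_apply E x))\<^sup>2 = (\<Sum>X\<in>Pow S. of_bool (E \<in> X) * (norm (atom S X x))\<^sup>2)" if "E \<in> S" for E x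
  proof -
    have EB: "E \<in> BB" using that S by blast
    have "(norm (E x))\<^sup>2 = (\<Sum>X\<in>Pow S. (norm (atom S X (E x)))\<^sup>2)" by (simp add: norm_sq_sum_atoms[OF S])
    also have "\<dots> = (\<Sum>X\<in>Pow S. of_bool (E \<in> X) * (norm (atom S X x))\<^sup>2)"
    proof (intro sum.cong refl)
      fix X assume "X \<in> Pow S"
      then have "atom S X (E x) = (if E \<in> X then atom S X x else 0)"
        using commute[OF EB at(1), of X x] at(2)[OF _ that, of X x] by simp
      then show "(norm (atom S X (E x)))\<^sup>2 = of_bool (E \<in> X) * (norm (atom S X x))\<^sup>2" by simp
    qed
    finally show ?thesis .
  qed
  have "cmod (b (x, y)) \<le> norm x * norm y" for x y
  proof -
    define u where "u X = norm (atom S X x) / sqrt (\<mu> X)" for X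
    define v where "v Y = norm (atom S Y y) / sqrt (\<nu> Y)" for Y
    have \<mu>0: "\<mu> X \<ge> 0" "\<nu> X \<ge> 0" for X by (auto simp: \<mu>_def \<nu>_def)
    have u: "(\<Sum>(X, Y)\<in>Pow S \<times> Pow S. (sqrt (f X Y) * u X)\<^sup>2) \<le> (norm x)\<^sup>2"
    proof -
      have "(\<Sum>(X, Y)\<in>Pow S \<times> Pow S. (sqrt (f X Y) * u X)\<^sup>2) = (\<Sum>X\<in>Pow S. (\<Sum>Y\<in>Pow S. f X Y) * (u X)\<^sup>2)"
        by (simp add: sum.cartesian_product[symmetric] power_mult_distrib f0 sum_distrib_right)
      also have "\<dots> \<le> (\<Sum>X\<in>Pow S. \<mu> X * (u X)\<^sup>2)"
        using f\<mu> by (intro sum_mono mult_right_mono) auto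
      also have "\<dots> \<le> (\<Sum>X\<in>Pow S. (norm (atom S X x))\<^sup>2)"
        using \<mu>0 by (intro sum_mono) (simp add: u_def power_divide)
      finally show ?thesis by (simp add: norm_sq_sum_atoms[OF S])
    qed
    have v: "(\<Sum>(X, Y)\<in>Pow S \<times> Pow S. (sqrt (f X Y) * v Y)\<^sup>2) \<le> (norm y)\<^sup>2"
    proof -
      have "(\<Sum>(X, Y)\<in>Pow S \<times> Pow S. (sqrt (f X Y) * v Y)\<^sup>2) = (\<Sum>X\<in>Pow S. \<Sum>Y\<in>Pow S. f X Y * (v Y)\<^sup>2)"
        by (simp add: sum.cartesian_product[symmetric] power_mult_distrib f0)
      also have "\<dots> = (\<Sum>Y\<in>Pow S. (\<Sum>X\<in>Pow S. f X Y) * (v Y)\<^sup>2)"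
        by (subst sum.swap) (simp add: sum_distrib_right)
      also have "\<dots> \<le> (\<Sum>Y\<in>Pow S. \<nu> Y * (v Y)\<^sup>2)"
        using f\<nu> by (intro sum_mono mult_right_mono) auto
      also have "\<dots> \<le> (\<Sum>Y\<in>Pow S. (norm (atom S Y y))\<^sup>2)"
        using \<mu>0 by (intro sum_mono) (simp add: v_def power_divide)
      finally show ?thesis by (simp add: norm_sq_sum_atoms[OF S])
    qed
    have "cmod (b (x, y)) \<le> (\<Sum>(X, Y)\<in>Pow S \<times> Pow S. \<bar>sqrt (f X Y) * u X\<bar> * \<bar>sqrt (f X Y) * v Y\<bar>)"
      unfolding b_def prod.case sum.cartesian_product[symmetric]
    proof (intro sum_norm_le)
      fix X Y assume "X \<in> Pow S" "Y \<in> Pow S"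
      then have XY: "X \<subseteq> S" "Y \<subseteq> S" by auto
      have "cmod (cinner x (atom S X \<xi>)) \<le> norm (atom S X x) * sqrt (\<mu> X)"
        using Cauchy_Schwarz[of "atom S X x" "atom S X \<xi>"] cinner_move[OF at(1)[OF XY(1)], of x "atom S X \<xi>"] at(1)[OF XY(1)]
        by (simp add: \<mu>_def)
      moreover have "cmod (cinner (atom S Y \<eta>) y) \<le> norm (atom S Y y) * sqrt (\<nu> Y)"
        using Cauchy_Schwarz[of "atom S Y \<eta>" "atom S Y y"] cinner_move[OF at(1)[OF XY(2)], of "atom S Y \<eta>" y] at(1)[OF XY(2)]
        by (simp add: \<nu>_def mult.commute)
      ultimately have "f X Y / (\<mu> X * \<nu> Y) * (cmod (cinner x (atom S X \<xi>)) * cmod (cinner (atom S Y \<eta>) y))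
          \<le> f X Y / (\<mu> X * \<nu> Y) * ((norm (atom S X x) * sqrt (\<mu> X)) * (norm (atom S Y y) * sqrt (\<nu> Y)))"
        using f0 \<mu>0 by (intro mult_left_mono mult_mono) auto
      also have "\<dots> = f X Y * ((norm (atom S X x) * (sqrt (\<mu> X) / \<mu> X)) * (norm (atom S Y y) * (sqrt (\<nu> Y) / \<nu> Y)))"
        by simp
      also have "\<dots> = \<bar>sqrt (f X Y) * u X\<bar> * \<bar>sqrt (f X Y) * v Y\<bar>"
        using f0[of X Y] \<mu>0 by (simp add: u_def v_def abs_mult sqrt_divide_self_eq inverse_eq_divide)
      finally show "cmod (complex_of_real (f X Y / (\<mu> X * \<nu> Y)) * cinner x (atom S X \<xi>) * cinner (atom S Y \<eta>) y)
          \<le> \<bar>sqrt (f X Y) * u X\<bar> * \<bar>sqrt (f X Y) * v Y\<bar>"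
        using f0[of X Y] \<mu>0 by (simp add: norm_mult norm_divide mult.assoc)
    qed
    also have "\<dots> = (\<Sum>z\<in>Pow S \<times> Pow S. \<bar>sqrt (f (fst z) (snd z)) * u (fst z)\<bar> * \<bar>sqrt (f (fst z) (snd z)) * v (snd z)\<bar>)"
      by (simp add: case_prod_beta)
    also have "\<dots> \<le> L2_set (\<lambda>z. sqrt (f (fst z) (snd z)) * u (fst z)) (Pow S \<times> Pow S)
        * L2_set (\<lambda>z. sqrt (f (fst z) (snd z)) * v (snd z)) (Pow S \<times> Pow S)"
      by (rule L2_set_mult_ineq)
    also have "\<dots> \<le> norm x * norm y"
      using u v unfolding L2_set_def
      by (intro mult_mono real_le_lsqrt) (auto simp: case_prod_beta intro: sum_nonneg real_sqrt_ge_zero)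
    finally show ?thesis .
  qed
  then have "sesquilinear_contraction b"
    unfolding sesquilinear_contraction_def b_def
    by (auto simp: cinner_add_left cinner_add_right cinner_scaleC_left cinner_scaleC_right
        sum.distrib sum_distrib_left algebra_simps add_divide_distrib intro!: sum.cong)
  moreover have "positive_on S \<xi> \<eta> b"
    unfolding positive_on_def
  proof (intro conjI ballI)
    fix E F assume EF: "E \<in> S" "F \<in> S"
    show "Im (b (blinfun_apply E \<xi>, blinfun_apply F \<eta>)) = 0" "0 \<le> Re (b (blinfun_apply E \<xi>, blinfun_apply F \<eta>))"
      using b_values[OF vE[OF _ EF(1)] wE[OF _ EF(2)]] f0 by (auto intro!: sum_nonneg)
  next
    fix E assume E: "E \<in> S"
    have "Re (b (blinfun_apply E \<xi>, \<eta>)) = (\<Sum>X\<in>Pow S. of_bool (E \<in> X) * (\<Sum>Y\<in>Pow S. f X Y))"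
      using b_values[OF vE[OF _ E] w1] by (auto simp: sum_distrib_left mult.commute)
    also have "\<dots> \<le> (\<Sum>X\<in>Pow S. of_bool (E \<in> X) * \<mu> X)"
      using f\<mu> by (intro sum_mono mult_left_mono) auto
    finally show "Re (b (blinfun_apply E \<xi>, \<eta>)) \<le> (norm (blinfun_apply E \<xi>))\<^sup>2"
      by (simp add: sumE[OF E] \<mu>_def)
    have "Re (b (\<xi>, blinfun_apply E \<eta>)) = (\<Sum>X\<in>Pow S. \<Sum>Y\<in>Pow S. f X Y * of_bool (E \<in> Y))"
      using b_values[OF v1 wE[OF _ E]] by simp
    also have "\<dots> = (\<Sum>Y\<in>Pow S. of_bool (E \<in> Y) * (\<Sum>X\<in>Pow S. f X Y))"
      by (subst sum.swap) (simp add: sum_distrib_left mult.commute)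
    also have "\<dots> \<le> (\<Sum>Y\<in>Pow S. of_bool (E \<in> Y) * \<nu> Y)"
      using f\<nu> by (intro sum_mono mult_left_mono) auto
    finally show "Re (b (\<xi>, blinfun_apply E \<eta>)) \<le> (norm (blinfun_apply E \<eta>))\<^sup>2"
      by (simp add: sumE[OF E] \<nu>_def)
  next
    fix E assume E: "E \<in> S \<inter> L"
    then have ES: "E \<in> S" by blast
    have "(\<Sum>X\<in>Pow S. \<Sum>Y\<in>Pow S. f X Y * of_bool (E \<in> X) * of_bool (E \<notin> Y)) = 0"
      using fL E by (intro sum.neutral ballI) auto
    then show "b (blinfun_apply E \<xi>, \<eta> - blinfun_apply E \<eta>) = 0"
      using b_values[OF vE[OF _ ES] wE'[OF _ ES]] by (simp only: of_real_0)
  qed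
  moreover have "\<delta> / 2 \<le> Re (b (\<xi>, \<eta>))"
    using b_values[OF v1 w1] f\<delta> by simp
  ultimately show ?thesis by blast
qed

lemma compact_bounded_forms:
  "compact {b :: 'b \<Rightarrow> complex. \<forall>z. cmod (b z) \<le> r z}"
proof -
  have "{b. \<forall>z. cmod (b z) \<le> r z} = PiE UNIV (\<lambda>z. cball 0 (r z))" by auto
  moreover have "compactin (product_topology (\<lambda>z. euclidean) UNIV) (PiE UNIV (\<lambda>z. cball (0::complex) (r z)))"
    by (subst compactin_PiE) auto
  ultimately show ?thesis by (simp add: euclidean_product_topology)
qed

lemma closed_forms:
  "closed {b. sesquilinear_contraction b \<and> positive_on S \<xi> \<eta> b \<and> \<delta> \<le> Re (b (\<xi>, \<eta>))}"
proof -
  note ci = continuous_intros continuous_on_product_coordinates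
  have "closed {b. sesquilinear_contraction b}"
    unfolding sesquilinear_contraction_def
    by (intro closed_Collect_conj closed_Collect_all closed_Collect_eq closed_Collect_le ci)
  moreover have "closed {b :: 'a \<times> 'a \<Rightarrow> complex. \<delta> \<le> Re (b (\<xi>, \<eta>))}"
    by (intro closed_Collect_le ci)
  moreover have "closed {b. positive_on S \<xi> \<eta> b}"
  proof -
    have eq: "{b. positive_on S \<xi> \<eta> b} =
      (\<Inter>E\<in>S. \<Inter>F\<in>S. {b. Im (b (blinfun_apply E \<xi>, blinfun_apply F \<eta>)) = 0 \<and> 0 \<le> Re (b (blinfun_apply E \<xi>, blinfun_apply F \<eta>))}) \<inter>
      (\<Inter>E\<in>S. {b. Re (b (blinfun_apply E \<xi>, \<eta>)) \<le> (norm (blinfun_apply E \<xi>))\<^sup>2}) \<inter>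
      (\<Inter>F\<in>S. {b. Re (b (\<xi>, blinfun_apply F \<eta>)) \<le> (norm (blinfun_apply F \<eta>))\<^sup>2}) \<inter>
      (\<Inter>E\<in>S \<inter> L. {b. b (blinfun_apply E \<xi>, \<eta> - blinfun_apply E \<eta>) = 0})"
      unfolding positive_on_def by blast
    show ?thesis unfolding eq
      by (intro closed_Int closed_INT ballI closed_Collect_conj closed_Collect_eq closed_Collect_le ci)
  qed
  ultimately show ?thesis by (intro closed_Collect_conj)
qed

text \<open>The forms of the finite subalgebras lie in a product of discs; a cluster point of them is
  positive on the whole Boolean algebra.\<close>

lemma positive_operator_exists:
  assumes \<delta>: "inseparable \<xi> \<eta> \<delta>"
  obtains T where "T \<in> bounded_ops" "positive_on BB \<xi> \<eta> (\<lambda>(x, y). cinner (blinfun_apply T x) y)"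
    "\<delta> / 2 \<le> Re (cinner (blinfun_apply T \<xi>) \<eta>)"
proof -
  define K where "K = {b :: 'a \<times> 'a \<Rightarrow> complex. \<forall>z. cmod (b z) \<le> norm (fst z) * norm (snd z)}"
  define C where "C S = {b. sesquilinear_contraction b \<and> positive_on S \<xi> \<eta> b \<and> \<delta>/2 \<le> Re (b (\<xi>, \<eta>))}" for S
  have "K \<inter> (\<Inter>S\<in>{S. finite S \<and> S \<subseteq> BB}. C S) \<noteq> {}"
  proof (rule compact_imp_fip_image)
    show "compact K" unfolding K_def by (rule compact_bounded_forms)
    show "closed (C S)" for S unfolding C_def by (rule closed_forms)
    fix I' assume I': "finite I'" "I' \<subseteq> {S. finite S \<and> S \<subseteq> BB}"
    then have "finite (\<Union>I')" "\<Union>I' \<subseteq> BB" by auto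
    then obtain b where b: "sesquilinear_contraction b" "positive_on (\<Union>I') \<xi> \<eta> b" "\<delta> / 2 \<le> Re (b (\<xi>, \<eta>))"
      using positive_form_finite[OF _ _ \<delta>] by blast
    have "positive_on S \<xi> \<eta> b" if "S \<in> I'" for S
      using b(2) that unfolding positive_on_def by blast
    then have "b \<in> (\<Inter>S\<in>I'. C S)" using b by (auto simp: C_def)
    moreover have "b \<in> K" using b(1) by (auto simp: K_def sesquilinear_contraction_def)
    ultimately show "K \<inter> (\<Inter>S\<in>I'. C S) \<noteq> {}" by blast
  qed
  then obtain b where b: "\<And>S. finite S \<Longrightarrow> S \<subseteq> BB \<Longrightarrow> b \<in> C S" by auto
  have sq: "sesquilinear_contraction b" and \<delta>': "\<delta> / 2 \<le> Re (b (\<xi>, \<eta>))"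
    using b[of "{}"] by (auto simp: C_def)
  obtain T where T: "T \<in> bounded_ops" "\<And>x y. cinner (blinfun_apply T x) y = b (x, y)"
  proof (rule sesquilinear_form_operator[of "\<lambda>x y. b (x, y)" 1])
  qed (use sq in \<open>auto simp: sesquilinear_contraction_def\<close>)
  have "positive_on BB \<xi> \<eta> b"
    unfolding positive_on_def
  proof (intro conjI ballI)
    fix E F assume EF: "E \<in> BB" "F \<in> BB"
    have "positive_on {E, F} \<xi> \<eta> b" using b[of "{E, F}"] EF by (auto simp: C_def)
    then show "Im (b (blinfun_apply E \<xi>, blinfun_apply F \<eta>)) = 0" "0 \<le> Re (b (blinfun_apply E \<xi>, blinfun_apply F \<eta>))"
      "Re (b (blinfun_apply E \<xi>, \<eta>)) \<le> (norm (blinfun_apply E \<xi>))\<^sup>2"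
      "Re (b (\<xi>, blinfun_apply F \<eta>)) \<le> (norm (blinfun_apply F \<eta>))\<^sup>2"
      unfolding positive_on_def by simp_all
  next
    fix E assume E: "E \<in> BB \<inter> L"
    have "positive_on {E} \<xi> \<eta> b" using b[of "{E}"] E by (auto simp: C_def)
    then show "b (blinfun_apply E \<xi>, \<eta> - blinfun_apply E \<eta>) = 0"
      using E unfolding positive_on_def by blast
  qed
  then have "positive_on BB \<xi> \<eta> (\<lambda>(x, y). cinner (T x) y)" unfolding T(2) by simp
  moreover have "\<delta> / 2 \<le> Re (cinner (T \<xi>) \<eta>)" unfolding T(2) by (rule \<delta>')
  ultimately show thesis by (rule that[OF T(1)])
qed

text \<open>Positivity forces every entry of the vanishing corner \<open>\<langle>T E \<xi>, E\<^sup>\<bottom> \<eta>\<rangle>\<close> to vanish, so the compression of \<open>T\<close>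
  to the cyclic spaces leaves the range of \<open>E\<close> invariant.\<close>

lemma compression_leaves_lattice_invariant:
  assumes T: "T \<in> bounded_ops" "positive_on BB \<xi> \<eta> (\<lambda>(x, y). cinner (blinfun_apply T x) y)"
    and p: "p \<in> projections" "\<And>E x. E \<in> BB \<Longrightarrow> blinfun_apply p (blinfun_apply E x) = E (p x)"
      "\<And>x. blinfun_apply p x \<in> cyclic_space \<xi>"
    and q: "q \<in> projections" "\<And>E x. E \<in> BB \<Longrightarrow> blinfun_apply q (blinfun_apply E x) = E (q x)"
      "\<And>x. blinfun_apply q x \<in> cyclic_space \<eta>"
    and E: "E \<in> L"
  shows "blinfun_apply E (q (T (p (E x)))) = q (T (p (E x)))"
proof -
  note EB = L_sub[OF E]
  have pos: "Im (cinner (T (F \<xi>)) (G \<eta>)) = 0" "0 \<le> Re (cinner (T (F \<xi>)) (G \<eta>))" if "F \<in> BB" "G \<in> BB" for F G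
    using T(2) that unfolding positive_on_def by auto
  have zero: "cinner (T (E \<xi>)) (\<eta> - E \<eta>) = 0" using T(2) E EB unfolding positive_on_def by auto
  have base: "cinner (T (E (F \<xi>))) (G \<eta> - E (G \<eta>)) = 0" if F: "F \<in> BB" and G: "G \<in> BB" for F G
  proof -
    let ?b = "\<lambda>F G. cinner (T ((E o\<^sub>L F) \<xi>)) (((id_blinfun - E) o\<^sub>L G) \<eta>)"
    have F': "id_blinfun - F \<in> BB" and G': "id_blinfun - G \<in> BB" using F G by (auto intro: compl)
    have "?b F G + ?b (id_blinfun - F) G + (?b F (id_blinfun - G) + ?b (id_blinfun - F) (id_blinfun - G)) = 0"
      using zero by (simp add: blinfun.diff_left blinfun.diff_right cinner_diff_left cinner_diff_right)
    then have "Re (?b F G) + Re (?b (id_blinfun - F) G) +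
        (Re (?b F (id_blinfun - G)) + Re (?b (id_blinfun - F) (id_blinfun - G))) = 0"
      by (metis plus_complex.sel(1) zero_complex.sel(1))
    moreover have nn: "0 \<le> Re (?b F G)" "Im (?b F G) = 0" if "F \<in> BB" "G \<in> BB" for F G
      by (rule pos[OF inter[OF EB that(1)] inter[OF compl[OF EB] that(2)]])+
    ultimately have "Re (?b F G) = 0"
      using nn(1)[OF F G] nn(1)[OF F' G] nn(1)[OF F G'] nn(1)[OF F' G'] by linarith
    then have "?b F G = 0" using nn(2)[OF F G] by (simp add: complex_eq_iff)
    then show ?thesis by (simp add: blinfun.diff_left)
  qed
  have left: "cinner (T (E u)) (G \<eta> - E (G \<eta>)) = 0" if "u \<in> cyclic_space \<xi>" "G \<in> BB" for u G
  proof -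
    let ?M = "{u. cinner (T (E u)) (G \<eta> - E (G \<eta>)) = 0}"
    have "cyclic_space \<xi> \<subseteq> ?M"
    proof (rule cyclic_space_subset)
      show "complex_subspace ?M" unfolding complex_subspace_def
        by (auto simp: blinfun.add_right cinner_add_left apply_scaleC[OF EB] bounded_opsD[OF T(1)] cinner_scaleC_left)
      show "closed ?M"
        by (intro closed_Collect_eq continuous_on_cinner_left continuous_intros
            linear_continuous_on blinfun.bounded_linear_right)
    qed (use base that in auto)
    then show ?thesis using that by blast
  qed
  have both: "cinner (T (E u)) (v - E v) = 0" if "u \<in> cyclic_space \<xi>" "v \<in> cyclic_space \<eta>" for u v
  proof -
    let ?M = "{v. cinner (T (E u)) (v - E v) = 0}"
    have "cyclic_space \<eta> \<subseteq> ?M"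
    proof (rule cyclic_space_subset)
      show "complex_subspace ?M" unfolding complex_subspace_def
      proof (intro conjI ballI allI)
        show "c *\<^sub>C v \<in> ?M" if "v \<in> ?M" for c v
          using that apply_scaleC[OF EB] by (simp add: cinner_scaleC_right flip: scaleC_diff_right)
        show "v + w \<in> ?M" if "v \<in> ?M" "w \<in> ?M" for v w
          using that by (simp add: blinfun.add_right cinner_diff_right cinner_add_right)
      qed simp
      show "closed ?M"
        by (intro closed_Collect_eq continuous_on_cinner_right continuous_intros
            linear_continuous_on blinfun.bounded_linear_right)
    qed (use left that in auto)
    then show ?thesis using that by blast
  qed
  show ?thesis
  proof (rule cinner_ext)
    fix z
    have "cinner (q (T (p (E x)))) (z - E z) = cinner (T (E (p x))) (q z - E (q z))"
      using p(2)[OF EB] q(2)[OF EB] by (simp add: projectionsD[OF q(1)] blinfun.diff_right)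
    also have "\<dots> = 0" by (rule both[OF p(3) q(3)])
    finally show "cinner (E (q (T (p (E x))))) z = cinner (q (T (p (E x)))) z"
      using cinner_move[OF EB] by (simp add: cinner_diff_right)
  qed
qed

end

section \<open>Functionals annihilating an algebra\<close>

lemma operator_algebra_sum:
  assumes "operator_algebra A" "\<And>i. i \<in> I \<Longrightarrow> T i \<in> A" shows "(\<Sum>i\<in>I. T i) \<in> A"
  using assms(2) by (induction I rule: infinite_finite_induct) (use assms(1) in \<open>auto simp: operator_algebra_def\<close>)

lemma operator_algebra_compose: "operator_algebra A \<Longrightarrow> S \<in> A \<Longrightarrow> T \<in> A \<Longrightarrow> S o\<^sub>L T \<in> A"
  unfolding operator_algebra_def by blast

lemma operator_algebra_bounded: "operator_algebra A \<Longrightarrow> S \<in> A \<Longrightarrow> S \<in> bounded_ops"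
  unfolding operator_algebra_def by blast

text \<open>The projection onto the closed subspace generated by \<open>A E H\<close> is invariant under \<open>A\<close>.\<close>

lemma invariant_projection_separates:
  fixes A :: "('a::complex_hilbert_space \<Rightarrow>\<^sub>L 'a) set"
  assumes A: "operator_algebra A" "id_blinfun \<in> A" and EF: "E \<in> bounded_ops" "F \<in> bounded_ops"
    and zero: "\<And>S z. S \<in> A \<Longrightarrow> blinfun_apply F (blinfun_apply S (blinfun_apply E z)) = 0"
  obtains Q where "Q \<in> lat A" "\<And>z. blinfun_apply Q (blinfun_apply E z) = E z" "\<And>z. blinfun_apply F (blinfun_apply Q z) = 0"
proof -
  define \<N> where "\<N> = {N. complex_subspace N \<and> closed N \<and> (\<forall>S\<in>A. \<forall>z. blinfun_apply S (blinfun_apply E z) \<in> N)}"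
  define K where "K = \<Inter>\<N>"
  have K: "complex_subspace K" "closed K"
    unfolding K_def \<N>_def complex_subspace_def by auto
  have sub: "complex_subspace {u. blinfun_apply S u \<in> N}" "closed {u. blinfun_apply S u \<in> N}"
    if "complex_subspace N" "closed N" "S \<in> bounded_ops" for N S
  proof -
    show "complex_subspace {u. blinfun_apply S u \<in> N}"
      using that(1,3) unfolding complex_subspace_def by (auto simp: blinfun.add_right bounded_opsD)
    have "closed (blinfun_apply S -` N)"
      using that(2) by (intro continuous_closed_vimage) (auto intro: linear_continuous_at blinfun.bounded_linear_right)
    then show "closed {u. blinfun_apply S u \<in> N}" by (simp add: vimage_def)
  qed
  have inv: "S u \<in> K" if "S \<in> A" "u \<in> K" for S u
  proof -
    have "blinfun_apply S (blinfun_apply T (blinfun_apply E z)) \<in> K" if "T \<in> A" for T z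
    proof -
      have "S o\<^sub>L T \<in> A" using A(1) \<open>S \<in> A\<close> that by (rule operator_algebra_compose)
      then show ?thesis unfolding K_def \<N>_def by force
    qed
    then have "{u. blinfun_apply S u \<in> K} \<in> \<N>"
      using sub[OF K operator_algebra_bounded[OF A(1) that(1)]] unfolding \<N>_def by blast
    then show ?thesis using that(2) unfolding K_def by blast
  qed
  have EK: "E z \<in> K" for z
  proof -
    have "E z \<in> N" if "N \<in> \<N>" for N
    proof -
      have "blinfun_apply id_blinfun (blinfun_apply E z) \<in> N" using that A(2) unfolding \<N>_def by blast
      then show ?thesis by simp
    qed
    then show ?thesis unfolding K_def by blast
  qed
  have FK: "F u = 0" if "u \<in> K" for u
  proof -
    have "complex_subspace {0::'a}" "closed {0::'a}" by (auto simp: complex_subspace_def)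
    from sub[OF this EF(2)] have "{u. blinfun_apply F u \<in> {0}} \<in> \<N>"
      using zero unfolding \<N>_def by blast
    then show ?thesis using that unfolding K_def by blast
  qed
  obtain Q where Q: "Q \<in> projections" "\<And>x. blinfun_apply Q x \<in> K" "\<And>x. x \<in> K \<Longrightarrow> blinfun_apply Q x = x"
    using projection_exists[OF K] by metis
  have "Q \<in> lat A"
    unfolding lat_def using Q inv by (auto simp: range_projection_iff[OF Q(1)])
  then show thesis using that Q EK FK by blast
qed

context boolean_projections
begin

lemma finite_orthogonal_sum:
  assumes "finite I" "\<And>X. X \<in> I \<Longrightarrow> a X \<in> BB"
    "\<And>X Y z. X \<in> I \<Longrightarrow> Y \<in> I \<Longrightarrow> X \<noteq> Y \<Longrightarrow> blinfun_apply (a X) (blinfun_apply (a Y) z) = 0"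
  shows "\<exists>B\<in>BB. \<forall>z. blinfun_apply B z = (\<Sum>X\<in>I. blinfun_apply (a X) z)"
  using assms
proof (induction I rule: finite_induct)
  case empty
  have "id_blinfun - id_blinfun \<in> BB" by (intro compl one)
  then show ?case by (intro bexI[of _ 0]) auto
next
  case (insert X I)
  then obtain B where B: "B \<in> BB" "\<And>z. blinfun_apply B z = (\<Sum>X\<in>I. blinfun_apply (a X) z)" by auto
  have "a X (B z) = 0" for z
    unfolding B(2) blinfun.sum_right using insert by (intro sum.neutral) auto
  then have "a X + B \<in> BB" using B(1) insert.prems by (intro orthogonal_sum) auto
  then show ?case using insert.hyps B(2) by (intro bexI[of _ "a X + B"]) (auto simp: blinfun.add_left)
qed

text \<open>In terms of atoms, a combination of projections acts diagonally.\<close>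

lemma simple_operator_bound:
  assumes S: "finite S" "S \<subseteq> BB" and r: "square_summable r"
    and le: "\<And>G. G \<in> BB \<Longrightarrow> sq_norm (\<lambda>n. blinfun_apply G (r n)) \<le> k * (norm (blinfun_apply G v))\<^sup>2"
  shows "square_summable (\<lambda>n. \<Sum>E\<in>S. \<alpha> E *\<^sub>C blinfun_apply E (r n))"
    "sq_norm (\<lambda>n. \<Sum>E\<in>S. \<alpha> E *\<^sub>C blinfun_apply E (r n)) \<le> k * (norm (\<Sum>E\<in>S. \<alpha> E *\<^sub>C blinfun_apply E v))\<^sup>2"
proof -
  define \<beta> where "\<beta> X = (\<Sum>E\<in>X. \<alpha> E)" for X :: "('a \<Rightarrow>\<^sub>L 'a) set"
  have pt: "(norm (\<Sum>E\<in>S. \<alpha> E *\<^sub>C blinfun_apply E z))\<^sup>2 = (\<Sum>X\<in>Pow S. (cmod (\<beta> X))\<^sup>2 * (norm (atom S X z))\<^sup>2)" for z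
  proof -
    have "(norm (\<Sum>X\<in>Pow S. \<beta> X *\<^sub>C atom S X z))\<^sup>2 = (\<Sum>X\<in>Pow S. (norm (\<beta> X *\<^sub>C atom S X z))\<^sup>2)"
      using S by (intro pythagoras_sum) (auto simp: cinner_scaleC_left cinner_scaleC_right atom_orthogonal)
    then show ?thesis unfolding combination_eq_sum_atoms[OF S] \<beta>_def
      by (simp add: norm_scaleC power_mult_distrib)
  qed
  have s: "summable (\<lambda>n. (norm (atom S X (r n)))\<^sup>2)" for X
    using square_summable_apply(1)[OF r, of "atom S X"] unfolding square_summable_def .
  show "square_summable (\<lambda>n. \<Sum>E\<in>S. \<alpha> E *\<^sub>C blinfun_apply E (r n))"
    unfolding square_summable_def pt by (intro summable_sum summable_mult s)
  have "sq_norm (\<lambda>n. \<Sum>E\<in>S. \<alpha> E *\<^sub>C blinfun_apply E (r n)) =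
      (\<Sum>X\<in>Pow S. (cmod (\<beta> X))\<^sup>2 * sq_norm (\<lambda>n. atom S X (r n)))"
    unfolding sq_norm_def pt using s by (simp add: suminf_sum summable_mult suminf_mult)
  also have "\<dots> \<le> (\<Sum>X\<in>Pow S. (cmod (\<beta> X))\<^sup>2 * (k * (norm (atom S X v))\<^sup>2))"
    using le atom_in[OF S] by (intro sum_mono mult_left_mono) auto
  also have "\<dots> = k * (norm (\<Sum>E\<in>S. \<alpha> E *\<^sub>C blinfun_apply E v))\<^sup>2"
    unfolding pt by (simp add: sum_distrib_left mult_ac)
  finally show "sq_norm (\<lambda>n. \<Sum>E\<in>S. \<alpha> E *\<^sub>C blinfun_apply E (r n)) \<le> k * (norm (\<Sum>E\<in>S. \<alpha> E *\<^sub>C blinfun_apply E v))\<^sup>2" .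
qed

end

lemma nonneg_zero_if_small:
  fixes w K :: real
  assumes "w \<ge> 0" "\<And>t. 0 < t \<Longrightarrow> t \<le> 1/2 \<Longrightarrow> w \<le> t * K"
  shows "w = 0"
proof (rule ccontr)
  assume "w \<noteq> 0"
  then have w: "w > 0" using assms(1) by simp
  then have K: "K > 0" using assms(2)[of "1/2"] by simp
  define t where "t = min (1/2) (w / (2 * K))"
  have "0 < t" "t \<le> 1/2" using w K by (auto simp: t_def)
  then have "w \<le> t * K" by (rule assms(2))
  also have "\<dots> \<le> w / (2 * K) * K" using K by (intro mult_right_mono) (auto simp: t_def)
  also have "\<dots> = w / 2" using K by simp
  finally show False using w by simp
qed

lemma cinner_series_bound:
  fixes x y :: "nat \<Rightarrow> 'a::complex_hilbert_space"
  assumes "square_summable x" "square_summable y" "sq_norm x \<le> a\<^sup>2" "sq_norm y \<le> b\<^sup>2" "a \<ge> 0" "b \<ge> 0"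
  shows "cmod (\<Sum>n. cinner (x n) (y n)) \<le> a * b"
proof -
  have "cmod (\<Sum>n. cinner (x n) (y n)) \<le> sqrt (sq_norm x) * sqrt (sq_norm y)"
    using assms by (intro cinner_series)
  also have "\<dots> \<le> a * b"
    using assms sq_norm_nonneg by (intro mult_mono real_le_lsqrt) auto
  finally show ?thesis .
qed

lemma cinner_series_add_left:
  fixes x y :: "nat \<Rightarrow> 'a::complex_hilbert_space"
  assumes "square_summable x" "square_summable x'" "square_summable y"
  shows "(\<Sum>n. cinner (x n + x' n) (y n)) = (\<Sum>n. cinner (x n) (y n)) + (\<Sum>n. cinner (x' n) (y n))"
  using assms by (simp add: cinner_add_left cinner_series suminf_add)

lemma cinner_series_add_right:
  fixes x y :: "nat \<Rightarrow> 'a::complex_hilbert_space"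
  assumes "square_summable x" "square_summable y" "square_summable y'"
  shows "(\<Sum>n. cinner (x n) (y n + y' n)) = (\<Sum>n. cinner (x n) (y n)) + (\<Sum>n. cinner (x n) (y' n))"
  using assms by (simp add: cinner_add_right cinner_series suminf_add)

context projection_sublattice
begin

context
  fixes A and \<xi> \<eta> :: 'a and p q :: "'a \<Rightarrow>\<^sub>L 'a"
  assumes A: "operator_algebra A" "commutant L \<subseteq> A" and BB: "BB \<subseteq> commutant L"
    and p: "p \<in> projections" "\<And>E x. E \<in> BB \<Longrightarrow> blinfun_apply p (blinfun_apply E x) = E (p x)"
      "\<And>x. blinfun_apply p x \<in> cyclic_space \<xi>" "\<And>x. x \<in> cyclic_space \<xi> \<Longrightarrow> blinfun_apply p x = x"
    and q: "q \<in> projections" "\<And>E x. E \<in> BB \<Longrightarrow> blinfun_apply q (blinfun_apply E x) = E (q x)"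
      "\<And>x. blinfun_apply q x \<in> cyclic_space \<eta>" "\<And>x. x \<in> cyclic_space \<eta> \<Longrightarrow> blinfun_apply q x = x"
begin

lemma pq_in: "p \<in> A" "q \<in> A"
proof -
  have "p \<in> commutant L" using p L_sub by (intro commutantI) (auto simp: projectionsD)
  moreover have "q \<in> commutant L" using q L_sub by (intro commutantI) (auto simp: projectionsD)
  ultimately show "p \<in> A" "q \<in> A" using A by auto
qed

lemma simple_operator_in:
  assumes "S \<subseteq> BB" shows "(\<Sum>E\<in>S. scale_op (\<alpha> E) E) \<in> A"
  using assms A BB unfolding operator_algebra_def
  by (intro operator_algebra_sum A) blast

text \<open>If \<open>x \<approx> c \<xi>\<close> on \<open>E\<close> and \<open>y \<approx> d \<eta>\<close> on \<open>F\<close>, the functional given by \<open>x\<close> and \<open>y\<close>, localised by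
  multiplication with simple operators, is on the corner \<open>F A E\<close> a perturbation of \<open>S \<mapsto> (c \<cdot> d) S\<close> of
  norm less than \<open>\<bar>c \<cdot> d\<bar>\<close>. A functional annihilating \<open>A\<close> therefore forces the corner to vanish.\<close>

lemma corner_vanishes:
  assumes xy: "square_summable x" "square_summable y"
    and ann: "\<And>S. S \<in> A \<Longrightarrow> (\<Sum>n. cinner (blinfun_apply S (x n)) (y n)) = 0"
    and E: "E \<in> BB" and F: "F \<in> BB"
    and c: "summable (\<lambda>n. (cmod (c n))\<^sup>2)" and d: "summable (\<lambda>n. (cmod (d n))\<^sup>2)"
    and xc: "\<And>G. G \<in> BB \<Longrightarrow> (\<And>z. blinfun_apply E (blinfun_apply G z) = G z) \<Longrightarrow>
      sq_norm (\<lambda>n. blinfun_apply G (x n - c n *\<^sub>C \<xi>)) \<le> \<gamma>\<^sup>2 * (norm (G \<xi>))\<^sup>2"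
    and yd: "\<And>G. G \<in> BB \<Longrightarrow> (\<And>z. blinfun_apply F (blinfun_apply G z) = G z) \<Longrightarrow>
      sq_norm (\<lambda>n. blinfun_apply G (y n - d n *\<^sub>C \<eta>)) \<le> \<kappa>\<^sup>2 * (norm (G \<eta>))\<^sup>2"
    and pos: "\<gamma> \<ge> 0" "\<kappa> \<ge> 0"
    and gap: "sqrt (\<Sum>n. (cmod (c n))\<^sup>2) * \<kappa> + sqrt (\<Sum>n. (cmod (d n))\<^sup>2) * \<gamma> + \<gamma> * \<kappa> < cmod (\<Sum>n. c n * cnj (d n))"
    and S: "S \<in> A"
  shows "blinfun_apply F (blinfun_apply q (blinfun_apply S (blinfun_apply p (blinfun_apply E z)))) = 0"
proof -
  define C where "C = sqrt (\<Sum>n. (cmod (c n))\<^sup>2)"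
  define D where "D = sqrt (\<Sum>n. (cmod (d n))\<^sup>2)"
  define cd where "cd = (\<Sum>n. c n * cnj (d n))"
  define R where "R = C * \<kappa> + D * \<gamma> + \<gamma> * \<kappa>"
  have C0: "C \<ge> 0" and C2: "C\<^sup>2 = (\<Sum>n. (cmod (c n))\<^sup>2)" unfolding C_def using c by (auto intro: suminf_nonneg)
  have D0: "D \<ge> 0" and D2: "D\<^sup>2 = (\<Sum>n. (cmod (d n))\<^sup>2)" unfolding D_def using d by (auto intro: suminf_nonneg)
  have R0: "R \<ge> 0" unfolding R_def using C0 D0 pos by simp
  have gap': "R < cmod cd" using gap unfolding R_def C_def D_def cd_def by simp
  define U where "U = F o\<^sub>L q o\<^sub>L S o\<^sub>L p o\<^sub>L E"
  have U: "U z = F (q (S (p (E z))))" for z by (simp add: U_def)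
  have EFA: "E \<in> A" "F \<in> A" using E F BB A(2) by auto
  have UA: "U \<in> A" unfolding U_def by (intro operator_algebra_compose[OF A(1)] EFA pq_in S)
  have Ub: "U \<in> bounded_ops" by (rule operator_algebra_bounded[OF A(1) UA])
  have UE: "U (E z) = U z" for z using E by (simp add: U)
  have FU: "F (U z) = U z" for z using F by (simp add: U)
  have Up: "U (p z) = U z" for z using p(2)[OF E] projectionsD(2)[OF p(1)] by (simp add: U flip: p(2)[OF E])
  have qU: "q (U z) = U z" for z using projectionsD(2)[OF q(1)] by (simp add: U q(2)[OF F])
  have simple_bound: "cmod cd * cmod (cinner (U u) v) \<le> R * norm U * norm u * norm v"
    if u: "u \<in> simple_vectors \<xi>" and v: "v \<in> simple_vectors \<eta>" for u v
  proof -
    obtain M \<alpha> where M: "finite M" "M \<subseteq> BB" and u_eq: "u = (\<Sum>G\<in>M. \<alpha> G *\<^sub>C blinfun_apply G \<xi>)"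
      using simple_vectors_combination[OF u] by blast
    obtain M' \<alpha>' where M': "finite M'" "M' \<subseteq> BB" and v_eq: "v = (\<Sum>G\<in>M'. \<alpha>' G *\<^sub>C blinfun_apply G \<eta>)"
      using simple_vectors_combination[OF v] by blast
    define a where "a z = (\<Sum>G\<in>M. \<alpha> G *\<^sub>C blinfun_apply G z)" for z
    define b where "b z = (\<Sum>G\<in>M'. \<alpha>' G *\<^sub>C blinfun_apply G z)" for z
    define r where "r n = E (x n - c n *\<^sub>C \<xi>)" for n
    define s where "s n = F (y n - d n *\<^sub>C \<eta>)" for n
    have EM: "blinfun_apply E (blinfun_apply G z) = blinfun_apply G (E z)" if "G \<in> M" for G z
      using commute[OF E, of G] M that by blast
    have FM: "blinfun_apply F (blinfun_apply G z) = blinfun_apply G (F z)" if "G \<in> M'" for G z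
      using commute[OF F, of G] M' that by blast
    have aE: "E (a z) = a (E z)" for z
      by (simp add: a_def blinfun.sum_right apply_scaleC[OF E] EM cong: sum.cong)
    have bF: "F (b z) = b (F z)" for z
      by (simp add: b_def blinfun.sum_right apply_scaleC[OF F] FM cong: sum.cong)
    have sc: "G \<in> BB \<Longrightarrow> blinfun_apply G (k *\<^sub>C z) = k *\<^sub>C G z" for G k z by (rule apply_scaleC)
    have a_add: "a (z + w) = a z + a w" "a (k *\<^sub>C z) = k *\<^sub>C a z" for z w k
      using M sc unfolding a_def
      by (auto simp: blinfun.add_right scaleC_add_right sum.distrib scaleC_sum_right scaleC_scaleC subset_iff mult.commute
          intro!: sum.cong)
    have b_add: "b (z + w) = b z + b w" "b (k *\<^sub>C z) = k *\<^sub>C b z" for z w k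
      using M' sc unfolding b_def
      by (auto simp: blinfun.add_right scaleC_add_right sum.distrib scaleC_sum_right scaleC_scaleC subset_iff mult.commute
          intro!: sum.cong)
    have r: "square_summable r" unfolding r_def
      by (intro square_summable_apply square_summable_diff xy square_summable_scaleC_vector c)
    have s: "square_summable s" unfolding s_def
      by (intro square_summable_apply square_summable_diff xy square_summable_scaleC_vector d)
    have "sq_norm (\<lambda>n. G (r n)) \<le> \<gamma>\<^sup>2 * (norm (G (E \<xi>)))\<^sup>2" if "G \<in> BB" for G
      using xc[of "G o\<^sub>L E"] that E commute[OF E that] by (simp add: r_def inter)
    note ar' = simple_operator_bound[OF M r this, of \<alpha>, folded a_def]
    have "sq_norm (\<lambda>n. G (s n)) \<le> \<kappa>\<^sup>2 * (norm (G (F \<eta>)))\<^sup>2" if "G \<in> BB" for G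
      using yd[of "G o\<^sub>L F"] that F commute[OF F that] by (simp add: s_def inter)
    note bs' = simple_operator_bound[OF M' s this, of \<alpha>', folded b_def]
    have u': "u = a \<xi>" and v': "v = b \<eta>" using u_eq v_eq by (auto simp: a_def b_def)
    have ar: "square_summable (\<lambda>n. a (r n))" "sq_norm (\<lambda>n. a (r n)) \<le> (\<gamma> * norm u)\<^sup>2"
    proof -
      have "norm (a (E \<xi>)) \<le> norm u" unfolding u' aE[symmetric] by (rule norm_projection_le[OF proj[OF E]])
      then have "\<gamma>\<^sup>2 * (norm (a (E \<xi>)))\<^sup>2 \<le> \<gamma>\<^sup>2 * (norm u)\<^sup>2" by (intro mult_left_mono power_mono) auto
      then show "sq_norm (\<lambda>n. a (r n)) \<le> (\<gamma> * norm u)\<^sup>2" using ar'(2) by (simp add: power_mult_distrib)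
    qed (rule ar')
    have bs: "square_summable (\<lambda>n. b (s n))" "sq_norm (\<lambda>n. b (s n)) \<le> (\<kappa> * norm v)\<^sup>2"
    proof -
      have "norm (b (F \<eta>)) \<le> norm v" unfolding v' bF[symmetric] by (rule norm_projection_le[OF proj[OF F]])
      then have "\<kappa>\<^sup>2 * (norm (b (F \<eta>)))\<^sup>2 \<le> \<kappa>\<^sup>2 * (norm v)\<^sup>2" by (intro mult_left_mono power_mono) auto
      then show "sq_norm (\<lambda>n. b (s n)) \<le> (\<kappa> * norm v)\<^sup>2" using bs'(2) by (simp add: power_mult_distrib)
    qed (rule bs')
    define cu where "cu n = c n *\<^sub>C U u" for n
    define dv where "dv n = d n *\<^sub>C v" for n
    define ur where "ur n = U (a (r n))" for n
    define bsn where "bsn n = b (s n)" for n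
    have cu: "square_summable cu" "sq_norm cu \<le> (C * (norm U * norm u))\<^sup>2"
    proof -
      show "square_summable cu" unfolding cu_def by (rule square_summable_scaleC_vector[OF c])
      have "sq_norm cu = C\<^sup>2 * (norm (U u))\<^sup>2"
        unfolding cu_def[abs_def] C2 by (rule square_summable_scaleC_vector[OF c])
      also have "\<dots> \<le> C\<^sup>2 * (norm U * norm u)\<^sup>2" by (intro mult_left_mono power_mono norm_blinfun) auto
      finally show "sq_norm cu \<le> (C * (norm U * norm u))\<^sup>2" by (simp add: power_mult_distrib)
    qed
    have dv: "square_summable dv" "sq_norm dv \<le> (D * norm v)\<^sup>2"
      unfolding dv_def[abs_def] by (simp_all add: square_summable_scaleC_vector[OF d] power_mult_distrib D2)
    have ur: "square_summable ur" "sq_norm ur \<le> (norm U * (\<gamma> * norm u))\<^sup>2"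
    proof -
      show "square_summable ur" unfolding ur_def by (intro square_summable_apply ar)
      have "sq_norm ur \<le> (norm U)\<^sup>2 * sq_norm (\<lambda>n. a (r n))"
        unfolding ur_def[abs_def] by (intro square_summable_apply ar)
      also have "\<dots> \<le> (norm U)\<^sup>2 * (\<gamma> * norm u)\<^sup>2" by (intro mult_left_mono ar) auto
      finally show "sq_norm ur \<le> (norm U * (\<gamma> * norm u))\<^sup>2" by (simp add: power_mult_distrib)
    qed
    have bsn: "square_summable bsn" "sq_norm bsn \<le> (\<kappa> * norm v)\<^sup>2"
      using bs unfolding bsn_def[abs_def] by auto
    have entry: "cinner (U (a (x n))) (b (y n)) = cinner (cu n + ur n) (dv n + bsn n)" for n
    proof -
      have "a (x n) = c n *\<^sub>C u + a (x n - c n *\<^sub>C \<xi>)"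
        using a_add(1)[of "c n *\<^sub>C \<xi>" "x n - c n *\<^sub>C \<xi>"] by (simp add: a_add u')
      then have "U (a (x n)) = cu n + U (E (a (x n - c n *\<^sub>C \<xi>)))"
        by (simp add: blinfun.add_right bounded_opsD[OF Ub] UE cu_def)
      then have 1: "U (a (x n)) = cu n + ur n" by (simp add: aE ur_def r_def)
      have "b (y n) = d n *\<^sub>C v + b (y n - d n *\<^sub>C \<eta>)"
        using b_add(1)[of "d n *\<^sub>C \<eta>" "y n - d n *\<^sub>C \<eta>"] by (simp add: b_add v')
      then have "cinner (U z) (b (y n)) = cinner (U z) (dv n) + cinner (F (U z)) (b (y n - d n *\<^sub>C \<eta>))" for z
        by (simp add: cinner_add_right FU dv_def)
      then have "cinner (U z) (b (y n)) = cinner (U z) (dv n + bsn n)" for z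
        using cinner_move[OF F] by (simp add: bF bsn_def s_def cinner_add_right)
      moreover have "cu n + ur n = U (a (x n))" using 1 by simp
      ultimately show ?thesis by metis
    qed
    \<comment> \<open>The adjoint of the simple operator \<open>b\<close> has the conjugate coefficients, so \<open>b\<^sup>* U a\<close> is in \<open>A\<close>.\<close>
    have bstar: "(\<Sum>G\<in>M'. scale_op (cnj (\<alpha>' G)) G) o\<^sub>L U o\<^sub>L (\<Sum>G\<in>M. scale_op (\<alpha> G) G) \<in> A"
      by (intro operator_algebra_compose[OF A(1)] simple_operator_in M M' UA)
    have "cinner (((\<Sum>G\<in>M'. scale_op (cnj (\<alpha>' G)) G) o\<^sub>L U o\<^sub>L (\<Sum>G\<in>M. scale_op (\<alpha> G) G)) z) w = cinner (U (a z)) (b w)" for z w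
    proof -
      have "(\<Sum>G\<in>M. scale_op (\<alpha> G) G) z = a z" by (simp add: a_def blinfun.sum_left scale_op_apply)
      moreover have "cinner ((\<Sum>G\<in>M'. scale_op (cnj (\<alpha>' G)) G) z) w = cinner z (b w)" for z
        using M' cinner_move
        by (auto simp: b_def blinfun.sum_left scale_op_apply cinner_sum_left cinner_sum_right cinner_scaleC_left
            cinner_scaleC_right intro!: sum.cong)
      ultimately show ?thesis by simp
    qed
    with ann[OF bstar] have "(\<Sum>n. cinner (U (a (x n))) (b (y n))) = 0" by simp
    then have "0 = (\<Sum>n. cinner (cu n + ur n) (dv n + bsn n))" by (simp add: entry)
    also have "\<dots> = (\<Sum>n. cinner (cu n) (dv n)) + (\<Sum>n. cinner (cu n) (bsn n)) +
        ((\<Sum>n. cinner (ur n) (dv n)) + (\<Sum>n. cinner (ur n) (bsn n)))"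
      unfolding cinner_series_add_left[OF cu(1) ur(1) square_summable_add(1)[OF dv(1) bsn(1)]]
        cinner_series_add_right[OF cu(1) dv(1) bsn(1)] cinner_series_add_right[OF ur(1) dv(1) bsn(1)] by (rule refl)
    also have "(\<Sum>n. cinner (cu n) (dv n)) = cd * cinner (U u) v"
    proof -
      have "summable (\<lambda>n. c n * cnj (d n))"
      proof (rule summable_norm_cancel, rule summable_comparison_test')
        show "summable (\<lambda>n. (cmod (c n))\<^sup>2 + (cmod (d n))\<^sup>2)" by (intro summable_add c d)
        show "norm (cmod (c n * cnj (d n))) \<le> (cmod (c n))\<^sup>2 + (cmod (d n))\<^sup>2" for n
        proof -
          have "0 \<le> cmod (c n) * cmod (d n)" "2 * (cmod (c n) * cmod (d n)) \<le> (cmod (c n))\<^sup>2 + (cmod (d n))\<^sup>2"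
            using sum_squares_bound[of "cmod (c n)" "cmod (d n)"] by (simp_all add: mult.assoc)
          then have "cmod (c n) * cmod (d n) \<le> (cmod (c n))\<^sup>2 + (cmod (d n))\<^sup>2" by linarith
          then show ?thesis by (simp add: norm_mult)
        qed
      qed
      from suminf_mult2[OF this, of "cinner (U u) v"] show ?thesis
        by (simp add: cu_def dv_def cd_def cinner_scaleC_left cinner_scaleC_right mult_ac)
    qed
    finally have *: "cd * cinner (U u) v = - ((\<Sum>n. cinner (cu n) (bsn n)) + (\<Sum>n. cinner (ur n) (dv n)) + (\<Sum>n. cinner (ur n) (bsn n)))"
      by (simp add: algebra_simps eq_neg_iff_add_eq_0)
    have "cmod cd * cmod (cinner (U u) v) = cmod (cd * cinner (U u) v)" by (simp add: norm_mult)
    also have "\<dots> = cmod ((\<Sum>n. cinner (cu n) (bsn n)) + (\<Sum>n. cinner (ur n) (dv n)) + (\<Sum>n. cinner (ur n) (bsn n)))"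
      unfolding * by (rule norm_minus_cancel)
    also have "\<dots> \<le> cmod ((\<Sum>n. cinner (cu n) (bsn n)) + (\<Sum>n. cinner (ur n) (dv n))) + cmod (\<Sum>n. cinner (ur n) (bsn n))"
      by (rule norm_triangle_ineq)
    also have "\<dots> \<le> cmod (\<Sum>n. cinner (cu n) (bsn n)) + cmod (\<Sum>n. cinner (ur n) (dv n)) + cmod (\<Sum>n. cinner (ur n) (bsn n))"
      by (rule add_right_mono[OF norm_triangle_ineq])
    also have "\<dots> \<le> C * (norm U * norm u) * (\<kappa> * norm v) + norm U * (\<gamma> * norm u) * (D * norm v)
        + norm U * (\<gamma> * norm u) * (\<kappa> * norm v)"
      using C0 D0 pos by (intro add_mono cinner_series_bound cu ur dv bsn) auto
    also have "\<dots> = R * norm U * norm u * norm v" by (simp add: R_def algebra_simps)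
    finally show ?thesis .
  qed
  have bound1: "cmod cd * cmod (cinner (U u) v) \<le> R * norm U * norm u * norm v"
    if "u \<in> simple_vectors \<xi>" "v \<in> cyclic_space \<eta>" for u v
  proof -
    have "closed {v. cmod cd * cmod (cinner (U u) v) \<le> R * norm U * norm u * norm v}"
      by (intro closed_Collect_le continuous_intros continuous_on_cinner_right)
    then have "cyclic_space \<eta> \<subseteq> {v. cmod cd * cmod (cinner (U u) v) \<le> R * norm U * norm u * norm v}"
      unfolding cyclic_space_def using simple_bound[OF that(1)] by (intro closure_minimal) auto
    then show ?thesis using that by blast
  qed
  have bound2: "cmod cd * cmod (cinner (U u) v) \<le> R * norm U * norm u * norm v"
    if "u \<in> cyclic_space \<xi>" "v \<in> cyclic_space \<eta>" for u v
  proof -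
    have "closed {u. cmod cd * cmod (cinner (U u) v) \<le> R * norm U * norm u * norm v}"
      by (intro closed_Collect_le continuous_intros continuous_on_cinner_left
          linear_continuous_on blinfun.bounded_linear_right)
    then have "cyclic_space \<xi> \<subseteq> {u. cmod cd * cmod (cinner (U u) v) \<le> R * norm U * norm u * norm v}"
      unfolding cyclic_space_def using bound1[OF _ that(2)] by (intro closure_minimal) auto
    then show ?thesis using that by blast
  qed
  have cd0: "cmod cd > 0" using gap' R0 by linarith
  have "norm U \<le> R * norm U / cmod cd"
  proof (rule norm_blinfun_bound)
    show "0 \<le> R * norm U / cmod cd" using R0 by simp
    fix z
    have "cmod cd * (norm (U z))\<^sup>2 = cmod cd * cmod (cinner (U (p z)) (q (U z)))"
      by (simp add: Up qU flip: cinner_self) (simp add: norm_power)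
    also have "\<dots> \<le> R * norm U * norm (p z) * norm (q (U z))"
      by (rule bound2[OF p(3) q(3)])
    also have "\<dots> \<le> R * norm U * norm z * norm (U z)"
      unfolding qU using R0 by (intro mult_right_mono mult_left_mono norm_projection_le p) auto
    finally have "cmod cd * norm (U z) \<le> R * norm U * norm z"
      by (cases "norm (U z) = 0") (use R0 in \<open>auto simp: power2_eq_square\<close>)
    then show "norm (U z) \<le> R * norm U / cmod cd * norm z"
      using cd0 by (simp add: field_simps)
  qed
  then have "cmod cd * norm U \<le> R * norm U" using cd0 by (simp add: field_simps)
  then have "norm U = 0" using gap' by (metis mult_le_cancel_right not_less norm_ge_zero less_le)
  then show ?thesis using U[of z] by simp
qed

text \<open>If the corner \<open>F A E\<close> vanishes, an element of \<open>L\<close> separates \<open>E\<close> from \<open>F\<close>, and \<open>T\<close> leaves it invariant.\<close>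

lemma positive_operator_supported:
  assumes lat: "lat A \<subseteq> L"
    and T: "T \<in> bounded_ops" "positive_on BB \<xi> \<eta> (\<lambda>(x, y). cinner (blinfun_apply T x) y)"
    and E: "E \<in> BB" and F: "F \<in> BB"
    and zero: "\<And>S z. S \<in> A \<Longrightarrow> blinfun_apply F (blinfun_apply q (blinfun_apply S (blinfun_apply p (blinfun_apply E z)))) = 0"
  shows "cinner (blinfun_apply T (blinfun_apply E \<xi>)) (blinfun_apply F \<eta>) = 0"
proof -
  have bo: "p \<in> bounded_ops" "q \<in> bounded_ops" "E \<in> bounded_ops" "F \<in> bounded_ops"
    using p(1) q(1) proj[OF E] proj[OF F] by (auto simp: projectionsD)
  have idA: "id_blinfun \<in> A" using A(2) id_in_commutant by blast
  have "(F o\<^sub>L q) (blinfun_apply S ((p o\<^sub>L E) z)) = 0" if "S \<in> A" for S z using zero[OF that] by simp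
  from invariant_projection_separates[OF A(1) idA _ _ this]
  obtain Q where Q: "Q \<in> lat A" and QE: "\<And>z. blinfun_apply Q ((p o\<^sub>L E) z) = (p o\<^sub>L E) z"
    and FQ: "\<And>z. (F o\<^sub>L q) (blinfun_apply Q z) = 0"
    using bo bounded_ops_blinfun_arith(3) by metis
  have QL: "Q \<in> L" using lat Q by blast
  note compression = compression_leaves_lattice_invariant[OF T p(1-3) q(1-3) QL]
  have "E \<xi> \<in> cyclic_space \<xi>" "F \<eta> \<in> cyclic_space \<eta>"
    using E F by (auto intro: simple_in_cyclic simple_vectors.base)
  then have pE: "E \<xi> = p (Q (E \<xi>))" and qF: "F \<eta> = q (F \<eta>)"
    using QE[of \<xi>] p(4) q(4) by auto
  have "cinner (T (E \<xi>)) (F \<eta>) = cinner (q (T (p (Q (E \<xi>))))) (F \<eta>)"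
    by (subst pE, subst qF) (simp add: projectionsD[OF q(1)])
  also have "\<dots> = cinner (q (F (Q (q (T (p (Q (E \<xi>)))))))) \<eta>"
    using cinner_move[OF F] q(2)[OF F] projectionsD(2)[OF q(1)] compression[of "E \<xi>"]
    by (metis (no_types, lifting))
  also have "\<dots> = 0" using FQ q(2)[OF F] by simp
  finally show ?thesis .
qed

text \<open>On a pair of pieces either the corner of \<open>A\<close>, and with it that of \<open>T\<close>, vanishes, or the constant
  \<open>c \<cdot> d\<close> is small. In the second case positivity and the bounds on the marginals of \<open>T\<close> allow the
  errors to be summed over all pairs of pieces.\<close>

lemma annihilating_functional_kills_positive_operator:
  assumes lat: "lat A \<subseteq> L"
    and T: "T \<in> bounded_ops" "positive_on BB \<xi> \<eta> (\<lambda>(x, y). cinner (blinfun_apply T x) y)"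
    and x: "square_summable x" "\<And>n. x n \<in> cyclic_space \<xi>"
    and y: "square_summable y" "\<And>n. y n \<in> cyclic_space \<eta>"
    and ann: "\<And>S. S \<in> A \<Longrightarrow> (\<Sum>n. cinner (blinfun_apply S (x n)) (y n)) = 0"
  shows "(\<Sum>n. cinner (blinfun_apply T (x n)) (y n)) = 0"
proof -
  define X2 where "X2 = 2 * sq_norm x + 1"
  define Y2 where "Y2 = 2 * sq_norm y + 1"
  \<comment> \<open>\<open>X2\<close> and \<open>Y2\<close> bound the simple approximations of \<open>x\<close> and \<open>y\<close>. The first two summands of \<open>K\<close> come from
    replacing \<open>x\<close> and \<open>y\<close> by these approximations, the other two from the pairs of pieces.\<close>
  define K where "K = norm T * (2 * sqrt (sq_norm y)) + norm T * (2 * sqrt X2)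
    + 3 * ((norm \<xi>)\<^sup>2 + X2) + 3 * ((norm \<eta>)\<^sup>2 + Y2)"
  have posT: "Im (cinner (T (F \<xi>)) (G \<eta>)) = 0" "0 \<le> Re (cinner (T (F \<xi>)) (G \<eta>))" if "F \<in> BB" "G \<in> BB" for F G
    using T(2) that unfolding positive_on_def by auto
  have marg: "Re (cinner (T (F \<xi>)) \<eta>) \<le> (norm (F \<xi>))\<^sup>2" "Re (cinner (T \<xi>) (F \<eta>)) \<le> (norm (F \<eta>))\<^sup>2" if "F \<in> BB" for F
    using T(2) that unfolding positive_on_def by auto
  have "cmod (\<Sum>n. cinner (T (x n)) (y n)) \<le> t * K" if t: "0 < t" "t \<le> 1/2" for t
  proof -
    have e: "0 < t\<^sup>2" "t\<^sup>2 \<le> 1/4" using t power_mono[of t "1/2" 2] by (auto simp: power2_eq_square)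
    obtain I :: "('a \<Rightarrow>\<^sub>L 'a) set set" and a c where "hereditary_approximation x \<xi> (t\<^sup>2) I a c"
      using hereditary_approximation_exists[OF x e] by blast
    note I = hereditary_approximationD(1-3)[OF this] and xc = hereditary_approximationD(5)[OF this]
      and xt' = hereditary_approximationD(6)[OF this]
    obtain N where c0: "c X n = 0" if "n \<ge> N" for X n
      using hereditary_approximationD(4)[OF \<open>hereditary_approximation x \<xi> (t\<^sup>2) I a c\<close>] by blast
    obtain J :: "('a \<Rightarrow>\<^sub>L 'a) set set" and b d where "hereditary_approximation y \<eta> (t\<^sup>2) J b d"
      using hereditary_approximation_exists[OF y e] by blast
    note J = hereditary_approximationD(1-3)[OF this] and yd = hereditary_approximationD(5)[OF this]
      and yt' = hereditary_approximationD(6)[OF this]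
    obtain N' where d0: "d Y n = 0" if "n \<ge> N'" for Y n
      using hereditary_approximationD(4)[OF \<open>hereditary_approximation y \<eta> (t\<^sup>2) J b d\<close>] by blast
    define xt where "xt n = (\<Sum>X\<in>I. c X n *\<^sub>C a X \<xi>)" for n
    define yt where "yt n = (\<Sum>Y\<in>J. d Y n *\<^sub>C b Y \<eta>)" for n
    define cc where "cc X = (\<Sum>n. (cmod (c X n))\<^sup>2)" for X
    define dd where "dd Y = (\<Sum>n. (cmod (d Y n))\<^sup>2)" for Y
    have csum: "summable (\<lambda>n. (cmod (c X n))\<^sup>2)" for X
      by (rule summable_finite[of "{..<N}"]) (auto simp: c0)
    have dsum: "summable (\<lambda>n. (cmod (d Y n))\<^sup>2)" for Y
      by (rule summable_finite[of "{..<N'}"]) (auto simp: d0)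
    have ccdd: "cc X \<ge> 0" "dd X \<ge> 0" for X
      unfolding cc_def dd_def using csum dsum by (auto intro: suminf_nonneg)
    have xt: "square_summable xt" by (rule square_summable_finite_support[of N]) (simp add: xt_def c0)
    have yt: "square_summable yt" by (rule square_summable_finite_support[of N']) (simp add: yt_def d0)
    have approx: "sq_norm z' \<le> 2 * sq_norm z + 1"
      if "square_summable z" "square_summable z'" "sq_norm (\<lambda>n. z n - z' n) \<le> 2 * t\<^sup>2" for z z' :: "nat \<Rightarrow> 'a"
    proof -
      have "sq_norm (\<lambda>n. z n - (z n - z' n)) \<le> 2 * sq_norm z + 2 * sq_norm (\<lambda>n. z n - z' n)"
        using that by (intro square_summable_diff)
      then show ?thesis using that(3) e by simp
    qed
    have xt2: "sq_norm xt \<le> X2" and yt2: "sq_norm yt \<le> Y2"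
      unfolding X2_def Y2_def using approx[OF x(1) xt] approx[OF y(1) yt] xt' yt'
      by (auto simp: xt_def[abs_def] yt_def[abs_def])
    have four: "2 * t\<^sup>2 \<le> (2 * t)\<^sup>2" by (simp add: power_mult_distrib)
    have X20: "X2 \<ge> 0" unfolding X2_def using sq_norm_nonneg[OF x(1)] by simp
    have total: "(\<Sum>X\<in>I. (1 + cc X) * (norm (a X \<xi>))\<^sup>2) \<le> (norm \<xi>)\<^sup>2 + X2"
      "(\<Sum>Y\<in>J. (1 + dd Y) * (norm (b Y \<eta>))\<^sup>2) \<le> (norm \<eta>)\<^sup>2 + Y2"
    proof -
      have gen: "(\<Sum>X\<in>I. (1 + (\<Sum>n. (cmod (c X n))\<^sup>2)) * (norm (a X \<zeta>))\<^sup>2) \<le> (norm \<zeta>)\<^sup>2 + sq_norm (\<lambda>n. \<Sum>X\<in>I. c X n *\<^sub>C a X \<zeta>)"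
        if I: "finite I" "\<And>X. X \<in> I \<Longrightarrow> a X \<in> BB"
          "\<And>X Y z. X \<in> I \<Longrightarrow> Y \<in> I \<Longrightarrow> X \<noteq> Y \<Longrightarrow> blinfun_apply (a X) (blinfun_apply (a Y) z) = 0"
          and csum: "\<And>X. summable (\<lambda>n. (cmod (c X n))\<^sup>2)"
        for I :: "('a \<Rightarrow>\<^sub>L 'a) set set" and a \<zeta> and c :: "('a \<Rightarrow>\<^sub>L 'a) set \<Rightarrow> nat \<Rightarrow> complex"
      proof -
        have orth: "cinner (a X u) (a Y v) = 0" if "X \<in> I" "Y \<in> I" "X \<noteq> Y" for X Y u v
          using cinner_move[OF I(2)[OF that(1)]] I(3)[OF that] by simp
        obtain B where B: "B \<in> BB" "\<And>z. blinfun_apply B z = (\<Sum>X\<in>I. blinfun_apply (a X) z)"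
          using finite_orthogonal_sum[of I a, OF I] by blast
        have "(\<Sum>X\<in>I. (norm (a X \<zeta>))\<^sup>2) = (norm (B \<zeta>))\<^sup>2"
          unfolding B(2) using I(1) orth by (intro pythagoras_sum[symmetric]) auto
        also have "\<dots> \<le> (norm \<zeta>)\<^sup>2" by (intro power_mono norm_projection_le proj B) auto
        finally have 1: "(\<Sum>X\<in>I. (norm (a X \<zeta>))\<^sup>2) \<le> (norm \<zeta>)\<^sup>2" .
        have pt: "(norm (\<Sum>X\<in>I. c X n *\<^sub>C a X \<zeta>))\<^sup>2 = (\<Sum>X\<in>I. (cmod (c X n))\<^sup>2 * (norm (a X \<zeta>))\<^sup>2)" for n
          using I(1) orth
          by (subst pythagoras_sum) (auto simp: norm_scaleC power_mult_distrib cinner_scaleC_left cinner_scaleC_right)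
        have "sq_norm (\<lambda>n. \<Sum>X\<in>I. c X n *\<^sub>C a X \<zeta>) = (\<Sum>X\<in>I. (\<Sum>n. (cmod (c X n))\<^sup>2) * (norm (a X \<zeta>))\<^sup>2)"
          unfolding sq_norm_def pt by (simp add: suminf_sum summable_mult2 csum suminf_mult2[symmetric])
        with 1 show ?thesis by (simp add: distrib_right sum.distrib)
      qed
      show "(\<Sum>X\<in>I. (1 + cc X) * (norm (a X \<xi>))\<^sup>2) \<le> (norm \<xi>)\<^sup>2 + X2"
        using gen[of I a c \<xi>, OF I csum] xt2 unfolding cc_def xt_def[abs_def] by linarith
      show "(\<Sum>Y\<in>J. (1 + dd Y) * (norm (b Y \<eta>))\<^sup>2) \<le> (norm \<eta>)\<^sup>2 + Y2"
        using gen[of J b d \<eta>, OF J dsum] yt2 unfolding dd_def yt_def[abs_def] by linarith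
    qed
    define \<Phi> where "\<Phi> X Y = Re (cinner (T (a X \<xi>)) (b Y \<eta>))" for X Y
    have \<Phi>: "cinner (T (a X \<xi>)) (b Y \<eta>) = complex_of_real (\<Phi> X Y)" "\<Phi> X Y \<ge> 0" if "X \<in> I" "Y \<in> J" for X Y
      using posT[OF I(2)[OF that(1)] J(2)[OF that(2)]] by (auto simp: \<Phi>_def complex_eq_iff)
    have entry: "cmod (\<Sum>n. c X n * cnj (d Y n)) * \<Phi> X Y \<le> 3 * t * ((1 + cc X) + (1 + dd Y)) * \<Phi> X Y"
      if X: "X \<in> I" and Y: "Y \<in> J" for X Y
    proof -
      define C where "C = sqrt (1 + cc X)"
      define D where "D = sqrt (1 + dd Y)"
      have CD: "C \<ge> 0" "D \<ge> 0" "C\<^sup>2 = 1 + cc X" "D\<^sup>2 = 1 + dd Y" "sqrt (cc X) \<le> C" "sqrt (dd Y) \<le> D"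
        using ccdd by (auto simp: C_def D_def)
      \<comment> \<open>The relative errors \<open>2 t\<^sup>2 (1 + 2 \<parallel>c\<parallel>\<^sup>2)\<close> and \<open>2 t\<^sup>2 (1 + 2 \<parallel>d\<parallel>\<^sup>2)\<close> are at most \<open>(2 t C)\<^sup>2\<close> and \<open>(2 t D)\<^sup>2\<close>.\<close>
      define R where "R = sqrt (cc X) * (2 * t * D) + sqrt (dd Y) * (2 * t * C) + (2 * t * C) * (2 * t * D)"
      show ?thesis
      proof (cases "R < cmod (\<Sum>n. c X n * cnj (d Y n))")
        case True
        have "blinfun_apply (b Y) (blinfun_apply q (blinfun_apply S (blinfun_apply p (blinfun_apply (a X) z)))) = 0"
          if S: "S \<in> A" for S z
        proof (rule corner_vanishes[OF x(1) y(1) ann I(2)[OF X] J(2)[OF Y] csum dsum _ _ _ _ _ S])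
          show "sq_norm (\<lambda>n. G (x n - c X n *\<^sub>C \<xi>)) \<le> (2 * t * C)\<^sup>2 * (norm (G \<xi>))\<^sup>2"
            if G: "G \<in> BB" "\<And>z. a X (blinfun_apply G z) = G z" for G
          proof -
            have "2 * t\<^sup>2 * (1 + 2 * cc X) \<le> (2 * t * C)\<^sup>2"
              by (simp add: power_mult_distrib CD(3) distrib_left)
            then have "2 * t\<^sup>2 * (1 + 2 * cc X) * (norm (G \<xi>))\<^sup>2 \<le> (2 * t * C)\<^sup>2 * (norm (G \<xi>))\<^sup>2"
              by (rule mult_right_mono) simp
            then show ?thesis using xc[OF X G] unfolding cc_def by linarith
          qed
          show "sq_norm (\<lambda>n. G (y n - d Y n *\<^sub>C \<eta>)) \<le> (2 * t * D)\<^sup>2 * (norm (G \<eta>))\<^sup>2"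
            if G: "G \<in> BB" "\<And>z. b Y (blinfun_apply G z) = G z" for G
          proof -
            have "2 * t\<^sup>2 * (1 + 2 * dd Y) \<le> (2 * t * D)\<^sup>2"
              by (simp add: power_mult_distrib CD(4) distrib_left)
            then have "2 * t\<^sup>2 * (1 + 2 * dd Y) * (norm (G \<eta>))\<^sup>2 \<le> (2 * t * D)\<^sup>2 * (norm (G \<eta>))\<^sup>2"
              by (rule mult_right_mono) simp
            then show ?thesis using yd[OF Y G] unfolding dd_def by linarith
          qed
        qed (use True CD t in \<open>auto simp: R_def cc_def dd_def\<close>)
        then have "\<Phi> X Y = 0"
          using positive_operator_supported[OF lat T I(2)[OF X] J(2)[OF Y]] by (simp add: \<Phi>_def)
        then show ?thesis by simp
      next
        case False
        have "R \<le> C * (2 * t * D) + D * (2 * t * C) + (2 * t * C) * (1 * D)"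
          unfolding R_def using CD t by (intro add_mono mult_mono) auto
        also have "\<dots> = 3 * t * (2 * C * D)" by simp
        also have "\<dots> \<le> 3 * t * (C\<^sup>2 + D\<^sup>2)" using t by (intro mult_left_mono sum_squares_bound) auto
        finally have "cmod (\<Sum>n. c X n * cnj (d Y n)) \<le> 3 * t * ((1 + cc X) + (1 + dd Y))"
          using False CD by simp
        then show ?thesis using \<Phi>(2)[OF X Y] by (rule mult_right_mono)
      qed
    qed
    obtain B where B: "B \<in> BB" "\<And>z. blinfun_apply B z = (\<Sum>X\<in>I. blinfun_apply (a X) z)"
      using finite_orthogonal_sum[of I a, OF I] by blast
    obtain B' where B': "B' \<in> BB" "\<And>z. blinfun_apply B' z = (\<Sum>Y\<in>J. blinfun_apply (b Y) z)"
      using finite_orthogonal_sum[of J b, OF J] by blast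
    have row: "(\<Sum>Y\<in>J. \<Phi> X Y) \<le> (norm (a X \<xi>))\<^sup>2" if X: "X \<in> I" for X
    proof -
      have "(\<Sum>Y\<in>J. \<Phi> X Y) = Re (cinner (T (a X \<xi>)) (B' \<eta>))"
        by (simp add: \<Phi>_def B'(2) cinner_sum_right)
      also have "\<dots> \<le> Re (cinner (T (a X \<xi>)) \<eta>)"
        using posT(2)[OF I(2)[OF X] compl[OF B'(1)]] by (simp add: blinfun.diff_left cinner_diff_right)
      also have "\<dots> \<le> (norm (a X \<xi>))\<^sup>2" by (rule marg[OF I(2)[OF X]])
      finally show ?thesis .
    qed
    have col: "(\<Sum>X\<in>I. \<Phi> X Y) \<le> (norm (b Y \<eta>))\<^sup>2" if Y: "Y \<in> J" for Y
    proof -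
      have "(\<Sum>X\<in>I. \<Phi> X Y) = Re (cinner (T (B \<xi>)) (b Y \<eta>))"
        by (simp add: \<Phi>_def B(2) cinner_sum_left blinfun.sum_right)
      also have "\<dots> \<le> Re (cinner (T \<xi>) (b Y \<eta>))"
        using posT(2)[OF compl[OF B(1)] J(2)[OF Y]] by (simp add: blinfun.diff_left blinfun.diff_right cinner_diff_left)
      also have "\<dots> \<le> (norm (b Y \<eta>))\<^sup>2" by (rule marg[OF J(2)[OF Y]])
      finally show ?thesis .
    qed
    have main: "cmod (\<Sum>n. cinner (T (xt n)) (yt n)) \<le> t * (3 * ((norm \<xi>)\<^sup>2 + X2) + 3 * ((norm \<eta>)\<^sup>2 + Y2))"
    proof -
      have cds: "summable (\<lambda>n. c X n * cnj (d Y n))" for X Y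
        by (rule summable_finite[of "{..<N}"]) (auto simp: c0)
      have pt: "cinner (T (xt n)) (yt n) = (\<Sum>X\<in>I. \<Sum>Y\<in>J. (c X n * cnj (d Y n)) * complex_of_real (\<Phi> X Y))" for n
        unfolding xt_def blinfun.sum_right cinner_sum_left unfolding yt_def cinner_sum_right
        by (intro sum.cong refl)
          (simp add: bounded_opsD[OF T(1)] cinner_scaleC_left cinner_scaleC_right \<Phi>(1))
      have "(\<Sum>n. cinner (T (xt n)) (yt n)) = (\<Sum>X\<in>I. \<Sum>Y\<in>J. (\<Sum>n. c X n * cnj (d Y n)) * complex_of_real (\<Phi> X Y))"
        unfolding pt by (simp add: suminf_sum summable_sum summable_mult2 cds suminf_mult2[symmetric])
      also have "cmod \<dots> \<le> (\<Sum>X\<in>I. \<Sum>Y\<in>J. cmod (\<Sum>n. c X n * cnj (d Y n)) * \<Phi> X Y)"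
        using \<Phi>(2) by (intro sum_norm_le) (simp add: norm_mult)
      also have "\<dots> \<le> (\<Sum>X\<in>I. \<Sum>Y\<in>J. 3 * t * ((1 + cc X) + (1 + dd Y)) * \<Phi> X Y)"
        by (intro sum_mono entry)
      also have "\<dots> = 3 * t * (\<Sum>X\<in>I. (1 + cc X) * (\<Sum>Y\<in>J. \<Phi> X Y)) + 3 * t * (\<Sum>X\<in>I. \<Sum>Y\<in>J. (1 + dd Y) * \<Phi> X Y)"
        by (simp add: sum_distrib_left sum.distrib[symmetric] algebra_simps)
      also have "(\<Sum>X\<in>I. \<Sum>Y\<in>J. (1 + dd Y) * \<Phi> X Y) = (\<Sum>Y\<in>J. (1 + dd Y) * (\<Sum>X\<in>I. \<Phi> X Y))"
        by (subst sum.swap) (simp add: sum_distrib_left)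
      also have "3 * t * (\<Sum>X\<in>I. (1 + cc X) * (\<Sum>Y\<in>J. \<Phi> X Y)) + 3 * t * \<dots> \<le>
          3 * t * (\<Sum>X\<in>I. (1 + cc X) * (norm (a X \<xi>))\<^sup>2) + 3 * t * (\<Sum>Y\<in>J. (1 + dd Y) * (norm (b Y \<eta>))\<^sup>2)"
        using t ccdd by (intro add_mono mult_left_mono sum_mono row col) auto
      also have "\<dots> \<le> 3 * t * ((norm \<xi>)\<^sup>2 + X2) + 3 * t * ((norm \<eta>)\<^sup>2 + Y2)"
        using t by (intro add_mono mult_left_mono total) auto
      also have "\<dots> = t * (3 * ((norm \<xi>)\<^sup>2 + X2) + 3 * ((norm \<eta>)\<^sup>2 + Y2))" by (simp add: algebra_simps)
      finally show ?thesis .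
    qed
    have dx: "square_summable (\<lambda>n. x n - xt n)" "sq_norm (\<lambda>n. x n - xt n) \<le> (2 * t)\<^sup>2"
      using square_summable_diff(1)[OF x(1) xt] order_trans[OF xt' four] unfolding xt_def by auto
    have dy: "square_summable (\<lambda>n. y n - yt n)" "sq_norm (\<lambda>n. y n - yt n) \<le> (2 * t)\<^sup>2"
      using square_summable_diff(1)[OF y(1) yt] order_trans[OF yt' four] unfolding yt_def by auto
    have Tss: "square_summable (\<lambda>n. T (z n))" "sq_norm (\<lambda>n. T (z n)) \<le> (norm T * k)\<^sup>2"
      if "square_summable z" "sq_norm z \<le> k\<^sup>2" for z k
    proof -
      have "(norm T)\<^sup>2 * sq_norm z \<le> (norm T)\<^sup>2 * k\<^sup>2" using that by (intro mult_left_mono) auto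
      then show "sq_norm (\<lambda>n. T (z n)) \<le> (norm T * k)\<^sup>2"
        using square_summable_apply(2)[OF that(1), of T] by (simp add: power_mult_distrib)
    qed (rule square_summable_apply[OF that(1)])
    have 1: "cmod (\<Sum>n. cinner (T (x n - xt n)) (y n)) \<le> norm T * (2 * t) * sqrt (sq_norm y)"
      using t sq_norm_nonneg[OF y(1)] by (intro cinner_series_bound[OF Tss(1)[OF dx] y(1) Tss(2)[OF dx]]) auto
    have xt2': "sq_norm xt \<le> (sqrt X2)\<^sup>2" using xt2 X20 by simp
    have 2: "cmod (\<Sum>n. cinner (T (xt n)) (y n - yt n)) \<le> norm T * sqrt X2 * (2 * t)"
      using t X20 by (intro cinner_series_bound[OF Tss(1)[OF xt xt2'] dy(1) Tss(2)[OF xt xt2'] dy(2)]) auto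
    have "(\<Sum>n. cinner (T (x n)) (y n)) = (\<Sum>n. cinner (T (x n - xt n) + T (xt n)) (y n))"
      by (simp add: blinfun.diff_right)
    also have "\<dots> = (\<Sum>n. cinner (T (x n - xt n)) (y n)) + (\<Sum>n. cinner (T (xt n)) (y n))"
      by (intro cinner_series_add_left square_summable_apply dx xt y)
    also have "(\<Sum>n. cinner (T (xt n)) (y n)) = (\<Sum>n. cinner (T (xt n)) ((y n - yt n) + yt n))" by simp
    also have "\<dots> = (\<Sum>n. cinner (T (xt n)) (y n - yt n)) + (\<Sum>n. cinner (T (xt n)) (yt n))"
      by (intro cinner_series_add_right square_summable_apply dy xt yt)
    finally have "cmod (\<Sum>n. cinner (T (x n)) (y n)) \<le> cmod (\<Sum>n. cinner (T (x n - xt n)) (y n)) +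
        (cmod (\<Sum>n. cinner (T (xt n)) (y n - yt n)) + cmod (\<Sum>n. cinner (T (xt n)) (yt n)))"
      by (simp only:) (intro order_trans[OF norm_triangle_ineq] add_left_mono norm_triangle_ineq)
    also have "\<dots> \<le> norm T * (2 * t) * sqrt (sq_norm y) + (norm T * sqrt X2 * (2 * t)
        + t * (3 * ((norm \<xi>)\<^sup>2 + X2) + 3 * ((norm \<eta>)\<^sup>2 + Y2)))"
      by (intro add_mono 1 2 main)
    also have "\<dots> = t * K" by (simp add: K_def algebra_simps)
    finally show ?thesis .
  qed
  then have "cmod (\<Sum>n. cinner (T (x n)) (y n)) = 0" by (intro nonneg_zero_if_small[of _ K]) auto
  then show ?thesis by simp
qed

end

end

section \<open>Ultraweakly closed algebras\<close>

definition ultraweak_functional ::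
  "(nat \<Rightarrow> 'a::complex_hilbert_space) \<Rightarrow> (nat \<Rightarrow> 'a) \<Rightarrow> ('a \<Rightarrow>\<^sub>L 'a) \<Rightarrow> complex" where
  "ultraweak_functional x y T = (\<Sum>n. cinner (blinfun_apply T (x n)) (y n))"

definition ultraweak_functionals :: "(('a::complex_hilbert_space \<Rightarrow>\<^sub>L 'a) \<Rightarrow> complex) set" where
  "ultraweak_functionals = {ultraweak_functional x y | x y. square_summable x \<and> square_summable y}"

lemma ultraweak_functional_linear:
  assumes "w \<in> ultraweak_functionals"
  shows "w (S + T) = w S + w T" "w (scale_op k S) = k * w S"
proof -
  obtain x y where w: "w = ultraweak_functional x y" and xy: "square_summable x" "square_summable y"
    using assms unfolding ultraweak_functionals_def by blast
  show "w (S + T) = w S + w T"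
    unfolding w ultraweak_functional_def blinfun.add_left
    by (intro cinner_series_add_left square_summable_apply xy)
  have "summable (\<lambda>n. cinner (S (x n)) (y n))" by (intro cinner_series square_summable_apply xy)
  then show "w (scale_op k S) = k * w S"
    unfolding w ultraweak_functional_def scale_op_apply cinner_scaleC_left by (rule suminf_mult)
qed

text \<open>The sum of two functionals is represented by the interleaved sequences.\<close>

lemma ultraweak_functionals_combination:
  fixes w w' :: "('a::complex_hilbert_space \<Rightarrow>\<^sub>L 'a) \<Rightarrow> complex"
  assumes "w \<in> ultraweak_functionals" "w' \<in> ultraweak_functionals"
  shows "(\<lambda>T. w T + k * w' T) \<in> ultraweak_functionals"
proof -
  obtain x y where w: "w = ultraweak_functional x y" and xy: "square_summable x" "square_summable y"
    using assms unfolding ultraweak_functionals_def by blast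
  obtain x' y' where w': "w' = ultraweak_functional x' y'" and xy': "square_summable x'" "square_summable y'"
    using assms unfolding ultraweak_functionals_def by blast
  have il_sq: "square_summable (\<lambda>n. if even n then f (n div 2) else g ((n - 1) div 2))"
    if "square_summable f" "square_summable g" for f g :: "nat \<Rightarrow> 'a"
  proof -
    have "(\<lambda>n. if even n then (norm (f (n div 2)))\<^sup>2 else (norm (g ((n - 1) div 2)))\<^sup>2) sums (sq_norm g + sq_norm f)"
      using that unfolding square_summable_def sq_norm_def by (intro sums_if summable_sums)
    then show ?thesis unfolding square_summable_def
      by (rule sums_summable[THEN iffD1[OF summable_cong, rotated]]) (auto intro: always_eventually)
  qed
  define u where "u n = (if even n then x (n div 2) else x' ((n - 1) div 2))" for n
  define v where "v n = (if even n then y (n div 2) else cnj k *\<^sub>C y' ((n - 1) div 2))" for n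
  have ky': "square_summable (\<lambda>n. cnj k *\<^sub>C y' n)"
    using xy'(2) by (rule square_summable_dominated[where C = "cmod k"]) (simp add: norm_scaleC)
  have uv: "square_summable u" "square_summable v"
    unfolding u_def v_def using xy xy' ky' il_sq by auto
  have mem: "ultraweak_functional u v \<in> ultraweak_functionals"
    using uv unfolding ultraweak_functionals_def by blast
  have eq: "w T + k * w' T = ultraweak_functional u v T" for T
  proof -
    have "(\<lambda>n. cinner (T (u n)) (v n)) sums ultraweak_functional u v T"
      unfolding ultraweak_functional_def using uv by (intro summable_sums cinner_series square_summable_apply)
    then have "(\<lambda>n. \<Sum>i\<in>{n * 2..<n * 2 + 2}. cinner (T (u i)) (v i)) sums ultraweak_functional u v T"
      by (rule sums_group) simp
    moreover have "(\<Sum>i\<in>{n * 2..<n * 2 + 2}. cinner (T (u i)) (v i))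
        = cinner (T (x n)) (y n) + k * cinner (T (x' n)) (y' n)" for n
    proof -
      have "{n * 2..<n * 2 + 2} = {n * 2, Suc (n * 2)}" by auto
      then show ?thesis by (simp add: u_def v_def cinner_scaleC_right)
    qed
    ultimately have "(\<lambda>n. cinner (T (x n)) (y n) + k * cinner (T (x' n)) (y' n)) sums ultraweak_functional u v T"
      by simp
    moreover have "(\<lambda>n. cinner (T (x n)) (y n) + k * cinner (T (x' n)) (y' n)) sums (w T + k * w' T)"
      unfolding w w' ultraweak_functional_def
      by (intro sums_add sums_mult summable_sums cinner_series square_summable_apply xy xy')
    ultimately show ?thesis by (metis sums_unique2)
  qed
  from ext[OF eq] have "(\<lambda>T. w T + k * w' T) = ultraweak_functional u v" .
  with mem show ?thesis by simp
qed

text \<open>Gaussian elimination: a functional that vanishes on \<open>A\<close> imposes no condition, and any other one is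
  used to correct \<open>T\<close> by a multiple of an element of \<open>A\<close> and to pass to its kernel in \<open>A\<close>.\<close>

lemma finite_interpolation:
  fixes T :: "'a::complex_hilbert_space \<Rightarrow>\<^sub>L 'a"
  assumes "finite K" "K \<subseteq> ultraweak_functionals"
    and "\<And>S S'. S \<in> A \<Longrightarrow> S' \<in> A \<Longrightarrow> S + S' \<in> A" "\<And>c S. S \<in> A \<Longrightarrow> scale_op c S \<in> A" "0 \<in> A"
    and "\<And>w. w \<in> ultraweak_functionals \<Longrightarrow> (\<And>S. S \<in> A \<Longrightarrow> w S = 0) \<Longrightarrow> w T = 0"
  shows "\<exists>S\<in>A. \<forall>w\<in>K. w S = w T"
  using assms
proof (induction K arbitrary: A T rule: finite_induct)
  case empty
  then show ?case by auto
next
  case (insert f K)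
  note lin = ultraweak_functional_linear
  have f: "f \<in> ultraweak_functionals" and K: "K \<subseteq> ultraweak_functionals" using insert.prems(1) by auto
  show ?case
  proof (cases "\<forall>S\<in>A. f S = 0")
    case True
    then have "f T = 0" using insert.prems(5)[OF f] by blast
    moreover have "\<exists>S\<in>A. \<forall>w\<in>K. w S = w T"
      by (rule insert.IH[OF K]) (use insert.prems in auto)
    ultimately show ?thesis using True by auto
  next
    case False
    then obtain S0 where S0: "S0 \<in> A" "f S0 \<noteq> 0" by blast
    define S1 where "S1 = scale_op (1 / f S0) S0"
    have S1: "S1 \<in> A" "f S1 = 1" using S0 insert.prems(3) by (auto simp: S1_def lin[OF f])
    define A' where "A' = {S \<in> A. f S = 0}"
    define T' where "T' = T + scale_op (- f T) S1"
    have fT': "f T' = 0" by (simp add: T'_def lin[OF f] S1)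
    have "\<exists>S\<in>A'. \<forall>w\<in>K. w S = w T'"
    proof (rule insert.IH[OF K])
      show "S + S' \<in> A'" if "S \<in> A'" "S' \<in> A'" for S S'
        using that insert.prems(2) by (auto simp: A'_def lin[OF f])
      show "scale_op c S \<in> A'" if "S \<in> A'" for c S
        using that insert.prems(3) by (auto simp: A'_def lin[OF f])
      have "f 0 = f 0 + f 0" using lin(1)[OF f, of 0 0] by simp
      then show "0 \<in> A'" using insert.prems(4) by (auto simp: A'_def)
      fix w assume w: "w \<in> ultraweak_functionals" and wA': "\<And>S. S \<in> A' \<Longrightarrow> w S = 0"
      let ?v = "\<lambda>S. w S + (- w S1) * f S"
      have v: "?v \<in> ultraweak_functionals" by (rule ultraweak_functionals_combination[OF w f])
      have vA: "?v S = 0" if "S \<in> A" for S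
      proof -
        have "S + scale_op (- f S) S1 \<in> A'"
          using that S1 insert.prems(2,3) by (auto simp: A'_def lin[OF f])
        then have "w (S + scale_op (- f S) S1) = 0" by (rule wA')
        then show ?thesis by (simp add: lin[OF w] mult.commute)
      qed
      have "?v T = 0" using insert.prems(5)[OF v vA] by simp
      then show "w T' = 0" by (simp add: T'_def lin[OF w] mult.commute)
    qed
    then obtain S where S: "S \<in> A" "f S = 0" "\<And>w. w \<in> K \<Longrightarrow> w S = w T'" unfolding A'_def by blast
    let ?S = "S + scale_op (f T) S1"
    have "w ?S = w T" if "w \<in> K" for w
    proof -
      have "w \<in> ultraweak_functionals" using that K by blast
      from lin[OF this] show ?thesis using S(3)[OF that] by (simp add: T'_def)
    qed
    moreover have "f ?S = f T" by (simp add: lin[OF f] S S1)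
    moreover have "?S \<in> A" using S S1 insert.prems(2,3) by auto
    ultimately show ?thesis by auto
  qed
qed

lemma ultraweak_open_determined:
  assumes "openin ultraweak_topology U" "T \<in> U"
  shows "\<exists>K. finite K \<and> K \<subseteq> ultraweak_functionals \<and> (\<forall>S\<in>bounded_ops. (\<forall>w\<in>K. w S = w T) \<longrightarrow> S \<in> U)"
proof -
  have "generate_topology_on {{T \<in> bounded_ops. (\<Sum>n. cinner (T (x n)) (y n)) \<in> U} | x y U.
        square_summable x \<and> square_summable y \<and> open U} U"
    using assms(1) unfolding ultraweak_topology_def by (rule openin_topology_generated_by)
  then show ?thesis using assms(2)
  proof (induction rule: generate_topology_on.induct)
    case (Int a b)
    then obtain K K' where "finite K" "K \<subseteq> ultraweak_functionals" "\<forall>S\<in>bounded_ops. (\<forall>w\<in>K. w S = w T) \<longrightarrow> S \<in> a"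
      "finite K'" "K' \<subseteq> ultraweak_functionals" "\<forall>S\<in>bounded_ops. (\<forall>w\<in>K'. w S = w T) \<longrightarrow> S \<in> b" by auto
    then show ?case by (intro exI[of _ "K \<union> K'"]) auto
  next
    case (UN \<U>)
    then obtain k where k: "k \<in> \<U>" "T \<in> k" by blast
    from UN.IH[OF this] show ?case using k(1) by blast
  next
    case (Basis s)
    then obtain x y V where s: "s = {T \<in> bounded_ops. ultraweak_functional x y T \<in> V}"
      and xy: "square_summable x" "square_summable y" unfolding ultraweak_functional_def by blast
    then have "ultraweak_functional x y \<in> ultraweak_functionals" unfolding ultraweak_functionals_def by blast
    then show ?case using Basis.prems s by (intro exI[of _ "{ultraweak_functional x y}"]) auto
  qed simp
qed

lemma openin_ultraweak_entry:
  fixes x y :: "'a::complex_hilbert_space"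
  assumes U: "open U"
  shows "openin ultraweak_topology {T \<in> bounded_ops. cinner (blinfun_apply T x) y \<in> U}"
  unfolding ultraweak_topology_def
proof (rule topology_generated_by_Basis)
  let ?single = "\<lambda>x n. if n = (0::nat) then x else 0"
  have ss: "square_summable (?single x)" for x :: 'a
    by (rule square_summable_finite_support[of 1]) auto
  have val: "(\<Sum>n. cinner (blinfun_apply T (?single x n)) (?single y n)) = cinner (T x) y" for T :: "'a \<Rightarrow>\<^sub>L 'a"
    by (subst suminf_finite[of "{0}"]) auto
  have eq: "{T \<in> bounded_ops. cinner (blinfun_apply T x) y \<in> U} =
      {T \<in> bounded_ops. (\<Sum>n. cinner (blinfun_apply T (?single x n)) (?single y n)) \<in> U}" by (simp only: val)
  show "{T \<in> bounded_ops. cinner (blinfun_apply T x) y \<in> U} \<in>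
      {{T \<in> bounded_ops. (\<Sum>n. cinner (blinfun_apply T (x n)) (y n)) \<in> U} | x y U.
        square_summable x \<and> square_summable y \<and> open U}"
    unfolding eq by (intro CollectI exI[of _ "?single x"] exI[of _ "?single y"] exI[of _ U] conjI refl ss U)
qed

lemma topspace_ultraweak: "topspace ultraweak_topology = (bounded_ops :: ('a::complex_hilbert_space \<Rightarrow>\<^sub>L 'a) set)"
proof
  show "topspace ultraweak_topology \<subseteq> (bounded_ops :: ('a \<Rightarrow>\<^sub>L 'a) set)"
    unfolding ultraweak_topology_def topology_generated_by_topspace by blast
  show "(bounded_ops :: ('a \<Rightarrow>\<^sub>L 'a) set) \<subseteq> topspace ultraweak_topology"
    using openin_subset[OF openin_ultraweak_entry[of UNIV 0 0]] by simp
qed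

text \<open>A neighbourhood of \<open>T\<close> contains every operator that agrees with \<open>T\<close> on suitable finitely many functionals. If
  \<open>T\<close> is killed by the functionals that annihilate \<open>A\<close>, some element of \<open>A\<close> is among these operators.\<close>

lemma ultraweak_bipolar:
  assumes A: "operator_algebra A" "closedin ultraweak_topology A" and T: "T \<in> bounded_ops"
    and ann: "\<And>x y. square_summable x \<Longrightarrow> square_summable y \<Longrightarrow>
      (\<And>S. S \<in> A \<Longrightarrow> (\<Sum>n. cinner (blinfun_apply S (x n)) (y n)) = 0) \<Longrightarrow> (\<Sum>n. cinner (blinfun_apply T (x n)) (y n)) = 0"
  shows "T \<in> A"
proof (rule ccontr)
  assume "T \<notin> A"
  have "T \<in> topspace ultraweak_topology" using T unfolding topspace_ultraweak .
  then have TA: "T \<in> topspace ultraweak_topology - A" using \<open>T \<notin> A\<close> by blast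
  have "openin ultraweak_topology (topspace ultraweak_topology - A)"
    using A(2) by (simp add: openin_diff)
  from ultraweak_open_determined[OF this TA] obtain K where K: "finite K" "K \<subseteq> ultraweak_functionals"
    "\<forall>S\<in>bounded_ops. (\<forall>w\<in>K. w S = w T) \<longrightarrow> S \<in> topspace ultraweak_topology - A"
    by (elim exE conjE)
  have "\<exists>S\<in>A. \<forall>w\<in>K. w S = w T"
  proof (rule finite_interpolation[OF K(1,2)])
    fix w assume "w \<in> ultraweak_functionals" "\<And>S. S \<in> A \<Longrightarrow> w S = 0"
    then show "w T = 0" using ann unfolding ultraweak_functionals_def ultraweak_functional_def by auto
  qed (use A(1) in \<open>auto simp: operator_algebra_def\<close>)
  then show False using K(3) operator_algebra_bounded[OF A(1)] by blast
qed

definition alg :: "('a::complex_hilbert_space \<Rightarrow>\<^sub>L 'a) set \<Rightarrow> ('a \<Rightarrow>\<^sub>L 'a) set" where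
  "alg L = {T \<in> bounded_ops. \<forall>P\<in>L. \<forall>x. blinfun_apply P (blinfun_apply T (blinfun_apply P x)) = T (P x)}"

lemma ultraweak_closed_alg:
  assumes L: "L \<subseteq> projections" shows "closedin ultraweak_topology (alg L)"
proof -
  have eq: "bounded_ops - alg L = (\<Union>P\<in>L. \<Union>x. \<Union>y.
    {T \<in> bounded_ops. cinner (blinfun_apply T (blinfun_apply P x)) (y - blinfun_apply P y) \<in> - {0}})"
  proof -
    have "P (T (P x)) = T (P x) \<longleftrightarrow> (\<forall>y. cinner (T (P x)) (y - P y) = 0)" if "P \<in> L" for P T and x :: 'a
    proof -
      have P: "P \<in> projections" using that L by blast
      have "cinner (T (P x)) (y - P y) = cinner (T (P x)) y - cinner (P (T (P x))) y" for y
        by (simp add: cinner_diff_right projectionsD[OF P])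
      then show ?thesis using cinner_ext[of "T (P x)" "P (T (P x))"] by auto
    qed
    then show ?thesis unfolding alg_def by auto
  qed
  have "openin ultraweak_topology (bounded_ops - alg L)"
    unfolding eq
  proof (rule openin_Union)
    fix U assume "U \<in> (\<lambda>P. \<Union>x. \<Union>y. {T \<in> bounded_ops. cinner (blinfun_apply T (blinfun_apply P x)) (y - blinfun_apply P y) \<in> - {0}}) ` L"
    then obtain P where U: "U = (\<Union>x. \<Union>y. {T \<in> bounded_ops. cinner (blinfun_apply T (blinfun_apply P x)) (y - blinfun_apply P y) \<in> - {0}})"
      by blast
    have "openin ultraweak_topology (\<Union>y. {T \<in> bounded_ops. cinner (blinfun_apply T (blinfun_apply P x)) (y - blinfun_apply P y) \<in> - {0}})" for x
    proof (rule openin_Union)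
      fix V assume "V \<in> range (\<lambda>y. {T \<in> bounded_ops. cinner (blinfun_apply T (blinfun_apply P x)) (y - blinfun_apply P y) \<in> - {0}})"
      then obtain y where V: "V = {T \<in> bounded_ops. cinner (blinfun_apply T (blinfun_apply P x)) (y - blinfun_apply P y) \<in> - {0}}" ..
      show "openin ultraweak_topology V" unfolding V by (rule openin_ultraweak_entry) auto
    qed
    then show "openin ultraweak_topology U" unfolding U by (intro openin_Union) blast
  qed
  moreover have "alg L \<subseteq> bounded_ops" unfolding alg_def by blast
  ultimately show ?thesis unfolding closedin_def topspace_ultraweak by blast
qed

lemma operator_algebra_alg:
  assumes "L \<subseteq> projections" shows "operator_algebra (alg L)"
proof -
  have "P (c *\<^sub>C x) = c *\<^sub>C P x" if "P \<in> L" for P c and x :: 'a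
    using that assms projectionsD(1) bounded_opsD by blast
  moreover have "P (S (T (P x))) = S (T (P x))" if "P \<in> L" "S \<in> alg L" "T \<in> alg L" for P S T and x :: 'a
  proof -
    have "P (T (P x)) = T (P x)" "P (S (P (T (P x)))) = S (P (T (P x)))"
      using that unfolding alg_def by blast+
    then show ?thesis by simp
  qed
  ultimately show ?thesis
    unfolding operator_algebra_def
    by (auto simp: alg_def blinfun.add_left blinfun.add_right scale_op_apply bounded_ops_blinfun_arith)
qed

lemma commutant_subset_alg:
  assumes "L \<subseteq> projections" shows "commutant L \<subseteq> alg L"
proof
  fix T assume T: "T \<in> commutant L"
  have "P (T (P x)) = T (P x)" if "P \<in> L" for P x
    using commutantD(2)[OF T that, of "P x"] projectionsD(2) assms that by (metis subsetD)
  then show "T \<in> alg L" unfolding alg_def using commutantD(1)[OF T] by blast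
qed

section \<open>Commutative subspace lattices\<close>

lemma strong_closed_approximation:
  fixes P :: "'a::complex_hilbert_space \<Rightarrow>\<^sub>L 'a"
  assumes L: "closedin (subtopology strong_operator_topology bounded_ops) L" and P: "P \<in> bounded_ops"
    and approx: "\<And>Z e. finite Z \<Longrightarrow> e > 0 \<Longrightarrow> \<exists>E\<in>L. \<forall>z\<in>Z. norm (blinfun_apply E z - P z) < e"
  shows "P \<in> L"
proof (rule ccontr)
  assume "P \<notin> L"
  obtain C where C: "closedin strong_operator_topology C" "L = C \<inter> bounded_ops"
    using L unfolding closedin_subtopology by blast
  have "openin strong_operator_topology (- C)"
    using C(1) unfolding closedin_def strong_operator_topology_topspace by (simp add: Compl_eq_Diff_UNIV)
  then obtain U where U: "open U" "- C = blinfun_apply -` U"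
    unfolding strong_operator_topology_def openin_pullback_topology by auto
  have "blinfun_apply P \<in> U" using U(2) C(2) P \<open>P \<notin> L\<close> by blast
  then obtain X where X: "blinfun_apply P \<in> (\<Pi>\<^sub>E i\<in>UNIV. X i)" "\<And>i. open (X i)" "finite {i. X i \<noteq> UNIV}"
    "(\<Pi>\<^sub>E i\<in>UNIV. X i) \<subseteq> U"
    using product_topology_open_contains_basis[of "\<lambda>_. euclidean" UNIV U "blinfun_apply P"] U(1)
    by (auto simp: euclidean_product_topology)
  define Z where "Z = {i. X i \<noteq> UNIV}"
  have "\<exists>e>0. \<forall>w. norm (w - P z) < e \<longrightarrow> w \<in> X z" for z
  proof -
    have "P z \<in> X z" using X(1) by auto
    then show ?thesis using X(2)[of z] unfolding open_dist dist_norm by blast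
  qed
  then obtain e where e: "\<And>z. e z > 0" "\<And>z w. norm (w - P z) < e z \<Longrightarrow> w \<in> X z" by metis
  define d where "d = Min (insert 1 (e ` Z))"
  have d: "d > 0" "\<And>z. z \<in> Z \<Longrightarrow> d \<le> e z" using X(3) e(1) unfolding d_def Z_def by auto
  obtain E where E: "E \<in> L" "\<And>z. z \<in> Z \<Longrightarrow> norm (blinfun_apply E z - P z) < d"
    using approx[of Z d] X(3) d(1) unfolding Z_def by blast
  have "blinfun_apply E z \<in> X z" for z
  proof (cases "z \<in> Z")
    case True
    then show ?thesis using e(2) E(2) d(2) by fastforce
  qed (simp add: Z_def)
  then have "blinfun_apply E \<in> U" using X(4) by auto
  then show False using U(2) E(1) C(2) by blast
qed

text \<open>For \<open>n \<le> m\<close> Pythagoras gives \<open>\<parallel>E\<^sub>m x - E\<^sub>n x\<parallel>\<^sup>2 = \<parallel>E\<^sub>m x\<parallel>\<^sup>2 - \<parallel>E\<^sub>n x\<parallel>\<^sup>2\<close>, a difference of members of a bounded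
  monotone sequence.\<close>

lemma increasing_projections_limit:
  fixes Es :: "nat \<Rightarrow> 'a::complex_hilbert_space \<Rightarrow>\<^sub>L 'a"
  assumes E: "\<And>n. Es n \<in> projections"
    and inc: "\<And>n x. blinfun_apply (Es n) (blinfun_apply (Es (Suc n)) x) = Es n x"
  obtains G where "G \<in> projections" "\<And>x. (\<lambda>n. blinfun_apply (Es n) x) \<longlonglongrightarrow> G x"
proof -
  have le: "Es n (Es m x) = Es n x" if "n \<le> m" for n m x
    using that
  proof (induction m arbitrary: x rule: dec_induct)
    case base
    show ?case using projectionsD(2)[OF E] .
  next
    case (step m)
    have "Es n (Es (Suc m) x) = Es n (Es m (Es (Suc m) x))" by (rule step.IH[symmetric])
    then show ?case using step.IH inc by simp
  qed
  have dist: "(norm (Es m x - Es n x))\<^sup>2 = (norm (Es m x))\<^sup>2 - (norm (Es n x))\<^sup>2" if "n \<le> m" for n m x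
    using norm_projection_split[OF E, of n "Es m x"] le[OF that, of x] by simp
  have conv: "convergent (\<lambda>n. blinfun_apply (Es n) x)" for x
  proof -
    let ?a = "\<lambda>n. (norm (Es n x))\<^sup>2"
    have inc: "incseq ?a"
    proof (rule incseq_SucI)
      show "?a n \<le> ?a (Suc n)" for n using dist[of n "Suc n" x] zero_le_power2[of "norm (Es (Suc n) x - Es n x)"] by simp
    qed
    have bd: "\<forall>n. ?a n \<le> (norm x)\<^sup>2" by (intro allI power_mono norm_projection_le E) auto
    obtain l where "?a \<longlonglongrightarrow> l" using incseq_convergent[OF inc bd] by metis
    then have "Cauchy ?a" by (rule LIMSEQ_imp_Cauchy)
    have "Cauchy (\<lambda>n. Es n x)"
    proof (rule metric_CauchyI)
      fix e :: real assume e: "e > 0"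
      then have "e\<^sup>2 > 0" by simp
      then obtain N where N: "\<And>m n. m \<ge> N \<Longrightarrow> n \<ge> N \<Longrightarrow> dist (?a m) (?a n) < e\<^sup>2"
        using \<open>Cauchy ?a\<close> unfolding Cauchy_def by metis
      have *: "dist (Es m x) (Es n x) < e" if "N \<le> n" "n \<le> m" for m n
      proof -
        have "(norm (Es m x - Es n x))\<^sup>2 < e\<^sup>2"
          using N[of m n] that dist[OF that(2), of x] by (auto simp: dist_real_def)
        then show ?thesis using e by (simp add: dist_norm power_less_imp_less_base)
      qed
      then have "dist (Es m x) (Es n x) < e" if "m \<ge> N" "n \<ge> N" for m n
        using that by (metis dist_commute linear)
      then show "\<exists>M. \<forall>m\<ge>M. \<forall>n\<ge>M. dist (Es m x) (Es n x) < e" by blast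
    qed
    then show ?thesis by (rule Cauchy_convergent)
  qed
  define g where "g x = lim (\<lambda>n. Es n x)" for x
  have g: "(\<lambda>n. blinfun_apply (Es n) x) \<longlonglongrightarrow> g x" for x
    unfolding g_def using conv by (simp add: convergent_LIMSEQ_iff)
  have bl: "bounded_linear g"
  proof (rule bounded_linear_intro[where K = 1])
    show "g (x + y) = g x + g y" for x y
      using tendsto_add[OF g[of x] g[of y]] g[of "x + y"] LIMSEQ_unique by (auto simp: blinfun.add_right)
    show "g (r *\<^sub>R x) = r *\<^sub>R g x" for r x
      using tendsto_scaleR[OF tendsto_const g[of x], of r] g[of "r *\<^sub>R x"] LIMSEQ_unique
      by (auto simp: blinfun.scaleR_right)
    show "norm (g x) \<le> norm x * 1" for x
      using tendsto_norm[OF g[of x]] norm_projection_le[OF E] by (intro LIMSEQ_le_const2[of _ _ "norm x * 1"]) auto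
  qed
  define G where "G = Blinfun g"
  have G: "blinfun_apply G x = g x" for x unfolding G_def using bl by (simp add: bounded_linear_Blinfun_apply)
  have "g (c *\<^sub>C x) = c *\<^sub>C g x" for c x
  proof -
    have "(\<lambda>n. c *\<^sub>C Es n x) \<longlonglongrightarrow> c *\<^sub>C g x"
      using continuous_on_scaleC[of UNIV c] g[of x] by (auto intro: continuous_on_tendsto_compose)
    then show ?thesis using g[of "c *\<^sub>C x"] LIMSEQ_unique bounded_opsD[OF projectionsD(1)[OF E]] by auto
  qed
  moreover have "g (g x) = g x" for x
  proof -
    have "Es n (g x) = Es n x" for n
    proof -
      have "(\<lambda>m. Es n (Es m x)) \<longlonglongrightarrow> Es n (g x)" by (intro blinfun.tendsto tendsto_const g)
      moreover have "(\<lambda>m. Es n (Es m x)) \<longlonglongrightarrow> Es n x"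
        by (rule tendsto_eventually) (use le eventually_ge_at_top in \<open>auto simp: eventually_sequentially\<close>)
      ultimately show ?thesis by (rule LIMSEQ_unique)
    qed
    then show ?thesis using g[of "g x"] g[of x] LIMSEQ_unique by auto
  qed
  moreover have "cinner (g x) y = cinner x (g y)" for x y
    using tendsto_cinner_left[OF g[of x], of y] tendsto_cinner_right[OF g[of y], of x] LIMSEQ_unique
    by (auto simp: projectionsD[OF E])
  ultimately have "G \<in> projections"
    unfolding projections_def bounded_ops_def by (auto simp: G intro: blinfun_eqI)
  then show thesis using that g by (simp add: G)
qed

text \<open>Commutation with a fixed operator passes to strong limits, so the projections of the von Neumann
  algebra \<open>L''\<close> form a complete Boolean algebra; \<open>L''\<close> is contained in \<open>L'\<close> because \<open>L\<close> is commutative.\<close>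

lemma bicommutant_projections_complete:
  fixes L :: "('a::complex_hilbert_space \<Rightarrow>\<^sub>L 'a) set"
  assumes L: "L \<subseteq> projections" and comm: "\<And>P Q. P \<in> L \<Longrightarrow> Q \<in> L \<Longrightarrow> P o\<^sub>L Q = Q o\<^sub>L P"
  defines "BB \<equiv> projections \<inter> commutant (commutant L)"
  shows "boolean_projections BB" "L \<subseteq> BB" "BB \<subseteq> commutant L"
proof -
  have Lc: "L \<subseteq> commutant L"
    unfolding commutant_def using comm L projectionsD(1) by blast
  show BBc: "BB \<subseteq> commutant L"
  proof
    fix T assume "T \<in> BB"
    then have T: "T \<in> commutant (commutant L)" unfolding BB_def by blast
    show "T \<in> commutant L" by (rule commutantI) (use commutantD[OF T] Lc in auto)
  qed
  show LB: "L \<subseteq> BB"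
  proof
    fix P assume P: "P \<in> L"
    then have "P \<in> projections" using L by blast
    moreover have "P \<in> commutant (commutant L)"
      by (rule commutantI) (use projectionsD(1)[OF calculation] commutantD(2) P in fastforce)+
    ultimately show "P \<in> BB" unfolding BB_def by blast
  qed
  have commute: "blinfun_apply E (blinfun_apply F x) = F (E x)" if "E \<in> BB" "F \<in> BB" for E F x
  proof -
    have "E \<in> commutant (commutant L)" "F \<in> commutant L" using that BBc unfolding BB_def by auto
    then show ?thesis by (rule commutantD(2))
  qed
  have "commutant L \<subseteq> bounded_ops" unfolding commutant_def by blast
  note alg'' = operator_algebra_commutant[OF this]
  show "boolean_projections BB"
  proof
    show "E \<in> projections" if "E \<in> BB" for E using that unfolding BB_def by blast
    show "blinfun_apply E (blinfun_apply F x) = F (E x)" if "E \<in> BB" "F \<in> BB" for E F x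
      using that by (rule commute)
    show one: "id_blinfun \<in> BB" unfolding BB_def
      by (auto simp: projections_def id_in_commutant intro: bounded_ops_blinfun_arith blinfun_eqI)
    show "E o\<^sub>L F \<in> BB" if "E \<in> BB" "F \<in> BB" for E F
      using that projections_compose[of E F] commute operator_algebra_compose[OF alg''] unfolding BB_def by blast
    show "id_blinfun - E \<in> BB" if "E \<in> BB" for E
    proof -
      have Ec: "E \<in> commutant (commutant L)" and Ep: "E \<in> projections" using that unfolding BB_def by auto
      have "id_blinfun - E \<in> commutant (commutant L)"
        by (rule commutantI)
          (auto simp: blinfun.diff_left blinfun.diff_right commutantD(2)[OF Ec] intro: bounded_ops_blinfun_arith commutantD(1)[OF Ec])
      then show ?thesis unfolding BB_def using projections_id_minus[OF Ep] by blast
    qed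
    fix Es assume Es: "\<And>n. Es n \<in> BB"
      and inc: "\<And>n x. blinfun_apply (Es n) (blinfun_apply (Es (Suc n)) x) = Es n x"
    obtain G where G: "G \<in> projections" "\<And>x. (\<lambda>n. blinfun_apply (Es n) x) \<longlonglongrightarrow> G x"
      using increasing_projections_limit[of Es] Es inc unfolding BB_def by blast
    have "G \<in> commutant (commutant L)"
    proof (rule commutantI)
      show "G \<in> bounded_ops" using G(1) by (rule projectionsD)
      fix T x assume T: "T \<in> commutant L"
      have "Es n (T x) = T (Es n x)" for n
        using Es[of n] commutantD(2)[OF _ T] unfolding BB_def by blast
      then have "(\<lambda>n. T (Es n x)) \<longlonglongrightarrow> G (T x)" using G(2)[of "T x"] by simp
      moreover have "(\<lambda>n. T (Es n x)) \<longlonglongrightarrow> T (G x)" by (intro blinfun.tendsto tendsto_const G)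
      ultimately show "G (T x) = T (G x)" by (rule LIMSEQ_unique)
    qed
    then show "\<exists>G\<in>BB. \<forall>x. (\<lambda>n. blinfun_apply (Es n) x) \<longlonglongrightarrow> G x" using G unfolding BB_def by blast
  qed
qed

text \<open>The lattice operations are given through ranges; for commuting projections the meet is \<open>P Q\<close> and the
  join is \<open>P + Q - P Q\<close>.\<close>

lemma csl_projection_sublattice:
  fixes L :: "('a::complex_hilbert_space \<Rightarrow>\<^sub>L 'a) set"
  assumes csl: "commutative_subspace_lattice L"
  shows "projection_sublattice (projections \<inter> commutant (commutant L)) L"
proof -
  have lat: "projection_lattice L" and L: "L \<subseteq> projections"
    and comm: "\<And>P Q. P \<in> L \<Longrightarrow> Q \<in> L \<Longrightarrow> P o\<^sub>L Q = Q o\<^sub>L P" and zo: "0 \<in> L" "id_blinfun \<in> L"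
    using csl unfolding commutative_subspace_lattice_def projection_lattice_def by auto
  define BB where "BB = projections \<inter> commutant (commutant L)"
  note bc = bicommutant_projections_complete[OF L comm, folded BB_def]
  interpret boolean_projections BB by (rule bc)
  have LB: "P \<in> BB" if "P \<in> L" for P using bc(2) that by blast
  have "projection_sublattice BB L"
  proof
    show "E \<in> BB" if "E \<in> L" for E using that by (rule LB)
    show "0 \<in> L" "id_blinfun \<in> L" by (rule zo)+
  next
    fix P Q assume P: "P \<in> L" and Q: "Q \<in> L"
    note PB = LB[OF P] note QB = LB[OF Q]
    obtain R where R: "R \<in> L" "range (blinfun_apply R) = range (blinfun_apply P) \<inter> range (blinfun_apply Q)"
      using lat P Q unfolding projection_lattice_def by blast
    have Riff: "R x = x \<longleftrightarrow> P x = x \<and> Q x = x" for x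
      unfolding range_projection_iff[OF proj[OF LB[OF R(1)]], symmetric] range_projection_iff[OF proj[OF PB], symmetric]
        range_projection_iff[OF proj[OF QB], symmetric] R(2) by (rule Int_iff)
    have "P o\<^sub>L Q = R"
    proof (rule projection_eqI[OF proj[OF inter[OF PB QB]] proj[OF LB[OF R(1)]]])
      show "(P o\<^sub>L Q) x = x" if "R x = x" for x using that Riff by simp
      show "R x = x" if "(P o\<^sub>L Q) x = x" for x
      proof -
        have x: "P (Q x) = x" using that by simp
        have "P x = x" using idem[OF PB, of "Q x"] unfolding x .
        moreover have "Q x = x" using idem[OF QB, of "P x"] commute[OF PB QB, of x] x by simp
        ultimately show ?thesis unfolding Riff by blast
      qed
    qed
    then show "P o\<^sub>L Q \<in> L" using R(1) by simp
    obtain R where R: "R \<in> L" "range (blinfun_apply R) = closure {P x + Q y | x y. True}"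
      using lat P Q unfolding projection_lattice_def by blast
    let ?J = "P + Q - (P o\<^sub>L Q)"
    have J: "?J x = P x + Q x - P (Q x)" for x by (simp add: blinfun.add_left blinfun.diff_left)
    have Jeq: "?J = id_blinfun - ((id_blinfun - P) o\<^sub>L (id_blinfun - Q))"
      by (rule blinfun_eqI) (simp add: blinfun.add_left blinfun.diff_left blinfun.diff_right)
    have JB: "?J \<in> BB" unfolding Jeq by (intro compl inter PB QB)
    have Riff: "R x = x \<longleftrightarrow> x \<in> closure {P x + Q y | x y. True}" for x
      unfolding range_projection_iff[OF proj[OF LB[OF R(1)]], symmetric] R(2) by (rule refl)
    have "?J = R"
    proof (rule projection_eqI[OF proj[OF JB] proj[OF LB[OF R(1)]]])
      fix x assume "R x = x"
      moreover have "closed {x. ?J x = x}"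
        by (intro closed_Collect_eq continuous_intros linear_continuous_on blinfun.bounded_linear_right)
      moreover have "{P x + Q y | x y. True} \<subseteq> {x. ?J x = x}"
        unfolding J using commute[OF PB QB] PB QB by (auto simp: blinfun.add_right)
      ultimately show "?J x = x" unfolding Riff using closure_minimal by blast
    next
      fix x assume "?J x = x"
      then have x: "P x + Q (x - P x) = x" unfolding J commute[OF PB QB] by (simp add: blinfun.diff_right add_diff_eq)
      have "P x + Q (x - P x) \<in> {P x + Q y | x y. True}" by blast
      then have "P x + Q (x - P x) \<in> closure {P x + Q y | x y. True}" by (rule closure_subset[THEN subsetD])
      then show "R x = x" unfolding Riff x .
    qed
    then show "?J \<in> L" using R(1) by simp
  qed
  then show ?thesis unfolding BB_def .
qed

context projection_sublattice
begin

text \<open>If every pair of a vector in the range and a vector in the kernel of \<open>P\<close> can be separated, finite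
  meets and joins separate finitely many pairs at once, so \<open>P\<close> is in the strong closure of \<open>L\<close>.\<close>

lemma inseparable_pair_exists:
  assumes closed: "closedin (subtopology strong_operator_topology bounded_ops) L"
    and P: "P \<in> BB" "P \<notin> L"
  obtains \<xi> \<eta> \<delta> where "P \<xi> = \<xi>" "P \<eta> = 0" "inseparable \<xi> \<eta> \<delta>"
proof (rule ccontr)
  assume "\<not> thesis"
  then have sep: "\<exists>E\<in>L. (norm (\<xi> - blinfun_apply E \<xi>))\<^sup>2 + (norm (blinfun_apply E \<eta>))\<^sup>2 < \<delta>"
    if "P \<xi> = \<xi>" "P \<eta> = 0" "\<delta> > 0" for \<xi> \<eta> \<delta>
    using that that(3) \<open>\<not> thesis\<close> \<open>\<And>\<xi> \<eta> \<delta>. P \<xi> = \<xi> \<Longrightarrow> P \<eta> = 0 \<Longrightarrow> inseparable \<xi> \<eta> \<delta> \<Longrightarrow> thesis\<close>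
    unfolding inseparable_def by (meson not_le)
  note le = norm_projection_le[OF proj]
  have one: "\<exists>E\<in>L. norm (\<xi> - blinfun_apply E \<xi>) < e \<and> (\<forall>\<eta>\<in>H. norm (blinfun_apply E \<eta>) < e)"
    if "finite H" "\<And>\<eta>. \<eta> \<in> H \<Longrightarrow> P \<eta> = 0" "P \<xi> = \<xi>" "e > 0" for H \<xi> e
    using that
  proof (induction H arbitrary: e rule: finite_induct)
    case empty
    then show ?case by (intro bexI[of _ id_blinfun] L_one) auto
  next
    case (insert \<eta> H)
    obtain E where E: "E \<in> L" "norm (\<xi> - blinfun_apply E \<xi>) < e/2" "\<And>\<eta>. \<eta> \<in> H \<Longrightarrow> norm (blinfun_apply E \<eta>) < e/2"
      using insert.IH[of "e/2"] insert.prems by auto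
    obtain F where F: "F \<in> L" "(norm (\<xi> - blinfun_apply F \<xi>))\<^sup>2 + (norm (blinfun_apply F \<eta>))\<^sup>2 < (e/2)\<^sup>2"
      using sep[of \<xi> \<eta> "(e/2)\<^sup>2"] insert.prems by auto
    have "(norm (\<xi> - F \<xi>))\<^sup>2 < (e/2)\<^sup>2" "(norm (F \<eta>))\<^sup>2 < (e/2)\<^sup>2"
      using F(2) zero_le_power2[of "norm (\<xi> - F \<xi>)"] zero_le_power2[of "norm (F \<eta>)"] by linarith+
    then have F': "norm (\<xi> - F \<xi>) < e/2" "norm (F \<eta>) < e/2"
      using insert.prems power_less_imp_less_base[of _ 2 "e/2"] by simp_all
    have EB: "E \<in> BB" and FB: "F \<in> BB" using E F L_sub by auto
    have "norm (\<xi> - E (F \<xi>)) \<le> norm (\<xi> - E \<xi>) + norm (E (\<xi> - F \<xi>))"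
      using norm_triangle_ineq[of "\<xi> - E \<xi>" "E (\<xi> - F \<xi>)"] by (simp add: blinfun.diff_right)
    also have "\<dots> < e" using le[OF EB, of "\<xi> - F \<xi>"] F'(1) E(2) by linarith
    finally have "norm (\<xi> - E (F \<xi>)) < e" .
    moreover have "norm (E (F \<eta>')) < e" if "\<eta>' \<in> insert \<eta> H" for \<eta>'
      using that le[OF EB, of "F \<eta>'"] le[OF FB, of "E \<eta>'"] commute[OF EB FB, of \<eta>'] E(3)[of \<eta>'] F'(2) insert.prems(3)
      by auto
    ultimately show ?case using L_meet[OF E(1) F(1)] by (intro bexI[of _ "E o\<^sub>L F"]) auto
  qed
  have all: "\<exists>E\<in>L. (\<forall>\<xi>\<in>\<Xi>. norm (\<xi> - blinfun_apply E \<xi>) < e) \<and> (\<forall>\<eta>\<in>H. norm (blinfun_apply E \<eta>) < e)"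
    if "finite \<Xi>" "finite H" "\<And>\<eta>. \<eta> \<in> H \<Longrightarrow> P \<eta> = 0" "\<And>\<xi>. \<xi> \<in> \<Xi> \<Longrightarrow> P \<xi> = \<xi>" "e > 0" for \<Xi> H e
    using that
  proof (induction \<Xi> arbitrary: e rule: finite_induct)
    case empty
    then show ?case by (intro bexI[of _ 0] L_zero) auto
  next
    case (insert \<xi> \<Xi>)
    obtain E where E: "E \<in> L" "\<And>\<xi>. \<xi> \<in> \<Xi> \<Longrightarrow> norm (\<xi> - blinfun_apply E \<xi>) < e/2" "\<And>\<eta>. \<eta> \<in> H \<Longrightarrow> norm (blinfun_apply E \<eta>) < e/2"
      using insert.IH[of "e/2"] insert.prems by auto
    obtain F where F: "F \<in> L" "norm (\<xi> - blinfun_apply F \<xi>) < e/2" "\<And>\<eta>. \<eta> \<in> H \<Longrightarrow> norm (blinfun_apply F \<eta>) < e/2"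
      using one[of H \<xi> "e/2"] insert.prems by auto
    have EB: "E \<in> BB" and FB: "F \<in> BB" using E F L_sub by auto
    let ?J = "E + F - (E o\<^sub>L F)"
    have J: "?J z = E z + F z - E (F z)" for z by (simp add: blinfun.add_left blinfun.diff_left)
    have "norm (z - ?J z) \<le> norm (z - E z)" "norm (z - ?J z) \<le> norm (z - F z)" for z
      using le[OF compl[OF EB], of "z - F z"] le[OF compl[OF FB], of "z - E z"] commute[OF EB FB, of z]
      by (simp_all add: J blinfun.add_left blinfun.diff_left blinfun.diff_right algebra_simps)
    then have "norm (z - ?J z) < e" if "z \<in> insert \<xi> \<Xi>" for z
      using that E(2)[of z] F(2) insert.prems(4) by (smt (verit) field_sum_of_halves insert_iff)
    moreover have "norm (?J z) < e" if "z \<in> H" for z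
    proof -
      have "?J z = E z + (id_blinfun - E) (F z)" by (simp add: blinfun.add_left blinfun.diff_left)
      then have "norm (?J z) \<le> norm (E z) + norm ((id_blinfun - E) (F z))" by (metis norm_triangle_ineq)
      then show ?thesis using le[OF compl[OF EB], of "F z"] E(3)[OF that] F(3)[OF that] by linarith
    qed
    ultimately show ?case using L_join[OF E(1) F(1)] by (intro bexI[of _ ?J]) auto
  qed
  have "P \<in> L"
  proof (rule strong_closed_approximation[OF closed])
    show "P \<in> bounded_ops" using proj[OF P(1)] by (rule projectionsD)
    fix Z :: "'a set" and e :: real assume Z: "finite Z" "e > 0"
    have "\<exists>E\<in>L. (\<forall>\<xi>\<in>P ` Z. norm (\<xi> - blinfun_apply E \<xi>) < e/2) \<and> (\<forall>\<eta>\<in>(\<lambda>z. z - P z) ` Z. norm (blinfun_apply E \<eta>) < e/2)"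
      using Z P(1) by (intro all) (auto simp: blinfun.diff_right)
    then obtain E where E: "E \<in> L" "\<And>z. z \<in> Z \<Longrightarrow> norm (P z - blinfun_apply E (P z)) < e/2"
      "\<And>z. z \<in> Z \<Longrightarrow> norm (blinfun_apply E (z - P z)) < e/2" by auto
    have "norm (E z - P z) < e" if "z \<in> Z" for z
    proof -
      have "E z - P z = E (z - P z) - (P z - E (P z))" by (simp add: blinfun.diff_right)
      then have "norm (E z - P z) \<le> norm (E (z - P z)) + norm (P z - E (P z))" by (metis norm_triangle_ineq4)
      then show ?thesis using E(2,3)[OF that] by linarith
    qed
    then show "\<exists>E\<in>L. \<forall>z\<in>Z. norm (blinfun_apply E z - P z) < e" using E(1) by blast
  qed
  then show False using P(2) by blast
qed

text \<open>The compressed positive operator moves \<open>\<xi>\<close>, which is in the range of \<open>P\<close>, to a vector that is not orthogonal to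
  \<open>\<eta>\<close> and hence not in the range of \<open>P\<close>. It lies in every admissible algebra by the bipolar criterion, since
  each annihilating functional, compressed to the two cyclic spaces, kills \<open>T\<close>.\<close>

lemma separating_operator_exists:
  assumes closed: "closedin (subtopology strong_operator_topology bounded_ops) L"
    and BB: "BB \<subseteq> commutant L" and P: "P \<in> BB" "P \<notin> L"
  obtains T where "T \<in> alg L" "\<not> blinfun_apply T ` range (blinfun_apply P) \<subseteq> range (blinfun_apply P)"
    "\<And>A. operator_algebra A \<Longrightarrow> closedin ultraweak_topology A \<Longrightarrow> commutant L \<subseteq> A \<Longrightarrow> lat A \<subseteq> L \<Longrightarrow> T \<in> A"
proof -
  obtain \<xi> \<eta> \<delta> where P\<xi>: "P \<xi> = \<xi>" and P\<eta>: "P \<eta> = 0" and \<delta>: "inseparable \<xi> \<eta> \<delta>"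
    using inseparable_pair_exists[OF closed P] by metis
  obtain T where T: "T \<in> bounded_ops" "positive_on BB \<xi> \<eta> (\<lambda>(x, y). cinner (blinfun_apply T x) y)"
    and T\<delta>: "\<delta> / 2 \<le> Re (cinner (blinfun_apply T \<xi>) \<eta>)"
    using positive_operator_exists[OF \<delta>] by metis
  obtain p where p: "p \<in> projections" "\<And>E x. E \<in> BB \<Longrightarrow> blinfun_apply p (blinfun_apply E x) = E (p x)"
    "\<And>x. blinfun_apply p x \<in> cyclic_space \<xi>" "\<And>x. x \<in> cyclic_space \<xi> \<Longrightarrow> blinfun_apply p x = x"
    by (rule cyclic_projection[of \<xi>]) (rule that; blast)
  obtain q where q: "q \<in> projections" "\<And>E x. E \<in> BB \<Longrightarrow> blinfun_apply q (blinfun_apply E x) = E (q x)"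
    "\<And>x. blinfun_apply q x \<in> cyclic_space \<eta>" "\<And>x. x \<in> cyclic_space \<eta> \<Longrightarrow> blinfun_apply q x = x"
    by (rule cyclic_projection[of \<eta>]) (rule that; blast)
  define T' where "T' = q o\<^sub>L T o\<^sub>L p"
  have T': "T' x = q (T (p x))" for x by (simp add: T'_def)
  have T'b: "T' \<in> bounded_ops" unfolding T'_def
    using p(1) q(1) T(1) projectionsD(1) bounded_ops_blinfun_arith(3) by blast
  show thesis
  proof (rule that[of T'])
    show "T' \<in> alg L"
      unfolding alg_def using T'b compression_leaves_lattice_invariant[OF T p(1-3) q(1-3)] by (auto simp: T')
    show "\<not> blinfun_apply T' ` range (blinfun_apply P) \<subseteq> range (blinfun_apply P)"
    proof
      assume "blinfun_apply T' ` range (blinfun_apply P) \<subseteq> range (blinfun_apply P)"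
      then have "T' (P \<xi>) \<in> range (blinfun_apply P)" by blast
      then have PT: "P (T' \<xi>) = T' \<xi>" using range_projection_iff[OF proj[OF P(1)]] P\<xi> by simp
      have "p \<xi> = \<xi>" "q \<eta> = \<eta>" using p(4) q(4) simple_in_cyclic[OF self_simple] by auto
      then have "cinner (T \<xi>) \<eta> = cinner (T' \<xi>) \<eta>" by (simp add: T' projectionsD[OF q(1)])
      also have "\<dots> = 0" using cinner_move[OF P(1), of "T' \<xi>" \<eta>] PT P\<eta> by simp
      finally show False using T\<delta> \<delta> unfolding inseparable_def by simp
    qed
    fix A assume A: "operator_algebra A" "closedin ultraweak_topology A" "commutant L \<subseteq> A" "lat A \<subseteq> L"
    show "T' \<in> A"
    proof (rule ultraweak_bipolar[OF A(1,2) T'b])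
      fix x y assume xy: "square_summable x" "square_summable y"
        and ann: "\<And>S. S \<in> A \<Longrightarrow> (\<Sum>n. cinner (blinfun_apply S (x n)) (y n)) = 0"
      have "(\<Sum>n. cinner (blinfun_apply S (p (x n))) (q (y n))) = 0" if "S \<in> A" for S
      proof -
        have "q o\<^sub>L S o\<^sub>L p \<in> A"
          using pq_in[OF A(1,3) BB p q] that by (intro operator_algebra_compose[OF A(1)])
        from ann[OF this] show ?thesis by (simp add: projectionsD[OF q(1)])
      qed
      then have "(\<Sum>n. cinner (blinfun_apply T (p (x n))) (q (y n))) = 0"
        by (intro annihilating_functional_kills_positive_operator[OF A(1,3) BB p q A(4) T]
            square_summable_apply xy p(3) q(3))
      then show "(\<Sum>n. cinner (blinfun_apply T' (x n)) (y n)) = 0"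
        by (simp add: T' projectionsD[OF q(1)])
    qed
  qed
qed

end

theorem corollary3p2:
  fixes L :: "('a::complex_hilbert_space \<Rightarrow>\<^sub>L 'a) set"
  assumes "commutative_subspace_lattice L"
  shows "\<exists>A\<^sub>0\<in>csl_algebras L. \<forall>A\<in>csl_algebras L. A\<^sub>0 \<subseteq> A"
proof -
  define BB where "BB = projections \<inter> commutant (commutant L)"
  have L: "L \<subseteq> projections" and comm: "\<And>P Q. P \<in> L \<Longrightarrow> Q \<in> L \<Longrightarrow> P o\<^sub>L Q = Q o\<^sub>L P"
    and closed: "closedin (subtopology strong_operator_topology bounded_ops) L"
    using assms unfolding commutative_subspace_lattice_def projection_lattice_def by auto
  interpret projection_sublattice BB L
    unfolding BB_def by (rule csl_projection_sublattice[OF assms])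
  have BBc: "BB \<subseteq> commutant L"
    unfolding BB_def by (rule bicommutant_projections_complete(3)[OF L comm])
  \<comment> \<open>Both \<open>alg L\<close> and the intersection of the class satisfy the condition on \<open>A\<close>. It is applied to \<open>alg L\<close>
    first, since the intersection has to be known to run over a nonempty class.\<close>
  have lat_subset: "lat A \<subseteq> L"
    if A: "commutant L \<subseteq> A" and mem: "\<And>T. T \<in> alg L \<Longrightarrow> (\<And>A. operator_algebra A \<Longrightarrow> closedin ultraweak_topology A \<Longrightarrow>
      commutant L \<subseteq> A \<Longrightarrow> lat A \<subseteq> L \<Longrightarrow> T \<in> A) \<Longrightarrow> T \<in> A" for A
  proof
    fix P assume P: "P \<in> lat A"
    then have "P \<in> lat (commutant L)" using A unfolding lat_def by blast
    then have PB: "P \<in> BB"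
      unfolding BB_def using invariant_projection_in_bicommutant[OF L] by (auto simp: lat_def)
    show "P \<in> L"
    proof (rule ccontr)
      assume "P \<notin> L"
      then obtain T where T: "T \<in> alg L" "\<not> blinfun_apply T ` range (blinfun_apply P) \<subseteq> range (blinfun_apply P)"
        "\<And>A. operator_algebra A \<Longrightarrow> closedin ultraweak_topology A \<Longrightarrow> commutant L \<subseteq> A \<Longrightarrow> lat A \<subseteq> L \<Longrightarrow> T \<in> A"
        using separating_operator_exists[OF closed BBc PB] by metis
      then have "T \<in> A" by (intro mem)
      then show False using P T(2) unfolding lat_def by blast
    qed
  qed
  have L_lat: "L \<subseteq> lat A" if "A \<subseteq> alg L" for A
    unfolding lat_def
  proof (rule subsetI, intro CollectI conjI ballI image_subsetI)
    fix P T x assume P: "P \<in> L"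
    show Pp: "P \<in> projections" using P L by (rule subsetD[rotated])
    assume T: "T \<in> A" and x: "x \<in> range (blinfun_apply P)"
    have Px: "P x = x" using x unfolding range_projection_iff[OF Pp] .
    have "T \<in> alg L" using that T by (rule subsetD)
    then have "P (T (P x)) = T (P x)" unfolding alg_def using P by simp
    then show "T x \<in> range (blinfun_apply P)" unfolding range_projection_iff[OF Pp] Px .
  qed
  have "lat (alg L) = L"
    using lat_subset[OF commutant_subset_alg[OF L]] L_lat[of "alg L"] by blast
  then have alg: "alg L \<in> csl_algebras L"
    unfolding csl_algebras_def using operator_algebra_alg[OF L] ultraweak_closed_alg[OF L] commutant_subset_alg[OF L] by blast
  define A\<^sub>0 where "A\<^sub>0 = \<Inter>(csl_algebras L)"
  have "operator_algebra A\<^sub>0"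
    unfolding operator_algebra_def
  proof (intro conjI ballI allI)
    show "A\<^sub>0 \<subseteq> bounded_ops" using alg operator_algebra_bounded unfolding A\<^sub>0_def csl_algebras_def by blast
  qed (auto simp: A\<^sub>0_def csl_algebras_def operator_algebra_def)
  moreover have "closedin ultraweak_topology A\<^sub>0"
    unfolding A\<^sub>0_def using alg by (intro closedin_Inter) (auto simp: csl_algebras_def)
  moreover have comm0: "commutant L \<subseteq> A\<^sub>0" unfolding A\<^sub>0_def csl_algebras_def by blast
  moreover have "lat A\<^sub>0 \<subseteq> L"
    by (rule lat_subset[OF comm0]) (auto simp: A\<^sub>0_def csl_algebras_def)
  moreover have "L \<subseteq> lat A\<^sub>0" using alg by (intro L_lat) (auto simp: A\<^sub>0_def)
  ultimately have "A\<^sub>0 \<in> csl_algebras L" unfolding csl_algebras_def by blast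
  then show ?thesis unfolding A\<^sub>0_def by blast
qed

end
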